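(* In the Bradley–Terry model, let $r>2$ be a fixed integer and suppose $b_n^{11}/c_n^6=o\big(n^{1/2}/(\log n)^{5/2}\big)$. Under the homogeneous null $H_0:\beta_2=\cdots=\beta_r$ (true parameter satisfying it), with $\hat{\boldsymbol\beta}^0$ the maximizer of $\ell_{bt}$ over $\{\boldsymbol\gamma\in\mathbb R^{n-1}:\gamma_2=\cdots=\gamma_r\}$, the statistic $2\{\ell_{bt}(\hat{\boldsymbol\beta})-\ell_{bt}(\hat{\boldsymbol\beta}^0)\}$ converges in distribution to the chi-square distribution with $r-2$ degrees of freedom as $n\to\infty$.
   Context: All quantities may depend on $n$; asymptotics are as $n\to\infty$. Bradley–Terry model: $n$ items; for each pair $1\le i<j\le n$ a number of comparisons $k_{ij}=k_{ji}\in\{1,\dots,K\}$ with $K$ a fixed constant; $a_{ij}\sim\mathrm{Binomial}(k_{ij},p_{ij})$ with $p_{ij}=e^{\beta_i-\beta_j}/(1+e^{\beta_i-\beta_j})$, $a_{ji}=k_{ij}-a_{ij}$, and $a_{ij}$, $1\le i<j\le n$, mutually independent. $\beta_1=0$; the parameter is $\boldsymbol\beta=(\beta_2,\dots,\beta_n)^\top$. $d_i=\sum_{j\ne i}a_{ij}$. $\ell_{bt}(\boldsymbol\gamma)=\sum_{i=1}^n\gamma_id_i-\sum_{1\le i<j\le n}k_{ij}\log(e^{\gamma_i}+e^{\gamma_j})$ with $\gamma_1=0$; $\hat{\boldsymbol\beta}$ is its maximizer over $\mathbb R^{n-1}$. $b_n=\max_{i\ne j}(1+e^{\beta_i-\beta_j})^2/e^{\beta_i-\beta_j}$,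 $c_n=\min_{i\ne j}(1+e^{\beta_i-\beta_j})^2/e^{\beta_i-\beta_j}$ at the true parameter. *)

theory Defs
  imports "HOL-Probability.Probability" "HOL-Library.Landau_Symbols"
begin

definition bt_pairs :: "nat \<Rightarrow> (nat \<times> nat) set" where
  "bt_pairs n = {(i, j). 1 \<le> i \<and> i < j \<and> j \<le> n}"

definition bt_prob :: "(nat \<Rightarrow> real) \<Rightarrow> nat \<Rightarrow> nat \<Rightarrow> real" where
  "bt_prob \<beta> i j = exp (\<beta> i - \<beta> j) / (1 + exp (\<beta> i - \<beta> j))"

definition bt_data :: "nat \<Rightarrow> (nat \<Rightarrow> nat \<Rightarrow> nat) \<Rightarrow> (nat \<Rightarrow> real) \<Rightarrow> (nat \<times> nat \<Rightarrow> nat) pmf" where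
  "bt_data n k \<beta> = Pi_pmf (bt_pairs n) 0 (\<lambda>(i, j). binomial_pmf (k i j) (bt_prob \<beta> i j))"

definition bt_win :: "(nat \<Rightarrow> nat \<Rightarrow> nat) \<Rightarrow> (nat \<times> nat \<Rightarrow> nat) \<Rightarrow> nat \<Rightarrow> nat \<Rightarrow> nat" where
  "bt_win k a i j = (if i < j then a (i, j) else k j i - a (j, i))"

definition bt_degree :: "nat \<Rightarrow> (nat \<Rightarrow> nat \<Rightarrow> nat) \<Rightarrow> (nat \<times> nat \<Rightarrow> nat) \<Rightarrow> nat \<Rightarrow> nat" where
  "bt_degree n k a i = (\<Sum>j\<in>{1..n} - {i}. bt_win k a i j)"

definition bt_loglik :: "nat \<Rightarrow> (nat \<Rightarrow> nat \<Rightarrow> nat) \<Rightarrow> (nat \<times> nat \<Rightarrow> nat) \<Rightarrow> (nat \<Rightarrow> real) \<Rightarrow> real" where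
  "bt_loglik n k a \<gamma> =
     (\<Sum>i=1..n. \<gamma> i * real (bt_degree n k a i))
     - (\<Sum>(i, j)\<in>bt_pairs n. real (k i j) * ln (exp (\<gamma> i) + exp (\<gamma> j)))"

(* parameter space R^{n-1}: gamma_1 = 0; only coordinates 1..n matter *)
definition bt_param_space :: "(nat \<Rightarrow> real) set" where
  "bt_param_space = {\<gamma>. \<gamma> 1 = 0}"

definition bt_null_space :: "nat \<Rightarrow> (nat \<Rightarrow> real) set" where
  "bt_null_space r = {\<gamma>. \<gamma> 1 = 0 \<and> (\<forall>i\<in>{2..r}. \<gamma> i = \<gamma> 2)}"

(* likelihood ratio statistic 2 { l(beta_hat) - l(beta_hat^0) }, written with the suprema
   of l over the two parameter sets (= values at the maximizers whenever these exist) *)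
definition bt_lr_stat :: "nat \<Rightarrow> nat \<Rightarrow> (nat \<Rightarrow> nat \<Rightarrow> nat) \<Rightarrow> (nat \<times> nat \<Rightarrow> nat) \<Rightarrow> real" where
  "bt_lr_stat n r k a =
     2 * ((SUP \<gamma>\<in>bt_param_space. bt_loglik n k a \<gamma>) - (SUP \<gamma>\<in>bt_null_space r. bt_loglik n k a \<gamma>))"

definition bt_b :: "nat \<Rightarrow> (nat \<Rightarrow> real) \<Rightarrow> real" where
  "bt_b n \<beta> = Max {(1 + exp (\<beta> i - \<beta> j))^2 / exp (\<beta> i - \<beta> j) | i j. i \<in> {1..n} \<and> j \<in> {1..n} \<and> i \<noteq> j}"

definition bt_c :: "nat \<Rightarrow> (nat \<Rightarrow> real) \<Rightarrow> real" where
  "bt_c n \<beta> = Min {(1 + exp (\<beta> i - \<beta> j))^2 / exp (\<beta> i - \<beta> j) | i j. i \<in> {1..n} \<and> j \<in> {1..n} \<and> i \<noteq> j}"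

definition chi_square_density :: "nat \<Rightarrow> real \<Rightarrow> real" where
  "chi_square_density m x =
     (if x > 0 then x powr (real m / 2 - 1) * exp (- x / 2) / (2 powr (real m / 2) * Gamma (real m / 2))
      else 0)"

definition chi_square :: "nat \<Rightarrow> real measure" where
  "chi_square m = density lborel (\<lambda>x. ennreal (chi_square_density m x))"

end

theory Submission
  imports Defs
begin

text \<open>
  Write \<open>V\<close> for the Hessian of the negative log-likelihood at the truth, a weighted Laplacian of the
  complete graph. Since \<open>\<beta>\<^sub>2 = \<beta>\<^sub>3\<close> under the null hypothesis, \<open>c\<^sub>n \<le> 4\<close>, and the rate condition says that a
  power of \<open>b\<^sub>n\<close> is small against \<open>n\<close>. Let \<open>R = {2..r}\<close> and let \<open>S\<close> be the set of the other items.

  Existence and uniform consistency of the maximum likelihood estimator \<open>\<beta> + e\<close>: at the items where \<open>e\<close>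
  is largest and smallest, all terms of the score equation have the same sign, and adding the two
  equations bounds the oscillation of \<open>e\<close> by the largest score over \<open>n / b\<^sub>n\<close>. The same argument solves
  \<open>V z = \<pi>\<close> with a sup-norm bound.

  Expanding the log-likelihood around the unrestricted estimator leaves no linear term, and the
  restricted problem reduces, up to \<open>o(1)\<close>, to minimising \<open>\<Sum>i\<in>R. A\<^sub>i (e\<^sub>i - c)\<^sup>2\<close> over \<open>c\<close>, where \<open>A\<^sub>i\<close> is the
  total weight of the comparisons of \<open>i\<close> with \<open>S\<close>. Self-concordance of the logistic potential
  (its second derivative changes by at most the factor \<open>exp \<bar>h\<bar>\<close> over a step \<open>h\<close>) controls the remainders.

  Solving \<open>V f = 1\<^sub>i - 1/n\<close> and pairing with the score equation gives \<open>e\<^sub>i = x\<^sub>i / A\<^sub>i + const + o(n\<^sup>-\<^sup>1\<^sup>/\<^sup>2)\<close> for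
  \<open>i \<in> R\<close>, with \<open>x\<^sub>i\<close> the centred number of wins of \<open>i\<close> against \<open>S\<close>; these are independent.

  Finally, the Laplace transform of the weighted variance of \<open>x\<^sub>i / A\<^sub>i\<close> is computed by Lindeberg
  replacement, where the Gaussian convolution of \<open>exp (- \<lambda> Q)\<close> is explicit, so that no Gaussian vector is
  needed. Convergence of Laplace transforms at positive integers implies weak convergence by
  Weierstrass approximation in the variable \<open>exp (- x)\<close>.
\<close>

section \<open>The logistic function and its Bregman divergence\<close>

text \<open>Every error term is compared with one parameter,
  \<open>t = b ^ 5 * l ^ 3 / sqrt n\<close> with \<open>l = sqrt (ln n)\<close>; the rate condition
  enters as the convergence of \<open>t\<close> to 0. The power 5 of \<open>b\<close> arises because
  the expansion of the estimator is accurate to order \<open>b ^ 4 * l\<^sup>2 / n\<close>, and this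
  error meets increments of order \<open>b * l / sqrt n\<close> in a quadratic form of total weight
  at most of order \<open>n\<close>.

  The restricted estimator is hard to control a priori, so it is never constructed: one trial point
  bounds the statistic from above, and an estimate over all constrained points, with long increments
  clipped, bounds it from below. Comparisons inside \<open>R\<close> would couple the coordinates;
  as each item has boundedly many of them, only the comparisons of \<open>R\<close> with
  \<open>S\<close> are kept. The solution \<open>f\<close> does not depend on the data, so its
  pairing with the scores is a linear statistic, open to Hoeffding's inequality. One of the
  \<open>r - 1\<close> coordinates in \<open>R\<close> is lost to the free common level
  \<open>c\<close>, which leaves \<open>r - 2\<close> degrees of freedom.\<close>

definition logistic :: "real \<Rightarrow> real" where
  "logistic t = exp t / (1 + exp t)"

definition softplus :: "real \<Rightarrow> real" where
  "softplus t = ln (1 + exp t)"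

definition dlogistic :: "real \<Rightarrow> real" where
  "dlogistic t = exp t / (1 + exp t)\<^sup>2"

lemma one_plus_exp_pos [simp]: "1 + exp t > (0::real)" "1 + exp t \<noteq> (0::real)"
proof -
  show "1 + exp t > (0::real)" by (rule add_pos_pos) auto
  then show "1 + exp t \<noteq> (0::real)" by simp
qed

lemma DERIV_softplus [derivative_intros]:
  "(softplus has_real_derivative logistic t) (at t)"
  unfolding softplus_def[abs_def] logistic_def
  by (auto intro!: derivative_eq_intros simp: field_simps)

lemma DERIV_logistic [derivative_intros]:
  "(logistic has_real_derivative dlogistic t) (at t)"
  unfolding logistic_def[abs_def] dlogistic_def
  by (auto intro!: derivative_eq_intros simp: field_simps power2_eq_square)

lemma logistic_minus: "logistic (- t) = 1 - logistic t"
  unfolding logistic_def by (simp add: exp_minus field_simps)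

lemma logistic_bounds: "0 < logistic t" "logistic t < 1"
  unfolding logistic_def by (auto simp: field_simps intro: add_pos_pos)

lemma dlogistic_minus: "dlogistic (- t) = dlogistic t"
  unfolding dlogistic_def by (simp add: exp_minus field_simps power2_eq_square)

lemma dlogistic_eq: "dlogistic t = logistic t * (1 - logistic t)"
  unfolding dlogistic_def logistic_def by (simp add: field_simps power2_eq_square)

lemma dlogistic_pos: "dlogistic t > 0"
  unfolding dlogistic_def by (simp add: zero_less_power)

lemma dlogistic_le: "dlogistic t \<le> 1 / 4"
proof -
  have "0 \<le> (logistic t - 1/2)\<^sup>2" by simp
  then show ?thesis unfolding dlogistic_eq by (simp add: power2_eq_square algebra_simps)
qed

text \<open>The logarithmic derivative of \<open>dlogistic\<close> is
  \<open>1 - 2 * logistic t\<close>, which lies in [-1, 1]; hence the factor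
  \<open>exp \<bar>s - t\<bar>\<close>. The two cases check this directly after clearing
  denominators.\<close>

lemma dlogistic_shift_le: "dlogistic s \<le> exp \<bar>s - t\<bar> * dlogistic t"
proof -
  have 1: "exp s * (1 + exp t)\<^sup>2 \<le> exp \<bar>s - t\<bar> * exp t * (1 + exp s)\<^sup>2"
  proof (cases "s \<ge> t")
    case True
    have "exp s * (1 + exp t)\<^sup>2 \<le> exp s * (1 + exp s)\<^sup>2"
      using True by (intro mult_left_mono power_mono add_mono) (auto intro: add_nonneg_nonneg)
    also have "\<dots> = exp \<bar>s - t\<bar> * exp t * (1 + exp s)\<^sup>2" using True by (simp flip: exp_add)
    finally show ?thesis .
  next
    case False
    have "exp s * (1 + exp t)\<^sup>2 \<le> exp s * (exp (t - s) * (1 + exp s))\<^sup>2"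
    proof (intro mult_left_mono power_mono)
      show "1 + exp t \<le> exp (t - s) * (1 + exp s)"
        using False by (simp add: distrib_left flip: exp_add)
    qed (auto intro: add_nonneg_nonneg)
    also have "\<dots> = (exp s * exp (t - s) * exp (t - s)) * (1 + exp s)\<^sup>2"
      by (simp add: power2_eq_square)
    also have "exp s * exp (t - s) * exp (t - s) = exp \<bar>s - t\<bar> * exp t"
      using False by (simp flip: exp_add)
    finally show ?thesis .
  qed
  then show ?thesis
    unfolding dlogistic_def by (simp add: field_simps)
qed

lemma dlogistic_shift_ge: "exp (- \<bar>s - t\<bar>) * dlogistic t \<le> dlogistic s"
proof -
  have "exp (- \<bar>s - t\<bar>) * dlogistic t \<le> exp (- \<bar>s - t\<bar>) * (exp \<bar>t - s\<bar> * dlogistic s)"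
    by (intro mult_left_mono dlogistic_shift_le) auto
  also have "\<dots> = dlogistic s"
    by (simp add: abs_minus_commute exp_minus)
  finally show ?thesis .
qed

text \<open>Integrating \<open>exp (- s) * dlogistic t \<le> dlogistic (t + s)\<close> over s in
  [0, h] gives this bound, which saturates but stays valid for large \<open>h\<close>. In place of
  the integral, the proof uses an exact formula for the difference of the two sides.\<close>

lemma logistic_increment_ge:
  assumes "h \<ge> 0"
  shows "dlogistic t * (1 - exp (- h)) \<le> logistic (t + h) - logistic t"
proof -
  define E F where "E = exp t" and "F = exp h"
  have E: "E > 0" and F: "F \<ge> 1" using assms by (auto simp: E_def F_def)
  have "E / (1 + E)\<^sup>2 * (1 - 1 / F) \<le> E * F / (1 + E * F) - E / (1 + E)"
  proof -
    have EF: "E * F > 0" using E F by simp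
    have "E * F / (1 + E * F) - E / (1 + E) - E / (1 + E)\<^sup>2 * (1 - 1 / F)
        = E * (F - 1) ^ 2 / ((1 + E * F) * (1 + E)\<^sup>2 * F)"
      using E F EF add_pos_pos[OF zero_less_one EF] add_pos_pos[OF zero_less_one E]
      by (simp add: divide_simps) (simp add: algebra_simps power2_eq_square)
    also have "\<dots> \<ge> 0" using E F by simp
    finally show ?thesis by simp
  qed
  then show ?thesis
    unfolding dlogistic_def logistic_def E_def F_def by (simp add: exp_add exp_minus field_simps)
qed

lemma logistic_taylor:
  assumes "\<bar>h\<bar> \<le> 1"
  shows "\<bar>logistic (t + h) - logistic t - dlogistic t * h\<bar> \<le> h\<^sup>2"
proof -
  have "\<exists>\<xi>. \<bar>\<xi> - t\<bar> \<le> \<bar>h\<bar> \<and> logistic (t + h) - logistic t = dlogistic \<xi> * h"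
  proof (cases h "0::real" rule: linorder_cases)
    case less
    obtain z where "z > t + h" "z < t" "logistic t - logistic (t + h) = (t - (t + h)) * dlogistic z"
      using MVT2[of "t + h" t logistic dlogistic] less DERIV_logistic by auto
    then show ?thesis by (intro exI[of _ z]) (auto simp: algebra_simps)
  next
    case greater
    obtain z where "z > t" "z < t + h" "logistic (t + h) - logistic t = (t + h - t) * dlogistic z"
      using MVT2[of t "t + h" logistic dlogistic] greater DERIV_logistic by auto
    then show ?thesis by (intro exI[of _ z]) (auto simp: algebra_simps)
  qed (auto intro: exI[of _ t])
  then obtain \<xi> where \<xi>: "\<bar>\<xi> - t\<bar> \<le> \<bar>h\<bar>" "logistic (t + h) - logistic t = dlogistic \<xi> * h"
    by blast
  define d where "d = \<bar>\<xi> - t\<bar>"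
  have d: "0 \<le> d" "d \<le> 1" "d \<le> \<bar>h\<bar>" using \<xi>(1) assms by (auto simp: d_def)
  have e1: "exp d \<le> 1 + d + d\<^sup>2" by (rule exp_bound) (use d in auto)
  have e2: "exp (- d) \<ge> 1 - d" using exp_ge_add_one_self[of "-d"] by simp
  have d2: "d\<^sup>2 \<le> d" using d by (simp add: power2_eq_square mult_left_le)
  have q: "0 \<le> dlogistic t" "dlogistic t \<le> 1 / 4" using dlogistic_pos[of t] dlogistic_le[of t] by auto
  have "dlogistic \<xi> - dlogistic t \<le> (exp d - 1) * dlogistic t"
    using dlogistic_shift_le[of \<xi> t] by (simp add: d_def algebra_simps)
  also have "\<dots> \<le> (2 * d) * (1 / 4)"
    using e1 d2 q d by (intro mult_mono) auto
  finally have u: "dlogistic \<xi> - dlogistic t \<le> d" using d by simp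
  have "dlogistic t - dlogistic \<xi> \<le> (1 - exp (- d)) * dlogistic t"
    using dlogistic_shift_ge[of \<xi> t] by (simp add: d_def algebra_simps)
  also have "\<dots> \<le> d * (1 / 4)"
    using e2 q d by (intro mult_mono) auto
  finally have "dlogistic t - dlogistic \<xi> \<le> d" using d by simp
  with u have "\<bar>dlogistic \<xi> - dlogistic t\<bar> \<le> \<bar>h\<bar>" using d by linarith
  then have "\<bar>dlogistic \<xi> - dlogistic t\<bar> * \<bar>h\<bar> \<le> \<bar>h\<bar> * \<bar>h\<bar>"
    by (intro mult_right_mono) auto
  then have "\<bar>(dlogistic \<xi> - dlogistic t) * h\<bar> \<le> h\<^sup>2"
    by (simp only: abs_mult power2_eq_square abs_mult_self_eq)
  then show ?thesis using \<xi>(2) by (simp add: algebra_simps)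
qed

definition bregman :: "real \<Rightarrow> real \<Rightarrow> real" where
  "bregman t h = softplus (t + h) - softplus t - logistic t * h"

lemma bregman_lagrange:
  "\<exists>\<xi>. \<bar>\<xi> - t\<bar> \<le> \<bar>h\<bar> \<and> bregman t h = dlogistic \<xi> * h\<^sup>2 / 2"
proof (cases "h = 0")
  case False
  define df :: "nat \<Rightarrow> real \<Rightarrow> real" where
    "df = (\<lambda>m. if m = 0 then (\<lambda>s. softplus (t + s)) else if m = 1 then (\<lambda>s. logistic (t + s)) else (\<lambda>s. dlogistic (t + s)))"
  have "(df m has_real_derivative df (Suc m) s) (at s)" if "m < 2" for m s
    using that DERIV_shift[of softplus "logistic (t + s)" s t] DERIV_shift[of logistic "dlogistic (t + s)" s t]
      DERIV_softplus[of "t + s"] DERIV_logistic[of "t + s"]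
    by (auto simp: df_def less_2_cases_iff add.commute)
  then obtain s where s: "\<bar>s\<bar> \<le> \<bar>h\<bar>"
      "softplus (t + h) = (\<Sum>m<2. df m 0 / fact m * h ^ m) + df 2 s / fact 2 * h ^ 2"
    using Maclaurin_bi_le[where diff = df and f = "\<lambda>s. softplus (t + s)" and x = h and n = 2]
    by (auto simp: df_def)
  show ?thesis
    by (rule exI[of _ "t + s"]) (use s in \<open>auto simp: df_def bregman_def numeral_2_eq_2\<close>)
qed (auto simp: bregman_def intro: exI[of _ t])

lemma bregman_nonneg: "bregman t h \<ge> 0"
proof -
  obtain \<xi> where "bregman t h = dlogistic \<xi> * h\<^sup>2 / 2" using bregman_lagrange by blast
  moreover have "dlogistic \<xi> * h\<^sup>2 \<ge> 0" using dlogistic_pos[of \<xi>] by simp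
  ultimately show ?thesis by linarith
qed

lemma bregman_upper:
  "2 * bregman (\<theta> + d) h \<le> exp (\<bar>d\<bar> + \<bar>h\<bar>) * (dlogistic \<theta> * h\<^sup>2)"
proof -
  obtain \<xi> where \<xi>: "\<bar>\<xi> - (\<theta> + d)\<bar> \<le> \<bar>h\<bar>" "bregman (\<theta> + d) h = dlogistic \<xi> * h\<^sup>2 / 2"
    using bregman_lagrange by blast
  have "dlogistic \<xi> \<le> exp \<bar>\<xi> - \<theta>\<bar> * dlogistic \<theta>" by (rule dlogistic_shift_le)
  also have "\<dots> \<le> exp (\<bar>d\<bar> + \<bar>h\<bar>) * dlogistic \<theta>"
    using \<xi>(1) dlogistic_pos[of \<theta>] by (intro mult_right_mono) auto
  finally show ?thesis unfolding \<xi>(2) by (simp add: mult_right_mono flip: mult.assoc)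
qed

lemma bregman_lower:
  "exp (- (\<bar>d\<bar> + \<bar>h\<bar>)) * (dlogistic \<theta> * h\<^sup>2) \<le> 2 * bregman (\<theta> + d) h"
proof -
  obtain \<xi> where \<xi>: "\<bar>\<xi> - (\<theta> + d)\<bar> \<le> \<bar>h\<bar>" "bregman (\<theta> + d) h = dlogistic \<xi> * h\<^sup>2 / 2"
    using bregman_lagrange by blast
  have "exp (- (\<bar>d\<bar> + \<bar>h\<bar>)) * dlogistic \<theta> \<le> exp (- \<bar>\<xi> - \<theta>\<bar>) * dlogistic \<theta>"
    using \<xi>(1) dlogistic_pos[of \<theta>] by (intro mult_right_mono) auto
  also have "\<dots> \<le> dlogistic \<xi>" by (rule dlogistic_shift_ge)
  finally show ?thesis unfolding \<xi>(2) by (simp add: mult_right_mono flip: mult.assoc)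
qed

text \<open>A convex function of \<open>h\<close> with minimum 0 at the origin grows along each ray.
  This permits shrinking an increment before a local lower bound is applied to it.\<close>

lemma bregman_scale_le:
  assumes "0 \<le> c" "c \<le> 1"
  shows "bregman t (c * h) \<le> bregman t h"
proof -
  have D: "((\<lambda>s. bregman t (s * h)) has_real_derivative (logistic (t + s * h) - logistic t) * h) (at s)" for s
    unfolding bregman_def
    by (auto intro!: derivative_eq_intros DERIV_chain2[OF DERIV_softplus] simp: algebra_simps)
  have mono: "mono logistic"
    by (rule monoI, rule DERIV_nonneg_imp_nondecreasing)
       (auto intro!: DERIV_logistic less_imp_le[OF dlogistic_pos] exI)
  have nn: "(logistic (t + s * h) - logistic t) * h \<ge> 0" if "s \<ge> 0" for s
  proof (cases "h \<ge> 0")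
    case True
    with that show ?thesis by (intro mult_nonneg_nonneg) (auto intro: monoD[OF mono])
  next
    case False
    with that have "s * h \<le> 0" by (simp add: mult_le_0_iff)
    with False show ?thesis by (intro mult_nonpos_nonpos) (auto intro: monoD[OF mono])
  qed
  have "bregman t (c * h) \<le> bregman t (1 * h)"
    by (rule DERIV_nonneg_imp_nondecreasing[where f = "\<lambda>s. bregman t (s * h)"])
       (use assms D nn in \<open>auto intro!: exI\<close>)
  then show ?thesis by simp
qed

text \<open>The exponential factor in \<open>bregman_lower\<close> degenerates for long increments.
  Shrinking \<open>h\<close> to length at most \<epsilon> first gives a uniform factor, so the bound
  also serves constrained points far from the estimator.\<close>

lemma bregman_clip_lower:
  assumes "0 \<le> \<epsilon>"
  shows "exp (- (\<bar>d\<bar> + \<epsilon>)) * (dlogistic \<theta> * (min \<bar>h\<bar> \<epsilon>)\<^sup>2) \<le> 2 * bregman (\<theta> + d) h"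
proof -
  define c where "c = (if \<bar>h\<bar> \<le> \<epsilon> then 1 else \<epsilon> / \<bar>h\<bar>)"
  have c: "0 \<le> c" "c \<le> 1" "\<bar>c * h\<bar> = min \<bar>h\<bar> \<epsilon>"
    using assms by (auto simp: c_def abs_mult)
  have "exp (- (\<bar>d\<bar> + \<epsilon>)) * (dlogistic \<theta> * (min \<bar>h\<bar> \<epsilon>)\<^sup>2)
      \<le> exp (- (\<bar>d\<bar> + \<bar>c * h\<bar>)) * (dlogistic \<theta> * (c * h)\<^sup>2)"
  proof (intro mult_mono)
    show "(min \<bar>h\<bar> \<epsilon>)\<^sup>2 \<le> (c * h)\<^sup>2" unfolding c(3)[symmetric] by simp
  qed (use c(3) dlogistic_pos[of \<theta>] in auto)
  also have "\<dots> \<le> 2 * bregman (\<theta> + d) (c * h)" by (rule bregman_lower)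
  also have "\<dots> \<le> 2 * bregman (\<theta> + d) h" using bregman_scale_le[OF c(1,2)] by simp
  finally show ?thesis .
qed

section \<open>Critical points of edge potentials on a complete graph\<close>

lemma compact_unit_cube: "compact {f :: nat \<Rightarrow> real. \<forall>i. \<bar>f i\<bar> \<le> 1}"
proof -
  have "compactin (product_topology (\<lambda>i. euclidean) (UNIV :: nat set)) (PiE UNIV (\<lambda>i. {- 1..1::real}))"
    by (subst compactin_PiE) auto
  moreover have "PiE UNIV (\<lambda>i. {- 1..1::real}) = {f. \<forall>i::nat. \<bar>f i\<bar> \<le> 1}"
    by (auto simp: PiE_def Pi_def abs_le_iff minus_le_iff)
  ultimately show ?thesis by (simp add: euclidean_product_topology)
qed


text \<open>A maximiser of \<open>J\<close> over the unit cube may lie on the boundary, where its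
  gradient need not vanish. At its largest and smallest coordinates the one-sided conditions still
  have the useful sign, and adding them bounds the oscillation below 1. As \<open>x\<close> sums to
  zero, \<open>J\<close> is invariant under constant shifts; the shift vanishing at
  \<open>i0\<close> is then a maximiser with all coordinates in the open interval, hence critical.
  The lemma serves both the nonlinear likelihood equations and the linear corrector
  equation.\<close>

lemma edge_potential_critical_point:
  fixes I :: "nat set" and H G :: "nat \<Rightarrow> nat \<Rightarrow> real \<Rightarrow> real" and x :: "nat \<Rightarrow> real"
  assumes fin: "finite I" and i0: "i0 \<in> I" and b: "b > 0"
    and x0: "(\<Sum>i\<in>I. x i) = 0" and xX: "\<And>i. i \<in> I \<Longrightarrow> \<bar>x i\<bar> \<le> X"
    and Hd: "\<And>i j t. (H i j has_real_derivative G i j t) (at t)"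
    and anti: "\<And>i j t. G j i (- t) = - G i j t"
    and lower: "\<And>i j t. i \<in> I \<Longrightarrow> j \<in> I \<Longrightarrow> i \<noteq> j \<Longrightarrow> 0 \<le> t \<Longrightarrow> (1 - exp (- t)) / b \<le> G i j t"
    and small: "4 * b * X \<le> card I"
  obtains f where "f i0 = 0" "\<And>i j. i \<in> I \<Longrightarrow> j \<in> I \<Longrightarrow> \<bar>f i - f j\<bar> \<le> 4 * b * X / card I"
    "\<And>i. i \<in> I \<Longrightarrow> x i = (\<Sum>j\<in>I. G i j (f i - f j))"
proof -
  define J where "J = (\<lambda>f. (\<Sum>i\<in>I. x i * f i) - (\<Sum>i\<in>I. \<Sum>j\<in>I. H i j (f i - f j)) / 2)"
  define B where "B = {f :: nat \<Rightarrow> real. \<forall>i. \<bar>f i\<bar> \<le> 1}"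
  have G0: "G i i 0 = 0" for i using anti[of i i 0] by simp
  have contH: "continuous_on UNIV (H i j)" for i j
    using Hd by (intro DERIV_continuous_on) (auto intro: has_field_derivative_at_within)
  have cproj: "continuous_on B (\<lambda>f. f i)" for i :: nat
    by (rule continuous_on_subset[OF continuous_on_product_coordinates]) auto
  have "continuous_on B J"
    unfolding J_def
    by (intro continuous_intros cproj continuous_on_compose2[OF contH]) auto
  moreover have "compact B" unfolding B_def by (rule compact_unit_cube)
  moreover have "B \<noteq> {}" by (auto simp: B_def intro: exI[of _ "\<lambda>_. 0"])
  ultimately obtain f where fB: "f \<in> B" and fmax: "\<And>g. g \<in> B \<Longrightarrow> J g \<le> J f"
    using continuous_attains_sup[of B J] by blast
  define grad where "grad = (\<lambda>f m. x m - (\<Sum>j\<in>I. G m j (f m - f j)))"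
  have Jderiv: "((\<lambda>t. J (g(m := t))) has_real_derivative grad g m) (at (g m))" if m: "m \<in> I" for g m
  proof -
    have 1: "((\<lambda>t. x i * (g(m := t)) i) has_real_derivative (if i = m then x i else 0)) (at (g m))" for i
      by (auto intro!: derivative_eq_intros)
    have 2: "((\<lambda>t. H i j ((g(m := t)) i - (g(m := t)) j)) has_real_derivative
        (if i = m then G i j (g i - g j) else 0) - (if j = m then G i j (g i - g j) else 0)) (at (g m))" for i j
    proof -
      have "((\<lambda>t. (g(m := t)) i - (g(m := t)) j) has_real_derivative
          (if i = m then 1 else 0) - (if j = m then 1 else 0)) (at (g m))"
        by (auto intro!: derivative_eq_intros)
      from DERIV_chain2[OF Hd this, of i j] show ?thesis
        by (auto split: if_splits)
    qed
    have "((\<lambda>t. J (g(m := t))) has_real_derivative (\<Sum>i\<in>I. if i = m then x i else 0)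
      - (\<Sum>i\<in>I. \<Sum>j\<in>I. (if i = m then G i j (g i - g j) else 0) - (if j = m then G i j (g i - g j) else 0)) / 2) (at (g m))"
      unfolding J_def by (intro DERIV_diff DERIV_sum DERIV_cdivide 1 2)
    also have "(\<Sum>i\<in>I. if i = m then x i else 0) = x m" using fin m by simp
    also have "(\<Sum>i\<in>I. \<Sum>j\<in>I. (if i = m then G i j (g i - g j) else 0) - (if j = m then G i j (g i - g j) else 0))
      = (\<Sum>i\<in>I. (if i = m then \<Sum>j\<in>I. G i j (g i - g j) else 0)) - (\<Sum>i\<in>I. G i m (g i - g m))"
    proof -
      have "(\<Sum>j\<in>I. if i = m then G i j (g i - g j) else 0) = (if i = m then \<Sum>j\<in>I. G i j (g i - g j) else 0)" for i
        by simp
      then show ?thesis using fin m by (simp add: sum_subtractf)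
    qed
    also have "(\<Sum>i\<in>I. (if i = m then \<Sum>j\<in>I. G i j (g i - g j) else 0)) = (\<Sum>j\<in>I. G m j (g m - g j))"
      using fin m by simp
    also have "(\<Sum>i\<in>I. G i m (g i - g m)) = - (\<Sum>j\<in>I. G m j (g m - g j))"
    proof -
      have "G i m (g i - g m) = - G m i (g m - g i)" for i using anti[of i m "g m - g i"] by simp
      then show ?thesis by (simp add: sum_negf)
    qed
    finally show ?thesis by (simp add: grad_def fun_upd_def)
  qed
  have updB: "g(m := t) \<in> B" if "g \<in> B" "\<bar>t\<bar> \<le> 1" for g m t
    using that by (auto simp: B_def)
  \<comment> \<open>Stated for every maximiser \<open>g\<close>, because it is applied to
    \<open>f\<close> and later to its shift. Room below \<open>g m\<close> turns a negative
    derivative into an admissible improvement.\<close>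
  have grad_nonneg: "grad g m \<ge> 0" if gB: "g \<in> B" and gJ: "J g = J f" and mI: "m \<in> I" and gm: "g m > - 1" for g m
  proof (rule ccontr)
    assume "\<not> grad g m \<ge> 0"
    then obtain d where d: "d > 0" "\<And>h. 0 < h \<Longrightarrow> h < d \<Longrightarrow> J (g(m := g m)) < J (g(m := g m - h))"
      using DERIV_neg_dec_left[OF Jderiv[OF mI, of g]] by auto
    define h where "h = min (d / 2) (g m + 1)"
    have h: "0 < h" "h < d" "h \<le> g m + 1" using d(1) gm by (auto simp: h_def)
    have "\<bar>g m\<bar> \<le> 1" using gB by (auto simp: B_def)
    then have "\<bar>g m - h\<bar> \<le> 1" using h by linarith
    from fmax[OF updB[OF gB this, of m]] d(2)[OF h(1,2)] gJ show False by simp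
  qed
  have grad_nonpos: "grad g m \<le> 0" if gB: "g \<in> B" and gJ: "J g = J f" and mI: "m \<in> I" and gm: "g m < 1" for g m
  proof (rule ccontr)
    assume "\<not> grad g m \<le> 0"
    then obtain d where d: "d > 0" "\<And>h. 0 < h \<Longrightarrow> h < d \<Longrightarrow> J (g(m := g m)) < J (g(m := g m + h))"
      using DERIV_pos_inc_right[OF Jderiv[OF mI, of g]] by auto
    define h where "h = min (d / 2) (1 - g m)"
    have h: "0 < h" "h < d" "h \<le> 1 - g m" using d(1) gm by (auto simp: h_def)
    have "\<bar>g m\<bar> \<le> 1" using gB by (auto simp: B_def)
    then have "\<bar>g m + h\<bar> \<le> 1" using h by linarith
    from fmax[OF updB[OF gB this, of m]] d(2)[OF h(1,2)] gJ show False by simp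
  qed
  have ne: "f ` I \<noteq> {}" "finite (f ` I)" using i0 fin by auto
  obtain p where p: "p \<in> I" "f p = Max (f ` I)" using Max_in[OF ne(2,1)] by auto
  obtain q where q: "q \<in> I" "f q = Min (f ` I)" using Min_in[OF ne(2,1)] by auto
  have pm: "f i \<le> f p" "f q \<le> f i" if "i \<in> I" for i
    using that ne fin p(2) q(2) by auto
  define N where "N = real (card I)"
  have N: "N > 0" using fin i0 by (auto simp: N_def card_gt_0_iff)
  define w where "w = f p - f q"
  have w0: "w \<ge> 0" using pm[OF p(1)] by (simp add: w_def)
  have X0: "X \<ge> 0" using xX[OF i0] by linarith
  have wbound: "w \<le> 4 * b * X / N \<and> w < 1"
  proof (cases "w = 0")
    case True
    then show ?thesis using b X0 N by simp
  next
    case False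
    have fb: "\<bar>f p\<bar> \<le> 1" "\<bar>f q\<bar> \<le> 1" using fB by (auto simp: B_def)
    \<comment> \<open>Since \<open>f p\<close> and \<open>f q\<close> differ,
      \<open>f p > - 1\<close> and \<open>f q < 1\<close> hold even on the boundary of the
      cube.\<close>
    have gp: "grad f p \<ge> 0" using False w0 fb by (intro grad_nonneg fB p) (auto simp: w_def)
    have gq: "grad f q \<le> 0" using False w0 fb by (intro grad_nonpos fB q) (auto simp: w_def)
    have low: "(1 - exp (- t)) / b \<le> G i j t" if "i \<in> I" "j \<in> I" "0 \<le> t" "i = j \<Longrightarrow> t = 0" for i j t
      using lower[of i j t] that G0 by (cases "i = j") auto
    have "N * (1 - exp (- w)) / b = (\<Sum>j\<in>I. (1 - exp (- w)) / b)" by (simp add: N_def)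
    also have "\<dots> \<le> (\<Sum>j\<in>I. G p j (f p - f j) - G q j (f q - f j))"
    proof (rule sum_mono)
      fix j assume j: "j \<in> I"
      define s t where "s = f p - f j" and "t = f j - f q"
      have st: "s \<ge> 0" "t \<ge> 0" "w = s + t" using pm[OF j] by (auto simp: s_def t_def w_def)
      \<comment> \<open>Subadditivity of \<open>1 - exp (- t)\<close> makes each vertex
        \<open>j\<close> contribute the full oscillation \<open>w\<close>, wherever
        \<open>f j\<close> lies between the extremes.\<close>
      have "0 \<le> (1 - exp (- s)) * (1 - exp (- t))" using st by (intro mult_nonneg_nonneg) auto
      then have "1 - exp (- w) \<le> (1 - exp (- s)) + (1 - exp (- t))"
        by (simp only: st(3) minus_add_distrib exp_add) (simp add: algebra_simps)
      then have "(1 - exp (- w)) / b \<le> (1 - exp (- s)) / b + (1 - exp (- t)) / b"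
        using b by (simp add: divide_right_mono flip: add_divide_distrib)
      also have "\<dots> \<le> G p j s + G j q t"
        using p q j st by (intro add_mono low) (auto simp: s_def t_def)
      also have "G j q t = - G q j (- t)" using anti[of j q "- t"] by simp
      finally show "(1 - exp (- w)) / b \<le> G p j (f p - f j) - G q j (f q - f j)"
        by (simp add: s_def t_def)
    qed
    also have "\<dots> \<le> x p - x q" using gp gq by (simp add: grad_def sum_subtractf)
    also have "\<dots> \<le> 2 * X" using xX[OF p(1)] xX[OF q(1)] by linarith
    finally have *: "1 - exp (- w) \<le> 2 * b * X / N" using b N by (simp add: field_simps)
    also have "2 * b * X / N \<le> 1 / 2" using small N by (simp add: N_def field_simps)
    finally have "exp (- w) \<ge> 1 / 2" by simp
    then have "exp w \<le> 2" by (simp add: exp_minus field_simps)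
    moreover have "exp w > 2" if "w \<ge> 1"
    proof -
      have "1 + 1 + 1\<^sup>2 / 2 \<le> exp (1::real)" by (rule exp_lower_Taylor_quadratic) simp
      also have "exp 1 \<le> exp w" using that by simp
      finally show ?thesis by simp
    qed
    ultimately have w1: "w < 1" by force
    \<comment> \<open>For \<open>w\<close> in [0, 1] this makes the saturating bound linear. Its
      factor 2, times the 2 from using two vertices, is the constant 4 of the statement.\<close>
    have "exp (- w) \<le> 1 - w / 2"
    proof -
      have "exp (- w) \<le> 1 / (1 + w + w\<^sup>2 / 2)"
        using exp_lower_Taylor_quadratic[OF w0] w0 by (simp add: exp_minus field_simps add_pos_nonneg)
      also have "\<dots> \<le> 1 - w / 2"
      proof -
        have ww: "w * w \<le> 1" using w0 w1 by (simp add: mult_le_one)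
        have "(1 - w / 2) * (1 + w + w\<^sup>2 / 2) = 1 + w * (2 - w * w) / 4"
          by (simp add: field_simps power2_eq_square)
        also have "\<dots> \<ge> 1" using w0 ww by simp
        finally have "1 \<le> (1 - w / 2) * (1 + w + w\<^sup>2 / 2)" .
        then show ?thesis using w0 by (simp add: divide_le_eq add_pos_nonneg)
      qed
      finally show ?thesis .
    qed
    with * have "w \<le> 2 * (2 * b * X / N)" by linarith
    then have "w \<le> 4 * b * X / N" by simp
    with w1 show ?thesis by simp
  qed
  define g where "g = (\<lambda>i. if i \<in> I then f i - f i0 else 0)"
  have gd: "g i - g j = f i - f j" if "i \<in> I" "j \<in> I" for i j using that by (simp add: g_def)
  have gw: "\<bar>g i - g j\<bar> \<le> w" if "i \<in> I" "j \<in> I" for i j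
    using pm[OF that(1)] pm[OF that(2)] by (auto simp: gd that w_def)
  have g1: "\<bar>g i\<bar> < 1" for i
    using gw[of i i0] i0 wbound by (cases "i \<in> I") (auto simp: g_def)
  have gB: "g \<in> B" using g1 by (auto simp: B_def less_imp_le)
  have Jg: "J g = J f"
  proof -
    have "(\<Sum>i\<in>I. x i * g i) = (\<Sum>i\<in>I. x i * f i) - f i0 * (\<Sum>i\<in>I. x i)"
      by (simp add: g_def algebra_simps sum_subtractf sum_distrib_left)
    moreover have "(\<Sum>i\<in>I. \<Sum>j\<in>I. H i j (g i - g j)) = (\<Sum>i\<in>I. \<Sum>j\<in>I. H i j (f i - f j))"
      by (intro sum.cong refl) (simp add: gd)
    ultimately show ?thesis using x0 by (simp add: J_def)
  qed
  have "x i = (\<Sum>j\<in>I. G i j (g i - g j))" if "i \<in> I" for i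
  proof -
    have "g i > - 1" "g i < 1" using g1[of i] by auto
    then show ?thesis
      using grad_nonneg[OF gB Jg that] grad_nonpos[OF gB Jg that] by (simp add: grad_def)
  qed
  moreover have "g i0 = 0" using i0 by (simp add: g_def)
  moreover have "\<bar>g i - g j\<bar> \<le> 4 * b * X / card I" if "i \<in> I" "j \<in> I" for i j
    using gw[OF that] wbound by (simp add: N_def)
  ultimately show ?thesis using that by blast
qed

section \<open>Lindeberg replacement along an explicit heat flow\<close>

lemma exp_minus_poly_bounds:
  fixes x :: real
  assumes "x \<ge> 0"
  shows "x * exp (- x) \<le> 1" "x\<^sup>2 * exp (- x) \<le> 2"
proof -
  have *: "1 + x + x\<^sup>2 / 2 \<le> exp x" by (rule exp_lower_Taylor_quadratic[OF assms])
  have "x \<le> exp x" using * assms zero_le_power2[of x] by linarith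
  then show "x * exp (- x) \<le> 1" by (simp add: exp_minus field_simps)
  have "x\<^sup>2 \<le> 2 * exp x" using * assms by linarith
  then show "x\<^sup>2 * exp (- x) \<le> 2" by (simp add: exp_minus field_simps)
qed

text \<open>The third derivative is \<open>c ^ 3\<close> times a bounded function of
  \<open>c * (y + s)\<close>. The coefficient of \<open>h\<^sup>2\<close> is the one that reappears
  as the time derivative in \<open>gaussian_taylor_time\<close>; this agreement is the heat
  equation.\<close>

lemma gaussian_taylor_space:
  fixes c y h :: real
  assumes c: "c \<ge> 0"
  shows "\<bar>exp (- (c * (y + h))\<^sup>2) - exp (- (c * y)\<^sup>2) * (1 - 2 * c\<^sup>2 * y * h + (2 * c ^ 4 * y\<^sup>2 - c\<^sup>2) * h\<^sup>2)\<bar>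
       \<le> 4 * c ^ 3 * \<bar>h\<bar> ^ 3"
proof -
  define u where "u = (\<lambda>s. exp (- (c * (y + s))\<^sup>2))"
  define df :: "nat \<Rightarrow> real \<Rightarrow> real" where
    "df = (\<lambda>m s. if m = 0 then u s else if m = 1 then - 2 * c\<^sup>2 * (y + s) * u s
       else if m = 2 then (4 * c ^ 4 * (y + s)\<^sup>2 - 2 * c\<^sup>2) * u s
       else (12 * c ^ 4 * (y + s) - 8 * c ^ 6 * (y + s) ^ 3) * u s)"
  have du: "(u has_real_derivative - 2 * c\<^sup>2 * (y + s) * u s) (at s)" for s
    unfolding u_def by (auto intro!: derivative_eq_intros simp: power2_eq_square algebra_simps)
  have "(df m has_real_derivative df (Suc m) s) (at s)" if "m < 3" for m s
  proof -
    have "m = 0 \<or> m = 1 \<or> m = 2" using that by auto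
    then consider "m = 0" | "m = 1" | "m = 2" by blast
    then show ?thesis
    proof cases
      case 1
      then show ?thesis using du by (simp add: df_def[abs_def])
    qed (simp add: df_def[abs_def], auto intro!: derivative_eq_intros du
          simp: algebra_simps power2_eq_square power3_eq_cube eval_nat_numeral)+
  qed
  then obtain s where s: "\<bar>s\<bar> \<le> \<bar>h\<bar>"
      "u h = (\<Sum>m<3. df m 0 / fact m * h ^ m) + df 3 s / fact 3 * h ^ 3"
    using Maclaurin_bi_le[where diff = df and f = u and x = h and n = 3] by (auto simp: df_def fun_eq_iff)
  have 3: "df 3 s = c ^ 3 * ((12 * (c * (y + s)) - 8 * (c * (y + s)) ^ 3) * exp (- (c * (y + s))\<^sup>2))"
    by (simp add: df_def u_def algebra_simps power_mult_distrib eval_nat_numeral)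
  define z where "z = c * (y + s)"
  have "\<bar>(12 * z - 8 * z ^ 3) * exp (- z\<^sup>2)\<bar> \<le> 20"
  proof -
    define t where "t = \<bar>z\<bar>"
    have t0: "t \<ge> 0" by (simp add: t_def)
    have zz: "z\<^sup>2 = t\<^sup>2" by (simp add: t_def)
    have lb: "1 + t\<^sup>2 + (t\<^sup>2)\<^sup>2 / 2 \<le> exp (t\<^sup>2)" by (rule exp_lower_Taylor_quadratic) simp
    have "0 \<le> (t - 1)\<^sup>2" "0 \<le> (t\<^sup>2 - t)\<^sup>2" by simp_all
    then have t1: "2 * t \<le> t\<^sup>2 + 1" and t3: "2 * t ^ 3 \<le> (t\<^sup>2)\<^sup>2 + t\<^sup>2"
      by (simp_all add: algebra_simps power2_eq_square power3_eq_cube)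
    have "\<bar>12 * z - 8 * z ^ 3\<bar> \<le> 12 * t + 8 * t ^ 3"
      unfolding t_def power_abs[symmetric] by (simp add: abs_mult)
    also have "\<dots> \<le> 20 * exp (t\<^sup>2)" using lb t1 t3 t0 zero_le_power2[of "t\<^sup>2"] zero_le_power2[of t] by linarith
    finally show ?thesis by (simp add: abs_mult zz exp_minus field_simps)
  qed
  then have "\<bar>df 3 s\<bar> \<le> c ^ 3 * 20"
    unfolding 3 z_def[symmetric] abs_mult[of "c ^ 3"] using c by (intro mult_mono) auto
  then have R: "\<bar>df 3 s / fact 3 * h ^ 3\<bar> \<le> c ^ 3 * 20 / 6 * \<bar>h\<bar> ^ 3"
  proof -
    have f3: "fact 3 = (6::real)" by (simp add: eval_nat_numeral)
    have "\<bar>df 3 s / fact 3 * h ^ 3\<bar> = \<bar>df 3 s\<bar> * (\<bar>h\<bar> ^ 3 / 6)" by (simp add: abs_mult power_abs f3)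
    also have "\<dots> \<le> c ^ 3 * 20 * (\<bar>h\<bar> ^ 3 / 6)" using \<open>\<bar>df 3 s\<bar> \<le> c ^ 3 * 20\<close> by (intro mult_right_mono) auto
    finally show ?thesis by simp
  qed
  have "u h - exp (- (c * y)\<^sup>2) * (1 - 2 * c\<^sup>2 * y * h + (2 * c ^ 4 * y\<^sup>2 - c\<^sup>2) * h\<^sup>2) = df 3 s / fact 3 * h ^ 3"
  proof -
    have "(\<Sum>m<3. df m 0 / fact m * h ^ m) = df 0 0 + df 1 0 * h + df 2 0 / 2 * h\<^sup>2"
      by (simp add: eval_nat_numeral)
    also have "\<dots> = exp (- (c * y)\<^sup>2) * (1 - 2 * c\<^sup>2 * y * h + (2 * c ^ 4 * y\<^sup>2 - c\<^sup>2) * h\<^sup>2)"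
      by (simp add: df_def u_def field_simps)
    finally show ?thesis unfolding s(2) by simp
  qed
  then have "\<bar>u h - exp (- (c * y)\<^sup>2) * (1 - 2 * c\<^sup>2 * y * h + (2 * c ^ 4 * y\<^sup>2 - c\<^sup>2) * h\<^sup>2)\<bar> \<le> c ^ 3 * 20 / 6 * \<bar>h\<bar> ^ 3"
    using R by simp
  also have "\<dots> \<le> 4 * c ^ 3 * \<bar>h\<bar> ^ 3"
    using c by (intro mult_right_mono) (auto simp: mult_left_mono)
  finally show ?thesis by (simp add: u_def)
qed

text \<open>The quotient is the mean of \<open>exp (- (c * (y + G))\<^sup>2)\<close> for a centred
  Gaussian \<open>G\<close> of variance \<open>v\<close>, that is, the heat flow started from a
  bump. The Taylor expansion runs in the variable \<open>N = 1 + 2 * c\<^sup>2 * v\<close>.\<close>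

lemma gaussian_taylor_time:
  fixes c y v :: real
  assumes v: "v \<ge> 0"
  shows "\<bar>exp (- (c * y)\<^sup>2 / (1 + 2 * c\<^sup>2 * v)) / sqrt (1 + 2 * c\<^sup>2 * v)
      - exp (- (c * y)\<^sup>2) * (1 + (2 * c ^ 4 * y\<^sup>2 - c\<^sup>2) * v)\<bar> \<le> 12 * c ^ 4 * v\<^sup>2"
proof (cases "c\<^sup>2 * v = 0")
  case True
  then have "c = 0 \<or> v = 0" by simp
  then show ?thesis by auto
next
  case False
  define \<beta> where "\<beta> = (c * y)\<^sup>2"
  have \<beta>: "\<beta> \<ge> 0" by (simp add: \<beta>_def)
  define f where "f = (\<lambda>N. exp (- \<beta> / N) / sqrt N)"
  define df :: "nat \<Rightarrow> real \<Rightarrow> real" where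
    "df = (\<lambda>m N. if m = 0 then f N else if m = 1 then f N * (\<beta> / N\<^sup>2 - 1 / (2 * N))
        else f N * ((\<beta> / N\<^sup>2 - 1 / (2 * N))\<^sup>2 - 2 * \<beta> / N ^ 3 + 1 / (2 * N\<^sup>2)))"
  have d1: "(f has_real_derivative f N * (\<beta> / N\<^sup>2 - 1 / (2 * N))) (at N)" if "N \<ge> 1" for N
    unfolding f_def using that
    by (auto intro!: derivative_eq_intros simp: field_simps power2_eq_square)
  have d2: "((\<lambda>N. f N * (\<beta> / N\<^sup>2 - 1 / (2 * N))) has_real_derivative df 2 N) (at N)" if "N \<ge> 1" for N
    unfolding df_def using that
    by (auto intro!: derivative_eq_intros d1 simp: field_simps eval_nat_numeral)
  define \<delta> where "\<delta> = 2 * c\<^sup>2 * v"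
  have \<delta>: "\<delta> > 0" using False v by (simp add: \<delta>_def less_le)
  have "\<forall>m t. m < 2 \<and> 1 \<le> t \<and> t \<le> 1 + \<delta> \<longrightarrow> (df m has_real_derivative df (Suc m) t) (at t)"
    using d1 d2 by (auto simp: df_def[abs_def] less_2_cases_iff numeral_2_eq_2)
  then obtain t where t: "t > 1" "t < 1 + \<delta>"
      "f (1 + \<delta>) = (\<Sum>m<2. df m 1 / fact m * (1 + \<delta> - 1) ^ m) + df 2 t / fact 2 * (1 + \<delta> - 1) ^ 2"
    using Taylor_up[where n = 2 and diff = df and f = f and a = 1 and b = "1 + \<delta>" and c = 1] \<delta>
    by (auto simp: df_def fun_eq_iff)
  have "\<bar>df 2 t\<bar> \<le> 6"
  proof -
    define x where "x = \<beta> / t"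
    have x: "x \<ge> 0" using \<beta> t by (simp add: x_def)
    have eq: "df 2 t = (exp (- x) * (x\<^sup>2 - 3 * x + 3 / 4)) / (sqrt t * t\<^sup>2)"
      using t by (simp add: df_def f_def x_def field_simps power2_eq_square eval_nat_numeral)
    have ex: "exp (- x) \<le> 1" "exp (- x) > 0" using x by auto
    have "\<bar>exp (- x) * (x\<^sup>2 - 3 * x + 3 / 4)\<bar> \<le> 6"
    proof -
      have "exp (- x) * (x\<^sup>2 - 3 * x + 3 / 4) = x\<^sup>2 * exp (- x) - 3 * (x * exp (- x)) + 3 / 4 * exp (- x)"
        by (simp add: algebra_simps)
      moreover have "0 \<le> x\<^sup>2 * exp (- x)" "0 \<le> x * exp (- x)" using x by auto
      ultimately show ?thesis
        using exp_minus_poly_bounds[OF x] ex by linarith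
    qed
    moreover have "sqrt t * t\<^sup>2 \<ge> 1" using t mult_mono[of 1 "sqrt t" 1 "t\<^sup>2"] by (simp add: one_le_power)
    ultimately show ?thesis unfolding eq abs_divide
      by (subst abs_of_pos[of "sqrt t * t\<^sup>2"]) (use t in \<open>auto simp: divide_le_eq intro: order_trans\<close>)
  qed
  then have R: "\<bar>df 2 t / fact 2 * \<delta>\<^sup>2\<bar> \<le> 3 * \<delta>\<^sup>2"
    by (simp add: abs_mult fact_numeral mult_right_mono)
  have "f (1 + \<delta>) - exp (- \<beta>) * (1 + (2 * c ^ 4 * y\<^sup>2 - c\<^sup>2) * v) = df 2 t / fact 2 * \<delta>\<^sup>2"
    unfolding t(3)
    by (simp add: df_def f_def numeral_2_eq_2 \<delta>_def \<beta>_def algebra_simps power_mult_distrib eval_nat_numeral)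
  then have "\<bar>f (1 + \<delta>) - exp (- \<beta>) * (1 + (2 * c ^ 4 * y\<^sup>2 - c\<^sup>2) * v)\<bar> \<le> 3 * \<delta>\<^sup>2"
    using R by simp
  also have "3 * \<delta>\<^sup>2 = 12 * c ^ 4 * v\<^sup>2" by (simp add: \<delta>_def power_mult_distrib eval_nat_numeral)
  finally show ?thesis by (simp add: f_def \<delta>_def \<beta>_def)
qed

text \<open>One replacement step: the mean and variance of \<xi> match those of the Gaussian, so all
  terms up to second order cancel. Absolute third moments are at most \<open>B * v\<close>, and
  \<open>v\<^sup>2 \<le> B\<^sup>2 * v\<close>. An error linear in \<open>v\<close> adds up over
  many replacements to a multiple of the total variance.\<close>

lemma gaussian_expectation_step:
  fixes p :: "'a pmf" and \<xi> :: "'a \<Rightarrow> real"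
  assumes c: "c \<ge> 0" and fin: "finite (set_pmf p)"
    and mean: "measure_pmf.expectation p \<xi> = 0" and bd: "\<And>a. a \<in> set_pmf p \<Longrightarrow> \<bar>\<xi> a\<bar> \<le> B"
    and var: "measure_pmf.expectation p (\<lambda>a. (\<xi> a)\<^sup>2) = v"
  shows "\<bar>measure_pmf.expectation p (\<lambda>a. exp (- (c * (y + \<xi> a))\<^sup>2))
     - exp (- (c * y)\<^sup>2 / (1 + 2 * c\<^sup>2 * v)) / sqrt (1 + 2 * c\<^sup>2 * v)\<bar> \<le> (4 * c ^ 3 * B + 12 * c ^ 4 * B\<^sup>2) * v"
proof -
  have int: "integrable p f" for f :: "'a \<Rightarrow> real" by (rule integrable_measure_pmf_finite[OF fin])
  obtain a0 where "a0 \<in> set_pmf p" using set_pmf_not_empty by fast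
  then have B: "B \<ge> 0" using bd[of a0] by linarith
  have sq: "(\<xi> a)\<^sup>2 \<le> B\<^sup>2" if "a \<in> set_pmf p" for a
    using bd[OF that] by (simp add: abs_le_square_iff[symmetric] B)
  have v0: "v \<ge> 0" unfolding var[symmetric] by (rule integral_nonneg_AE) simp
  have vB: "v \<le> B\<^sup>2"
  proof -
    have "measure_pmf.expectation p (\<lambda>a. (\<xi> a)\<^sup>2) \<le> measure_pmf.expectation p (\<lambda>a. B\<^sup>2)"
      using sq by (intro integral_mono_AE int) (auto simp: AE_measure_pmf_iff)
    then show ?thesis by (simp add: var)
  qed
  define g where "g = (\<lambda>h. exp (- (c * y)\<^sup>2) * (1 - 2 * c\<^sup>2 * y * h + (2 * c ^ 4 * y\<^sup>2 - c\<^sup>2) * h\<^sup>2))"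
  have Eg: "measure_pmf.expectation p (\<lambda>a. g (\<xi> a)) = exp (- (c * y)\<^sup>2) * (1 + (2 * c ^ 4 * y\<^sup>2 - c\<^sup>2) * v)"
    unfolding g_def by (simp add: int mean var)
  have "\<bar>measure_pmf.expectation p (\<lambda>a. exp (- (c * (y + \<xi> a))\<^sup>2)) - measure_pmf.expectation p (\<lambda>a. g (\<xi> a))\<bar>
     = \<bar>measure_pmf.expectation p (\<lambda>a. exp (- (c * (y + \<xi> a))\<^sup>2) - g (\<xi> a))\<bar>"
    by (simp add: int)
  also have "\<dots> \<le> measure_pmf.expectation p (\<lambda>a. \<bar>exp (- (c * (y + \<xi> a))\<^sup>2) - g (\<xi> a)\<bar>)"
    by (rule integral_abs_bound)
  also have "\<dots> \<le> measure_pmf.expectation p (\<lambda>a. 4 * c ^ 3 * B * (\<xi> a)\<^sup>2)"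
  proof (intro integral_mono_AE int)
    show "AE a in p. \<bar>exp (- (c * (y + \<xi> a))\<^sup>2) - g (\<xi> a)\<bar> \<le> 4 * c ^ 3 * B * (\<xi> a)\<^sup>2"
      unfolding AE_measure_pmf_iff
    proof
      fix a assume a: "a \<in> set_pmf p"
      have "\<bar>exp (- (c * (y + \<xi> a))\<^sup>2) - g (\<xi> a)\<bar> \<le> 4 * c ^ 3 * \<bar>\<xi> a\<bar> ^ 3"
        unfolding g_def by (rule gaussian_taylor_space[OF c])
      also have "\<bar>\<xi> a\<bar> ^ 3 = \<bar>\<xi> a\<bar> * (\<xi> a)\<^sup>2" by (simp add: power3_eq_cube power2_eq_square)
      also have "4 * c ^ 3 * (\<bar>\<xi> a\<bar> * (\<xi> a)\<^sup>2) \<le> 4 * c ^ 3 * (B * (\<xi> a)\<^sup>2)"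
        using c bd[OF a] by (intro mult_left_mono mult_right_mono) auto
      finally show "\<bar>exp (- (c * (y + \<xi> a))\<^sup>2) - g (\<xi> a)\<bar> \<le> 4 * c ^ 3 * B * (\<xi> a)\<^sup>2" by simp
    qed
  qed
  also have "\<dots> = 4 * c ^ 3 * B * v" by (simp add: var)
  finally have 1: "\<bar>measure_pmf.expectation p (\<lambda>a. exp (- (c * (y + \<xi> a))\<^sup>2)) - measure_pmf.expectation p (\<lambda>a. g (\<xi> a))\<bar> \<le> 4 * c ^ 3 * B * v" .
  have "12 * c ^ 4 * v\<^sup>2 \<le> 12 * c ^ 4 * (B\<^sup>2 * v)"
    unfolding power2_eq_square[of v] using vB v0 c by (intro mult_left_mono mult_right_mono) auto
  then show ?thesis using 1 gaussian_taylor_time[OF v0, of c y] unfolding Eg by (simp add: algebra_simps)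
qed

text \<open>The expectation of \<open>exp (- l * Q (x + G))\<close>, where \<open>Q\<close> is the variance of \<open>x j / A j\<close> with weights \<open>A j\<close>
  and \<open>G\<close> is a centred Gaussian vector with independent coordinates of variance \<open>T j\<close>.\<close>

definition heat_kernel :: "real \<Rightarrow> (nat \<Rightarrow> real) \<Rightarrow> nat set \<Rightarrow> (nat \<Rightarrow> real) \<Rightarrow> (nat \<Rightarrow> real) \<Rightarrow> real" where
  "heat_kernel l A R T x = (let D = (\<lambda>j. A j + 2 * l * T j) in
     sqrt ((\<Prod>j\<in>R. A j / D j) * (\<Sum>j\<in>R. A j) / (\<Sum>j\<in>R. (A j)\<^sup>2 / D j))
     * exp (- l * ((\<Sum>j\<in>R. (x j)\<^sup>2 / D j) - (\<Sum>j\<in>R. A j * x j / D j)\<^sup>2 / (\<Sum>j\<in>R. (A j)\<^sup>2 / D j))))"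

lemma weighted_cauchy_schwarz:
  fixes A x D :: "nat \<Rightarrow> real"
  assumes "finite R" "\<And>j. j \<in> R \<Longrightarrow> D j > 0" "(\<Sum>j\<in>R. (A j)\<^sup>2 / D j) > 0"
  shows "(\<Sum>j\<in>R. A j * x j / D j)\<^sup>2 / (\<Sum>j\<in>R. (A j)\<^sup>2 / D j) \<le> (\<Sum>j\<in>R. (x j)\<^sup>2 / D j)"
proof -
  have eq: "A j * x j / D j = (A j / sqrt (D j)) * (x j / sqrt (D j))"
           "(A j)\<^sup>2 / D j = (A j / sqrt (D j))\<^sup>2" "(x j)\<^sup>2 / D j = (x j / sqrt (D j))\<^sup>2" if "j \<in> R" for j
    using assms(2)[OF that] by (auto simp: power_divide)
  have "(\<Sum>j\<in>R. A j * x j / D j)\<^sup>2 \<le> (\<Sum>j\<in>R. (A j)\<^sup>2 / D j) * (\<Sum>j\<in>R. (x j)\<^sup>2 / D j)"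
    using Cauchy_Schwarz_ineq_sum[of "\<lambda>j. A j / sqrt (D j)" "\<lambda>j. x j / sqrt (D j)" R]
    by (simp add: eq cong: sum.cong)
  then show ?thesis using assms(3) by (simp add: divide_le_eq mult.commute)
qed

text \<open>As a function of one coordinate and its time, the kernel is a constant multiple of the
  one-dimensional heat flow started from a Gaussian bump.\<close>

lemma heat_kernel_coordinate:
  fixes A T x :: "nat \<Rightarrow> real"
  assumes fin: "finite R" and i: "i \<in> R" and ne: "R \<noteq> {i}" and l: "l > 0"
    and A: "\<And>j. j \<in> R \<Longrightarrow> A j > 0" and T: "\<And>j. j \<in> R \<Longrightarrow> T j \<ge> 0"
  obtains M c y0 where "0 \<le> M" "M \<le> 1" "0 \<le> c" "c \<le> sqrt (l / A i)"
    "\<And>y v. v \<ge> 0 \<Longrightarrow> heat_kernel l A R (T(i := T i + v)) (x(i := y)) =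
       M * (exp (- (c * (y - y0))\<^sup>2 / (1 + 2 * c\<^sup>2 * v)) / sqrt (1 + 2 * c\<^sup>2 * v))"
proof -
  define D where "D = (\<lambda>j. A j + 2 * l * T j)"
  define R' where "R' = R - {i}"
  define E where "E = (\<Sum>j\<in>R'. (x j)\<^sup>2 / D j)"
  define F where "F = (\<Sum>j\<in>R'. A j * x j / D j)"
  define G where "G = (\<Sum>j\<in>R'. (A j)\<^sup>2 / D j)"
  define P where "P = (\<Prod>j\<in>R'. A j / D j)"
  define S where "S = (\<Sum>j\<in>R. A j)"
  define a where "a = A i"
  define d where "d = D i"
  define N where "N = G * d + a\<^sup>2"
  have a: "a > 0" using A[OF i] by (simp add: a_def)
  have D: "D j > 0" "A j \<le> D j" if "j \<in> R" for j
    using A[OF that] T[OF that] l by (auto simp: D_def add_pos_nonneg)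
  have da: "d \<ge> a" using D(2)[OF i] by (simp add: d_def a_def)
  have finR': "finite R'" and R'ne: "R' \<noteq> {}" using fin i ne by (auto simp: R'_def)
  \<comment> \<open>\<open>R\<close> has an element besides \<open>i\<close>, so \<open>G\<close>,
    by which \<open>y0\<close> and \<open>M\<close> divide, is positive.\<close>
  have G: "G > 0" unfolding G_def
  proof (intro sum_pos finR' R'ne)
    fix j assume "j \<in> R'"
    then have "A j > 0" "D j > 0" using A D by (auto simp: R'_def)
    then show "(A j)\<^sup>2 / D j > 0" by simp
  qed
  have N: "N > 0" using G da a by (simp add: N_def add_pos_pos)
  have P: "P \<ge> 0" unfolding P_def using A D by (intro prod_nonneg) (auto simp: R'_def intro!: divide_nonneg_pos less_imp_le)
  have S: "S > 0" unfolding S_def using A fin i by (intro sum_pos) auto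
  \<comment> \<open>Completing the square in coordinate \<open>i\<close>: \<open>y0\<close> is the
    minimiser of the exponent's quadratic form, \<open>c\<^sup>2\<close> its curvature before time
    is added, and \<open>M\<close> collects what is free of \<open>y\<close> and \<open>v\<close>.
    Adding time \<open>v\<close> multiplies \<open>N\<close> by
    \<open>1 + 2 * c\<^sup>2 * v\<close>.\<close>
  define c where "c = sqrt (l * G / N)"
  have c2: "c\<^sup>2 = l * G / N" using l G N by (simp add: c_def)
  define y0 where "y0 = a * F / G"
  define M where "M = sqrt (P * S * a / N) * exp (- l * (E - F\<^sup>2 / G))"
  have split_sum: "(\<Sum>j\<in>R. f j) = f i + (\<Sum>j\<in>R'. f j)" for f :: "nat \<Rightarrow> real"
    unfolding R'_def using fin i by (simp add: sum.remove)
  have split_prod: "(\<Prod>j\<in>R. f j) = f i * (\<Prod>j\<in>R'. f j)" for f :: "nat \<Rightarrow> real"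
    unfolding R'_def using fin i by (simp add: prod.remove)
  have main: "heat_kernel l A R (T(i := T i + v)) (x(i := y)) =
       M * (exp (- (c * (y - y0))\<^sup>2 / (1 + 2 * c\<^sup>2 * v)) / sqrt (1 + 2 * c\<^sup>2 * v))" if v: "v \<ge> 0" for y v
  proof -
    define D' where "D' = (\<lambda>j. A j + 2 * l * (T(i := T i + v)) j)"
    define d' where "d' = d + 2 * l * v"
    have d': "d' > 0" using da a l v by (simp add: d'_def add_pos_nonneg)
    have D'i: "D' i = d'" by (simp add: D'_def d'_def d_def D_def algebra_simps)
    have D'j: "D' j = D j" if "j \<in> R'" for j using that by (auto simp: D'_def D_def R'_def)
    have xj: "(x(i := y)) j = x j" if "j \<in> R'" for j using that by (auto simp: R'_def)
    define N' where "N' = G * d' + a\<^sup>2"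
    have N': "N' > 0" using G d' by (simp add: N'_def add_pos_nonneg)
    have NN': "N' = N * (1 + 2 * c\<^sup>2 * v)"
    proof -
      have "N * (1 + 2 * c\<^sup>2 * v) = N + 2 * l * G * v" using N by (simp add: c2 distrib_left)
      moreover have "N' = N + 2 * l * G * v" by (simp add: N'_def N_def d'_def algebra_simps)
      ultimately show ?thesis by simp
    qed
    have q: "1 + 2 * c\<^sup>2 * v > 0" using v by (simp add: add_pos_nonneg)
    have s1: "(\<Sum>j\<in>R. ((x(i := y)) j)\<^sup>2 / D' j) = y\<^sup>2 / d' + E"
      unfolding split_sum E_def D'i by (intro arg_cong2[where f = "(+)"] sum.cong) (auto simp: D'j R'_def)
    have s2: "(\<Sum>j\<in>R. A j * (x(i := y)) j / D' j) = a * y / d' + F"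
      unfolding split_sum F_def D'i by (intro arg_cong2[where f = "(+)"] sum.cong) (auto simp: D'j a_def R'_def)
    have s3: "(\<Sum>j\<in>R. (A j)\<^sup>2 / D' j) = a\<^sup>2 / d' + G"
      unfolding split_sum G_def D'i by (intro arg_cong2[where f = "(+)"] sum.cong) (auto simp: D'j a_def)
    have s4: "(\<Prod>j\<in>R. A j / D' j) = a / d' * P"
      unfolding split_prod P_def D'i by (intro arg_cong2[where f = "(*)"] prod.cong) (auto simp: D'j a_def)
    have pre: "a / d' * P * S / (a\<^sup>2 / d' + G) = P * S * a / N / (1 + 2 * c\<^sup>2 * v)"
    proof -
      have "a\<^sup>2 / d' + G = N' / d'" using d' by (simp add: N'_def field_simps)
      then have "a / d' * P * S / (a\<^sup>2 / d' + G) = P * S * a / N'"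
        using d' N' by simp
      then show ?thesis by (simp add: NN')
    qed
    have ex: "y\<^sup>2 / d' + E - (a * y / d' + F)\<^sup>2 / (a\<^sup>2 / d' + G) = E - F\<^sup>2 / G + G * (y - y0)\<^sup>2 / N'"
    proof -
      have e1: "a\<^sup>2 / d' + G = N' / d'" using d' by (simp add: N'_def field_simps)
      have e2: "(a * y / d' + F)\<^sup>2 / (N' / d') = (a * y + F * d')\<^sup>2 / (d' * N')"
        using d' N' by (simp add: field_simps power2_eq_square)
      define Z W where "Z = a * y + F * d'" and "W = G * (y - y0)"
      have W: "W = G * y - a * F" using G by (simp add: W_def y0_def right_diff_distrib)
      have "G * (N' * y\<^sup>2 - Z\<^sup>2) = d' * (W\<^sup>2 - F\<^sup>2 * N')"
        unfolding W Z_def N'_def by algebra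
      then have "(N' * y\<^sup>2 - Z\<^sup>2) / d' = (W\<^sup>2 - F\<^sup>2 * N') / G"
        using d' G by (simp add: frac_eq_eq mult.commute)
      then have "(N' * y\<^sup>2 - Z\<^sup>2) / d' / N' = (W\<^sup>2 - F\<^sup>2 * N') / G / N'" by (rule arg_cong)
      moreover have "(N' * y\<^sup>2 - Z\<^sup>2) / d' / N' = y\<^sup>2 / d' - Z\<^sup>2 / (d' * N')"
        using N' by (simp add: diff_divide_distrib)
      moreover have "(W\<^sup>2 - F\<^sup>2 * N') / G / N' = - (F\<^sup>2 / G) + G * (y - y0)\<^sup>2 / N'"
        using N' G by (simp add: diff_divide_distrib W_def power2_eq_square)
      ultimately have "y\<^sup>2 / d' - (a * y + F * d')\<^sup>2 / (d' * N') = - (F\<^sup>2 / G) + G * (y - y0)\<^sup>2 / N'"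
        by (simp add: Z_def)
      then show ?thesis unfolding e1 e2 by linarith
    qed
    have "heat_kernel l A R (T(i := T i + v)) (x(i := y)) =
      sqrt (P * S * a / N / (1 + 2 * c\<^sup>2 * v)) * exp (- l * (E - F\<^sup>2 / G + G * (y - y0)\<^sup>2 / N'))"
      unfolding heat_kernel_def Let_def D'_def[symmetric] s1 s2 s3 s4 S_def[symmetric] pre ex ..
    also have "- l * (E - F\<^sup>2 / G + G * (y - y0)\<^sup>2 / N') = - l * (E - F\<^sup>2 / G) + (- (c * (y - y0))\<^sup>2 / (1 + 2 * c\<^sup>2 * v))"
      using N q unfolding NN' power_mult_distrib[of c] by (subst (2) c2) (simp add: field_simps)
    also have "exp (- l * (E - F\<^sup>2 / G) + (- (c * (y - y0))\<^sup>2 / (1 + 2 * c\<^sup>2 * v)))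
      = exp (- l * (E - F\<^sup>2 / G)) * exp (- (c * (y - y0))\<^sup>2 / (1 + 2 * c\<^sup>2 * v))" by (rule exp_add)
    also have "sqrt (P * S * a / N / (1 + 2 * c\<^sup>2 * v)) = sqrt (P * S * a / N) / sqrt (1 + 2 * c\<^sup>2 * v)"
      by (rule real_sqrt_divide)
    finally show ?thesis unfolding M_def by (simp only: times_divide_eq_left times_divide_eq_right mult.assoc)
  qed
  have "M \<le> 1"
  proof -
    have "F\<^sup>2 / G \<le> E" unfolding E_def F_def G_def using finR' G D
      by (intro weighted_cauchy_schwarz) (auto simp: R'_def G_def)
    then have "exp (- l * (E - F\<^sup>2 / G)) \<le> 1" using l by simp
    moreover have "P * S * a / N \<le> 1"
    proof -
      \<comment> \<open>the product of the ratios is at most each single one, hence at most their weighted mean\<close>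
      have le: "(\<Prod>j\<in>R. A j / D j) \<le> A m / D m" if m: "m \<in> R" for m
      proof -
        have "(\<Prod>j\<in>R. A j / D j) = A m / D m * (\<Prod>j\<in>R - {m}. A j / D j)"
          using fin m by (simp add: prod.remove)
        also have "\<dots> \<le> A m / D m * 1"
          using A D m by (intro mult_left_mono prod_le_1) (auto simp: divide_le_eq intro!: divide_nonneg_pos less_imp_le)
        finally show ?thesis by simp
      qed
      have "a / d * P * S = (\<Sum>m\<in>R. A m * (\<Prod>j\<in>R. A j / D j))"
        unfolding sum_distrib_right[symmetric] split_prod by (simp add: P_def S_def a_def d_def mult_ac)
      also have "\<dots> \<le> (\<Sum>m\<in>R. A m * (A m / D m))"
        using A le by (intro sum_mono mult_left_mono) (auto intro: less_imp_le)
      also have "\<dots> = a\<^sup>2 / d + G" by (simp add: split_sum G_def a_def d_def power2_eq_square)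
      also have "\<dots> = N / d" using da a by (simp add: N_def field_simps)
      finally have "P * S * a / d \<le> N / d" by (simp add: mult_ac)
      then have "P * S * a \<le> N" using da a by (simp add: divide_le_cancel)
      then show ?thesis using N by simp
    qed
    then have "sqrt (P * S * a / N) \<le> 1" by simp
    ultimately show ?thesis unfolding M_def using P S a N by (intro mult_le_one) auto
  qed
  moreover have "0 \<le> M" using P S a N by (simp add: M_def)
  moreover have "0 \<le> c" using l G N by (simp add: c_def)
  moreover have "c \<le> sqrt (l / A i)"
  proof -
    have "G * a \<le> N" unfolding N_def using G da mult_left_mono[of a d G] zero_le_power2[of a] by linarith
    then have "l * G / N \<le> l / a" using l N a by (simp add: field_simps)
    then show ?thesis unfolding c_def a_def[symmetric] by (rule real_sqrt_le_mono)
  qed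
  ultimately show ?thesis using main that[of M c y0] by blast
qed

lemma expectation_pair_pmf_finite:
  fixes h :: "'a \<times> 'b \<Rightarrow> real"
  assumes "finite (set_pmf p)" "finite (set_pmf q)"
  shows "measure_pmf.expectation (pair_pmf p q) h = measure_pmf.expectation p (\<lambda>x. measure_pmf.expectation q (\<lambda>y. h (x, y)))"
proof -
  have "measure_pmf.expectation (pair_pmf p q) h = (\<Sum>a\<in>set_pmf p. pmf p a *\<^sub>R measure_pmf.expectation (bind_pmf q (\<lambda>y. return_pmf (a, y))) h)"
    unfolding pair_pmf_def by (rule pmf_expectation_bind) (use assms in auto)
  also have "\<dots> = (\<Sum>a\<in>set_pmf p. pmf p a *\<^sub>R measure_pmf.expectation q (\<lambda>y. h (a, y)))"
    by (simp flip: map_pmf_def)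
  also have "\<dots> = measure_pmf.expectation p (\<lambda>x. measure_pmf.expectation q (\<lambda>y. h (x, y)))"
    by (rule integral_measure_pmf[symmetric]) (use assms in auto)
  finally show ?thesis .
qed

text \<open>Lindeberg replacement, one variable at a time. The kernel family is closed under the
  heat flow in each coordinate, so every replacement reduces to
  \<open>gaussian_expectation_step\<close> by way of \<open>heat_kernel_coordinate\<close>. The
  induction needs arbitrary \<open>x\<close>, because conditioning on the new variable shifts the
  starting point.\<close>

lemma heat_kernel_expectation:
  fixes A :: "nat \<Rightarrow> real" and q :: "'p \<Rightarrow> 'a pmf" and \<xi> :: "'p \<Rightarrow> 'a \<Rightarrow> real" and \<iota> :: "'p \<Rightarrow> nat"
  assumes fin: "finite R" and card: "card R \<ge> 2" and l: "l > 0" and A0: "A0 > 0" and B: "B \<ge> 0"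
    and A: "\<And>j. j \<in> R \<Longrightarrow> A j \<ge> A0"
    and finP: "finite P" and finq: "\<And>p. p \<in> P \<Longrightarrow> finite (set_pmf (q p))" and \<iota>: "\<And>p. p \<in> P \<Longrightarrow> \<iota> p \<in> R"
    and mean: "\<And>p. p \<in> P \<Longrightarrow> measure_pmf.expectation (q p) (\<xi> p) = 0"
    and bd: "\<And>p a. p \<in> P \<Longrightarrow> a \<in> set_pmf (q p) \<Longrightarrow> \<bar>\<xi> p a\<bar> \<le> B"
    and var: "\<And>p. p \<in> P \<Longrightarrow> measure_pmf.expectation (q p) (\<lambda>a. (\<xi> p a)\<^sup>2) = v p"
    and T: "\<And>j. j \<in> R \<Longrightarrow> T j \<ge> 0"
  defines "c \<equiv> sqrt (l / A0)"
  shows "\<bar>measure_pmf.expectation (Pi_pmf P d q) (\<lambda>a. heat_kernel l A R T (\<lambda>i. x i + (\<Sum>p\<in>{p\<in>P. \<iota> p = i}. \<xi> p (a p))))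
     - heat_kernel l A R (\<lambda>i. T i + (\<Sum>p\<in>{p\<in>P. \<iota> p = i}. v p)) x\<bar> \<le> (4 * c ^ 3 * B + 12 * c ^ 4 * B\<^sup>2) * (\<Sum>p\<in>P. v p)"
  using finP finq \<iota> mean bd var
proof (induction P arbitrary: x rule: finite_induct)
  case empty
  then show ?case by simp
next
  case (insert p P)
  let ?K = "heat_kernel l A R" and ?\<kappa> = "4 * c ^ 3 * B + 12 * c ^ 4 * B\<^sup>2"
  define i where "i = \<iota> p"
  define S where "S = (\<lambda>a i. \<Sum>p\<in>{p\<in>P. \<iota> p = i}. \<xi> p (a p))"
  define V where "V = (\<lambda>i. T i + (\<Sum>p\<in>{p\<in>P. \<iota> p = i}. v p))"
  have i: "i \<in> R" using insert.prems(2) by (simp add: i_def)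
  have c: "c \<ge> 0" using l A0 by (simp add: c_def)
  have v: "v p' \<ge> 0" if "p' \<in> insert p P" for p'
    unfolding insert.prems(5)[OF that, symmetric] by (rule integral_nonneg_AE) simp
  have V: "V j \<ge> 0" if "j \<in> R" for j unfolding V_def using T[OF that] v by (intro add_nonneg_nonneg sum_nonneg) auto
  have finq': "finite (set_pmf (q p))" using insert.prems(1) by simp
  have finPi: "finite (set_pmf (Pi_pmf P d q))"
  proof (rule finite_subset[OF set_Pi_pmf_subset'[OF insert.hyps(1)]])
    show "finite (PiE_dflt P d (set_pmf \<circ> q))" using insert.prems(1) insert.hyps(1) by (intro finite_PiE_dflt) auto
  qed
  have sum_ins: "(\<Sum>p'\<in>{p'\<in>insert p P. \<iota> p' = j}. f p') = (if j = i then f p else 0) + (\<Sum>p'\<in>{p'\<in>P. \<iota> p' = j}. f p')" for f :: "'p \<Rightarrow> real" and j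
  proof (cases "j = i")
    case True
    then have "{p'\<in>insert p P. \<iota> p' = j} = insert p {p'\<in>P. \<iota> p' = j}" by (auto simp: i_def)
    then show ?thesis using True insert.hyps by simp
  next
    case False
    then have "{p'\<in>insert p P. \<iota> p' = j} = {p'\<in>P. \<iota> p' = j}" by (auto simp: i_def)
    then show ?thesis using False by simp
  qed
  have "measure_pmf.expectation (Pi_pmf (insert p P) d q) (\<lambda>a. ?K T (\<lambda>j. x j + (\<Sum>p'\<in>{p'\<in>insert p P. \<iota> p' = j}. \<xi> p' (a p'))))
     = measure_pmf.expectation (q p) (\<lambda>y. measure_pmf.expectation (Pi_pmf P d q) (\<lambda>a. ?K T (\<lambda>j. (x(i := x i + \<xi> p y)) j + S a j)))"
  proof -
    have eq: "(\<lambda>j. x j + (\<Sum>p'\<in>{p'\<in>insert p P. \<iota> p' = j}. \<xi> p' ((a(p := y)) p'))) = (\<lambda>j. (x(i := x i + \<xi> p y)) j + S a j)" for a y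
    proof
      fix j
      have "(\<Sum>p'\<in>{p'\<in>P. \<iota> p' = j}. \<xi> p' ((a(p := y)) p')) = S a j"
        unfolding S_def using insert.hyps(2) by (intro sum.cong) auto
      then show "x j + (\<Sum>p'\<in>{p'\<in>insert p P. \<iota> p' = j}. \<xi> p' ((a(p := y)) p')) = (x(i := x i + \<xi> p y)) j + S a j"
        unfolding sum_ins by simp
    qed
    show ?thesis
      unfolding Pi_pmf_insert[OF insert.hyps(1,2)] integral_map_pmf
        expectation_pair_pmf_finite[OF finq' finPi] case_prod_conv eq ..
  qed
  also have "\<bar>\<dots> - measure_pmf.expectation (q p) (\<lambda>y. ?K V (x(i := x i + \<xi> p y)))\<bar> \<le> ?\<kappa> * (\<Sum>p\<in>P. v p)"
  proof -
    have int: "integrable (q p) f" for f :: "'a \<Rightarrow> real" by (rule integrable_measure_pmf_finite[OF finq'])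
    have IH: "\<bar>measure_pmf.expectation (Pi_pmf P d q) (\<lambda>a. ?K T (\<lambda>j. z j + S a j)) - ?K V z\<bar> \<le> ?\<kappa> * (\<Sum>p\<in>P. v p)" for z
      unfolding S_def V_def using insert.prems by (intro insert.IH) auto
    have "\<bar>measure_pmf.expectation (q p) (\<lambda>y. measure_pmf.expectation (Pi_pmf P d q) (\<lambda>a. ?K T (\<lambda>j. (x(i := x i + \<xi> p y)) j + S a j)))
       - measure_pmf.expectation (q p) (\<lambda>y. ?K V (x(i := x i + \<xi> p y)))\<bar>
      = \<bar>measure_pmf.expectation (q p) (\<lambda>y. measure_pmf.expectation (Pi_pmf P d q) (\<lambda>a. ?K T (\<lambda>j. (x(i := x i + \<xi> p y)) j + S a j)) - ?K V (x(i := x i + \<xi> p y)))\<bar>"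
      by (subst Bochner_Integration.integral_diff[OF int int]) simp
    also have "\<dots> \<le> measure_pmf.expectation (q p) (\<lambda>y. \<bar>measure_pmf.expectation (Pi_pmf P d q) (\<lambda>a. ?K T (\<lambda>j. (x(i := x i + \<xi> p y)) j + S a j)) - ?K V (x(i := x i + \<xi> p y))\<bar>)"
      by (rule integral_abs_bound)
    also have "\<dots> \<le> measure_pmf.expectation (q p) (\<lambda>y. ?\<kappa> * (\<Sum>p\<in>P. v p))"
      by (intro integral_mono_AE int AE_I2 IH)
    finally show ?thesis by simp
  qed
  finally have 1: "\<bar>measure_pmf.expectation (Pi_pmf (insert p P) d q) (\<lambda>a. ?K T (\<lambda>j. x j + (\<Sum>p'\<in>{p'\<in>insert p P. \<iota> p' = j}. \<xi> p' (a p'))))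
     - measure_pmf.expectation (q p) (\<lambda>y. ?K V (x(i := x i + \<xi> p y)))\<bar> \<le> ?\<kappa> * (\<Sum>p\<in>P. v p)" .
  have Ri: "R \<noteq> {i}" using card by auto
  have Apos: "A j > 0" if "j \<in> R" for j using A[OF that] A0 by linarith
  obtain M c' y0 where M: "0 \<le> M" "M \<le> 1" and c': "0 \<le> c'" "c' \<le> sqrt (l / A i)"
    and K: "\<And>y v. v \<ge> 0 \<Longrightarrow> ?K (V(i := V i + v)) (x(i := y)) =
       M * (exp (- (c' * (y - y0))\<^sup>2 / (1 + 2 * c'\<^sup>2 * v)) / sqrt (1 + 2 * c'\<^sup>2 * v))"
    by (rule heat_kernel_coordinate[OF fin i Ri l, of A V x]) (use Apos V in auto)
  have cc: "c' \<le> c"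
  proof -
    have "l / A i \<le> l / A0" using A[OF i] A0 l by (intro divide_left_mono) auto
    then show ?thesis using c'(2) unfolding c_def by (meson order_trans real_sqrt_le_mono)
  qed
  have vp: "v p \<ge> 0" using v by simp
  have K0: "?K V (x(i := x i + \<xi> p y)) = M * exp (- (c' * (x i - y0 + \<xi> p y))\<^sup>2)" for y
    using K[of 0 "x i + \<xi> p y"] by (simp add: algebra_simps)
  have K1: "?K (V(i := V i + v p)) x = M * (exp (- (c' * (x i - y0))\<^sup>2 / (1 + 2 * c'\<^sup>2 * v p)) / sqrt (1 + 2 * c'\<^sup>2 * v p))"
    using K[OF vp, of "x i"] by simp
  have "\<bar>measure_pmf.expectation (q p) (\<lambda>y. ?K V (x(i := x i + \<xi> p y))) - ?K (V(i := V i + v p)) x\<bar>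
     = M * \<bar>measure_pmf.expectation (q p) (\<lambda>y. exp (- (c' * (x i - y0 + \<xi> p y))\<^sup>2)) - exp (- (c' * (x i - y0))\<^sup>2 / (1 + 2 * c'\<^sup>2 * v p)) / sqrt (1 + 2 * c'\<^sup>2 * v p)\<bar>"
    unfolding K0 K1 integral_mult_right_zero right_diff_distrib[symmetric] using M(1) by (simp only: abs_mult abs_of_nonneg)
  also have "\<dots> \<le> 1 * ((4 * c' ^ 3 * B + 12 * c' ^ 4 * B\<^sup>2) * v p)"
    using M insert.prems by (intro mult_mono gaussian_expectation_step c'(1)) auto
  also have "\<dots> \<le> ?\<kappa> * v p"
    using cc c'(1) B vp by (simp add: mult_right_mono add_mono mult_left_mono power_mono)
  finally have 2: "\<bar>measure_pmf.expectation (q p) (\<lambda>y. ?K V (x(i := x i + \<xi> p y))) - ?K (V(i := V i + v p)) x\<bar> \<le> ?\<kappa> * v p" .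
  have "(\<lambda>j. T j + (\<Sum>p'\<in>{p'\<in>insert p P. \<iota> p' = j}. v p')) = V(i := V i + v p)"
    unfolding sum_ins by (auto simp: V_def fun_eq_iff)
  with 1 2 show ?case using insert.hyps by (simp add: distrib_left)
qed

section \<open>Laplace transforms and weak convergence\<close>

text \<open>In the variable \<open>s = exp (- x)\<close> a continuous step function extends
  continuously to [0, 1], and the expectation of a polynomial in \<open>s\<close> is a combination
  of Laplace transforms at natural numbers. Power 0 is covered by total mass 1.\<close>

lemma weak_conv_m_of_laplace:
  fixes \<mu> :: "nat \<Rightarrow> real pmf" and M :: "real measure"
  assumes M: "real_distribution M" and Mpos: "AE x in M. 0 \<le> x"
    and pos: "\<And>n x. x \<in> set_pmf (\<mu> n) \<Longrightarrow> 0 \<le> x"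
    and conv: "\<And>l::nat. l > 0 \<Longrightarrow> (\<lambda>n. measure_pmf.expectation (\<mu> n) (\<lambda>x. exp (- real l * x)))
                  \<longlonglongrightarrow> integral\<^sup>L M (\<lambda>x. exp (- real l * x))"
  shows "weak_conv_m (\<lambda>n. measure_pmf (\<mu> n)) M"
proof -
  interpret M: real_distribution M by fact
  \<comment> \<open>A \<open>measure_pmf\<close> has all sets measurable, whereas a real
    distribution lives on \<open>borel\<close>; the distribution functions agree.\<close>
  define N where "N = (\<lambda>n. distr (measure_pmf (\<mu> n)) borel (\<lambda>x. x))"
  have N: "real_distribution (N n)" for n
    unfolding N_def by (intro prob_space.real_distribution_distr prob_space_measure_pmf) simp
  have AEmu: "AE x in measure_pmf (\<mu> n). 0 \<le> x" for n
    using pos by (simp add: AE_measure_pmf_iff)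
  have conv0: "(\<lambda>n. measure_pmf.expectation (\<mu> n) (\<lambda>x. exp (- x) ^ l))
                  \<longlonglongrightarrow> integral\<^sup>L M (\<lambda>x. exp (- x) ^ l)" for l :: nat
  proof (cases "l > 0")
    case True
    then show ?thesis using conv[OF True] by (simp add: mult.commute flip: exp_of_nat_mult)
  next
    case False
    then show ?thesis using M.prob_space by simp
  qed
  have "(\<lambda>n. integral\<^sup>L (N n) (cts_step x y)) \<longlonglongrightarrow> integral\<^sup>L M (cts_step x y)" if xy: "x < y" for x y
  proof (rule LIMSEQ_I)
    fix e :: real assume e: "e > 0"
    \<comment> \<open>The step vanishes to the right of \<open>y\<close>, so \<open>F\<close> is
      zero on all of \<open>s < exp (- y)\<close> and the value 0 at nonpositive \<open>s\<close>
      extends it continuously.\<close>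
    define F where "F = (\<lambda>s::real. if s \<le> 0 then 0 else cts_step x y (- ln s))"
    have cstep: "continuous_on UNIV (cts_step x y)"
      using cts_step_uniformly_continuous[OF xy] by (rule uniformly_continuous_imp_continuous)
    have "isCont F s" for s
    proof (cases "s < exp (- y)")
      case True
      have ev: "eventually (\<lambda>u. F u = 0) (nhds s)"
      proof -
        have "eventually (\<lambda>u. u < exp (- y)) (nhds s)"
          using True by (intro eventually_nhds_in_open[of "{..<exp (- y)}", simplified]) auto
        then show ?thesis
        proof eventually_elim
          case (elim u)
          show ?case
          proof (cases "u \<le> 0")
            case False
            then have "ln u < - y" using elim ln_less_cancel_iff[of u "exp (- y)"] by simp
            then show ?thesis using xy False by (simp add: F_def cts_step_def)
          qed (simp add: F_def)
        qed
      qed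
      then show ?thesis by (subst isCont_cong[of F "\<lambda>_. 0"]) (auto elim: eventually_mono)
    next
      case False
      then have s: "s > 0" using exp_gt_zero[of "- y"] by linarith
      have "eventually (\<lambda>u. u > 0) (nhds s)"
        using s by (intro eventually_nhds_in_open[of "{0<..}", simplified]) auto
      then have ev: "eventually (\<lambda>u. F u = cts_step x y (- ln u)) (nhds s)"
        by eventually_elim (simp add: F_def)
      have "isCont (\<lambda>u. cts_step x y (- ln u)) s"
        using s cstep by (intro isCont_o2[of _ "\<lambda>u. - ln u" "cts_step x y"] continuous_intros)
           (auto simp: continuous_on_eq_continuous_at)
      then show ?thesis using isCont_cong[OF ev] by simp
    qed
    then have "continuous_on {0..1} F" by (simp add: continuous_at_imp_continuous_on)
    then obtain g where g: "real_polynomial_function g" "\<And>s. s \<in> {0..1} \<Longrightarrow> \<bar>F s - g s\<bar> < e / 4"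
      using Stone_Weierstrass_real_polynomial_function[of "{0..1::real}" F "e / 4"] e by auto
    obtain c m where gs: "g = (\<lambda>s. \<Sum>i\<le>m. c i * s ^ i)"
      using g(1) by (auto simp: real_polynomial_function_iff_sum)
    have Fe: "F (exp (- u)) = cts_step x y u" for u by (simp add: F_def)
    have gb: "\<bar>cts_step x y u - g (exp (- u))\<bar> \<le> e / 4" if "u \<ge> 0" for u
      using g(2)[of "exp (- u)"] that Fe[of u] by (auto intro: less_imp_le)
    have pint: "integrable (measure_pmf (\<mu> n)) (\<lambda>u. exp (- u) ^ i)" for n i
      using AEmu[of n] by (intro measure_pmf.integrable_const_bound[where B = 1]) (auto elim!: eventually_mono intro: power_le_one)
    have Mint: "integrable M (\<lambda>u. exp (- u) ^ i)" for i
      using Mpos by (intro M.integrable_const_bound[of _ 1]) (auto elim!: eventually_mono intro: power_le_one)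
    have step_b: "\<bar>cts_step x y u\<bar> \<le> 1" for u using xy by (auto simp: cts_step_def)
    have mstep [measurable]: "cts_step x y \<in> borel_measurable borel"
      using cstep by (rule borel_measurable_continuous_onI)
    have pstep: "integrable (measure_pmf (\<mu> n)) (cts_step x y)" for n
      using step_b by (intro measure_pmf.integrable_const_bound[where B = 1]) auto
    have Mstep: "integrable M (cts_step x y)" by (rule M.integrable_cts_step[OF xy])
    have pg: "integrable (measure_pmf (\<mu> n)) (\<lambda>u. g (exp (- u)))" for n
      unfolding gs by (intro Bochner_Integration.integrable_sum integrable_mult_right pint)
    have Mg: "integrable M (\<lambda>u. g (exp (- u)))"
      unfolding gs by (intro Bochner_Integration.integrable_sum integrable_mult_right Mint)
    have "(\<lambda>n. measure_pmf.expectation (\<mu> n) (\<lambda>u. g (exp (- u)))) \<longlonglongrightarrow> integral\<^sup>L M (\<lambda>u. g (exp (- u)))"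
    proof -
      have 1: "measure_pmf.expectation (\<mu> n) (\<lambda>u. g (exp (- u))) = (\<Sum>i\<le>m. c i * measure_pmf.expectation (\<mu> n) (\<lambda>u. exp (- u) ^ i))" for n
        unfolding gs by (subst Bochner_Integration.integral_sum) (auto intro!: pint simp del: exp_minus)
      have 2: "integral\<^sup>L M (\<lambda>u. g (exp (- u))) = (\<Sum>i\<le>m. c i * integral\<^sup>L M (\<lambda>u. exp (- u) ^ i))"
        unfolding gs by (subst Bochner_Integration.integral_sum) (auto intro!: Mint)
      show ?thesis unfolding 1 2 by (intro tendsto_sum tendsto_mult tendsto_const conv0)
    qed
    then obtain n0 where n0: "\<And>n. n \<ge> n0 \<Longrightarrow> \<bar>measure_pmf.expectation (\<mu> n) (\<lambda>u. g (exp (- u))) - integral\<^sup>L M (\<lambda>u. g (exp (- u)))\<bar> < e / 4"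
      using LIMSEQ_D[of _ _ "e / 4"] e by (metis real_norm_def zero_less_divide_iff zero_less_numeral)
    have d1: "\<bar>measure_pmf.expectation (\<mu> n) (cts_step x y) - measure_pmf.expectation (\<mu> n) (\<lambda>u. g (exp (- u)))\<bar> \<le> e / 4" for n
    proof -
      have "measure_pmf.expectation (\<mu> n) (cts_step x y) - measure_pmf.expectation (\<mu> n) (\<lambda>u. g (exp (- u)))
          = measure_pmf.expectation (\<mu> n) (\<lambda>u. cts_step x y u - g (exp (- u)))"
        by (simp add: Bochner_Integration.integral_diff[OF pstep pg])
      also have "\<bar>\<dots>\<bar> \<le> measure_pmf.expectation (\<mu> n) (\<lambda>u. \<bar>cts_step x y u - g (exp (- u))\<bar>)"
        by (rule integral_abs_bound)
      also have "\<dots> \<le> measure_pmf.expectation (\<mu> n) (\<lambda>u. e / 4)"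
        using AEmu[of n] gb by (intro integral_mono_AE) (auto intro!: integrable_abs Bochner_Integration.integrable_diff pstep pg elim!: eventually_mono)
      finally show ?thesis by simp
    qed
    have d2: "\<bar>integral\<^sup>L M (cts_step x y) - integral\<^sup>L M (\<lambda>u. g (exp (- u)))\<bar> \<le> e / 4"
    proof -
      have "integral\<^sup>L M (cts_step x y) - integral\<^sup>L M (\<lambda>u. g (exp (- u)))
          = integral\<^sup>L M (\<lambda>u. cts_step x y u - g (exp (- u)))"
        by (simp add: Bochner_Integration.integral_diff[OF Mstep Mg])
      also have "\<bar>\<dots>\<bar> \<le> integral\<^sup>L M (\<lambda>u. \<bar>cts_step x y u - g (exp (- u))\<bar>)"
        by (rule integral_abs_bound)
      also have "\<dots> \<le> integral\<^sup>L M (\<lambda>u. e / 4)"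
        using Mpos gb by (intro integral_mono_AE) (auto intro!: integrable_abs Bochner_Integration.integrable_diff Mstep Mg elim!: eventually_mono)
      finally show ?thesis using M.prob_space by simp
    qed
    show "\<exists>no. \<forall>n\<ge>no. norm (integral\<^sup>L (N n) (cts_step x y) - integral\<^sup>L M (cts_step x y)) < e"
    proof (intro exI[of _ n0] allI impI)
      fix n assume "n \<ge> n0"
      have "integral\<^sup>L (N n) (cts_step x y) = measure_pmf.expectation (\<mu> n) (cts_step x y)"
        unfolding N_def by (subst integral_distr) auto
      then show "norm (integral\<^sup>L (N n) (cts_step x y) - integral\<^sup>L M (cts_step x y)) < e"
        using n0[OF \<open>n \<ge> n0\<close>] d1[of n] d2 unfolding real_norm_def by linarith
    qed
  qed
  then have "weak_conv_m N M" by (intro integral_cts_step_conv_imp_weak_conv N M)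
  moreover have "cdf (N n) = cdf (measure_pmf (\<mu> n))" for n
    by (auto simp: cdf_def N_def measure_distr fun_eq_iff)
  ultimately show ?thesis by (simp add: weak_conv_m_def)
qed

section \<open>The chi-square law and its Laplace transform\<close>

lemma nn_integral_chi_square_laplace:
  assumes m: "m > 0" and l: "l \<ge> 0"
  shows "(\<integral>\<^sup>+x. ennreal (chi_square_density m x * exp (- l * x)) \<partial>lborel) = ennreal ((1 + 2 * l) powr (- real m / 2))"
proof -
  define s where "s = real m / 2"
  \<comment> \<open>The exponential rate of the density times \<open>exp (- l * x)\<close>;
    substituting \<open>t = c * x\<close> in the Gamma integral produces this integrand. The case
    \<open>l = 0\<close> later yields total mass 1.\<close>
  define c where "c = 1 / 2 + l"
  have s: "s > 0" and c: "c > 0" using m l by (auto simp: s_def c_def)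
  have G: "Gamma s > 0" using s by (rule Gamma_real_pos)
  have "ennreal (Gamma s) = (\<integral>\<^sup>+t. ennreal (indicator {0..} t * t powr (s - 1) / exp t) \<partial>lborel)"
    by (rule Gamma_conv_nn_integral_real[OF s])
  also have "\<dots> = ennreal c * (\<integral>\<^sup>+x. ennreal (indicator {0..} (c * x) * (c * x) powr (s - 1) / exp (c * x)) \<partial>lborel)"
    using nn_integral_real_affine[of "\<lambda>t. ennreal (indicator {0..} t * t powr (s - 1) / exp t)" c 0] c by simp
  also have "\<dots> = (\<integral>\<^sup>+x. ennreal c * ennreal (indicator {0..} (c * x) * (c * x) powr (s - 1) / exp (c * x)) \<partial>lborel)"
    by (rule nn_integral_cmult[symmetric]) simp
  also have "\<dots> = (\<integral>\<^sup>+x. ennreal (c powr s * 2 powr s * Gamma s) * ennreal (chi_square_density m x * exp (- l * x)) \<partial>lborel)"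
  proof (rule nn_integral_cong)
    fix x :: real
    have "c * (indicator {0..} (c * x) * (c * x) powr (s - 1) / exp (c * x))
        = c powr s * 2 powr s * Gamma s * (chi_square_density m x * exp (- l * x))"
    proof (cases "x > 0")
      case True
      have "c * (c * x) powr (s - 1) = c powr s * x powr (s - 1)"
        using c True by (simp add: powr_mult powr_diff)
      moreover have "exp (- x / 2) * exp (- l * x) = 1 / exp (c * x)"
        by (simp add: c_def exp_minus field_simps flip: exp_add)
      moreover have "indicator {0..} (c * x) = (1::real)" using c True by simp
      ultimately show ?thesis
        using True G by (simp add: chi_square_density_def s_def[symmetric] field_simps)
    next
      case False
      then show ?thesis
        using c by (cases "x = 0") (auto simp: chi_square_density_def indicator_def zero_le_mult_iff)
    qed
    then show "ennreal c * ennreal (indicator {0..} (c * x) * (c * x) powr (s - 1) / exp (c * x))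
        = ennreal (c powr s * 2 powr s * Gamma s) * ennreal (chi_square_density m x * exp (- l * x))"
      using c G by (simp flip: ennreal_mult')
  qed
  also have "\<dots> = ennreal (c powr s * 2 powr s * Gamma s) * (\<integral>\<^sup>+x. ennreal (chi_square_density m x * exp (- l * x)) \<partial>lborel)"
    by (rule nn_integral_cmult) (simp add: chi_square_density_def[abs_def])
  also have "c powr s * 2 powr s = (1 + 2 * l) powr s"
    using l by (simp add: c_def distrib_left mult.commute flip: powr_mult)
  finally have *: "ennreal (Gamma s) = ennreal ((1 + 2 * l) powr s * Gamma s) * (\<integral>\<^sup>+x. ennreal (chi_square_density m x * exp (- l * x)) \<partial>lborel)" .
  have p: "(1 + 2 * l) powr s > 0" using l by simp
  have "ennreal (1 / ((1 + 2 * l) powr s * Gamma s)) * ennreal (Gamma s)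
     = ennreal (1 / ((1 + 2 * l) powr s * Gamma s)) * ennreal ((1 + 2 * l) powr s * Gamma s) * (\<integral>\<^sup>+x. ennreal (chi_square_density m x * exp (- l * x)) \<partial>lborel)"
    by (subst *) (simp only: mult.assoc)
  also have "ennreal (1 / ((1 + 2 * l) powr s * Gamma s)) * ennreal ((1 + 2 * l) powr s * Gamma s)
     = ennreal (1 / ((1 + 2 * l) powr s * Gamma s) * ((1 + 2 * l) powr s * Gamma s))"
    using p G by (intro ennreal_mult'[symmetric]) simp
  finally have "ennreal (1 / ((1 + 2 * l) powr s * Gamma s)) * ennreal (Gamma s)
     = ennreal (1 / ((1 + 2 * l) powr s * Gamma s) * ((1 + 2 * l) powr s * Gamma s)) * (\<integral>\<^sup>+x. ennreal (chi_square_density m x * exp (- l * x)) \<partial>lborel)" .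
  moreover have "1 / ((1 + 2 * l) powr s * Gamma s) * ((1 + 2 * l) powr s * Gamma s) = 1" using p G by simp
  moreover have "ennreal (1 / ((1 + 2 * l) powr s * Gamma s)) * ennreal (Gamma s) = ennreal ((1 + 2 * l) powr (- s))"
    using p G by (simp add: powr_minus field_simps flip: ennreal_mult')
  ultimately show ?thesis by (simp add: s_def)
qed

lemma chi_square_density_nonneg: "m > 0 \<Longrightarrow> chi_square_density m x \<ge> 0"
  using Gamma_real_pos[of "real m / 2"] by (simp add: chi_square_density_def)

lemma chi_square_density_measurable [measurable]: "chi_square_density m \<in> borel_measurable borel"
  by (simp add: chi_square_density_def[abs_def])

lemma real_distribution_chi_square:
  assumes "m > 0"
  shows "real_distribution (chi_square m)"
proof -
  have "emeasure (chi_square m) UNIV = 1"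
    using nn_integral_chi_square_laplace[OF assms, of 0]
    by (simp add: chi_square_def emeasure_density)
  then have "prob_space (chi_square m)" by (intro prob_spaceI) (simp add: chi_square_def)
  then show ?thesis
    by (simp add: real_distribution_def real_distribution_axioms_def chi_square_def)
qed

lemma AE_chi_square_nonneg: "AE x in chi_square m. 0 \<le> x"
  unfolding chi_square_def by (subst AE_density) (auto simp: chi_square_density_def)

lemma chi_square_laplace:
  assumes m: "m > 0" and l: "l \<ge> 0"
  shows "integral\<^sup>L (chi_square m) (\<lambda>x. exp (- l * x)) = (1 + 2 * l) powr (- real m / 2)"
proof -
  have "integral\<^sup>L (chi_square m) (\<lambda>x. exp (- l * x)) = (\<integral>x. chi_square_density m x * exp (- l * x) \<partial>lborel)"
    unfolding chi_square_def using chi_square_density_nonneg[OF m] by (subst integral_density) auto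
  also have "\<dots> = (1 + 2 * l) powr (- real m / 2)"
    using nn_integral_chi_square_laplace[OF m l] chi_square_density_nonneg[OF m]
    by (intro integral_eq_nn_integral[THEN trans]) (auto intro!: AE_I2)
  finally show ?thesis .
qed

section \<open>The Bradley-Terry model\<close>

lemma sum_bt_pairs_symmetrized:
  fixes F :: "nat \<Rightarrow> nat \<Rightarrow> real"
  shows "(\<Sum>(i, j)\<in>bt_pairs n. F i j + F j i) = (\<Sum>i=1..n. \<Sum>j\<in>{1..n} - {i}. F i j)"
proof -
  let ?P = "bt_pairs n" and ?Q = "{(i, j). 1 \<le> j \<and> j < i \<and> i \<le> n}"
  have fin: "finite ?P" "finite ?Q"
    by (rule finite_subset[of _ "{1..n} \<times> {1..n}"]; force simp: bt_pairs_def)+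
  have "(\<Sum>i=1..n. \<Sum>j\<in>{1..n} - {i}. F i j) = (\<Sum>(i, j)\<in>(SIGMA i:{1..n}. {1..n} - {i}). F i j)"
    by (rule sum.Sigma) auto
  also have "(SIGMA i:{1..n}. {1..n} - {i}) = ?P \<union> ?Q" by (auto simp: bt_pairs_def)
  also have "(\<Sum>(i, j)\<in>?P \<union> ?Q. F i j) = (\<Sum>(i, j)\<in>?P. F i j) + (\<Sum>(i, j)\<in>?Q. F i j)"
    by (rule sum.union_disjoint[OF fin]) (auto simp: bt_pairs_def)
  also have "(\<Sum>(i, j)\<in>?Q. F i j) = (\<Sum>(i, j)\<in>?P. F j i)"
    by (rule sum.reindex_bij_witness[where i = prod.swap and j = prod.swap]) (auto simp: bt_pairs_def)
  finally show ?thesis by (simp add: sum.distrib case_prod_unfold)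
qed

lemma sum_bt_pairs_symmetric:
  fixes F :: "nat \<Rightarrow> nat \<Rightarrow> real"
  assumes sym: "\<And>i j. i \<in> {1..n} \<Longrightarrow> j \<in> {1..n} \<Longrightarrow> F i j = F j i" and diag: "\<And>i. i \<in> {1..n} \<Longrightarrow> F i i = 0"
  shows "(\<Sum>(i, j)\<in>bt_pairs n. F i j) = (\<Sum>i=1..n. \<Sum>j=1..n. F i j) / 2"
proof -
  have "2 * (\<Sum>(i, j)\<in>bt_pairs n. F i j) = (\<Sum>(i, j)\<in>bt_pairs n. F i j + F j i)"
    unfolding sum_distrib_left
  proof (intro sum.cong refl, clarify)
    fix i j assume "(i, j) \<in> bt_pairs n"
    then have "F i j = F j i" by (intro sym) (auto simp: bt_pairs_def)
    then show "2 * F i j = F i j + F j i" by simp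
  qed
  also have "\<dots> = (\<Sum>i=1..n. \<Sum>j\<in>{1..n} - {i}. F i j)" by (rule sum_bt_pairs_symmetrized)
  also have "\<dots> = (\<Sum>i=1..n. \<Sum>j=1..n. F i j)"
    by (intro sum.cong refl sum.mono_neutral_left) (auto simp: diag)
  finally show ?thesis by simp
qed

section \<open>The weighted variance and its perturbation\<close>

definition weighted_var :: "(nat \<Rightarrow> real) \<Rightarrow> nat set \<Rightarrow> (nat \<Rightarrow> real) \<Rightarrow> real" where
  "weighted_var A R f = (\<Sum>i\<in>R. A i * (f i)\<^sup>2) - (\<Sum>i\<in>R. A i * f i)\<^sup>2 / (\<Sum>i\<in>R. A i)"

text \<open>The weighted mean is the best common level \<open>c\<close>, so
  \<open>weighted_var\<close> is the value of the restricted quadratic problem.\<close>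

lemma weighted_var_shift:
  assumes "(\<Sum>i\<in>R. A i) > 0"
  shows "(\<Sum>i\<in>R. A i * (f i - c)\<^sup>2) = weighted_var A R f + (\<Sum>i\<in>R. A i) * (c - (\<Sum>i\<in>R. A i * f i) / (\<Sum>i\<in>R. A i))\<^sup>2"
proof -
  let ?S = "\<Sum>i\<in>R. A i" and ?F = "\<Sum>i\<in>R. A i * f i" and ?Q = "\<Sum>i\<in>R. A i * (f i)\<^sup>2"
  have "(\<Sum>i\<in>R. A i * (f i - c)\<^sup>2) = ?Q - 2 * c * ?F + c\<^sup>2 * ?S"
    by (simp add: power2_diff algebra_simps sum.distrib sum_subtractf sum_distrib_left sum_distrib_right)
  also have "\<dots> = ?Q - ?F\<^sup>2 / ?S + ?S * (c - ?F / ?S)\<^sup>2"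
    using assms by (simp add: field_simps power2_eq_square)
  finally show ?thesis by (simp add: weighted_var_def)
qed

lemma weighted_var_le:
  assumes "(\<Sum>i\<in>R. A i) > 0"
  shows "weighted_var A R f \<le> (\<Sum>i\<in>R. A i * (f i - c)\<^sup>2)"
  using assms by (subst weighted_var_shift) (auto intro!: mult_nonneg_nonneg)

text \<open>Only differences of \<open>f\<close> enter this form. It is the basis for perturbation,
  because the expansion of the estimator determines its coordinates only up to a common
  constant.\<close>

lemma weighted_var_pairwise:
  assumes "(\<Sum>i\<in>R. A i) > 0"
  shows "weighted_var A R f = (\<Sum>i\<in>R. \<Sum>j\<in>R. A i * A j * (f i - f j)\<^sup>2) / (2 * (\<Sum>i\<in>R. A i))"
proof -
  let ?S = "\<Sum>i\<in>R. A i" and ?F = "\<Sum>i\<in>R. A i * f i" and ?Q = "\<Sum>i\<in>R. A i * (f i)\<^sup>2"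
  have "(\<Sum>i\<in>R. \<Sum>j\<in>R. A i * A j * (f i - f j)\<^sup>2) = (\<Sum>i\<in>R. \<Sum>j\<in>R. (A i * (f i)\<^sup>2) * A j + A i * (A j * (f j)\<^sup>2) - 2 * ((A i * f i) * (A j * f j)))"
    by (intro sum.cong refl) (simp add: power2_eq_square algebra_simps)
  also have "\<dots> = ?Q * ?S + ?S * ?Q - 2 * (?F * ?F)"
    by (simp only: sum.distrib sum_subtractf sum_distrib_left[symmetric] sum_distrib_right[symmetric])
  finally have "(\<Sum>i\<in>R. \<Sum>j\<in>R. A i * A j * (f i - f j)\<^sup>2) = 2 * ?S * ?Q - 2 * ?F\<^sup>2" by (simp add: power2_eq_square algebra_simps)
  then show ?thesis using assms by (simp add: weighted_var_def diff_divide_distrib)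
qed

lemma weighted_var_perturb:
  fixes A f g :: "nat \<Rightarrow> real"
  assumes A: "\<And>i. i \<in> R \<Longrightarrow> A i \<ge> 0" and S: "(\<Sum>i\<in>R. A i) > 0"
    and fw: "\<And>i j. i \<in> R \<Longrightarrow> j \<in> R \<Longrightarrow> \<bar>f i - f j\<bar> \<le> w"
    and fg: "\<And>i j. i \<in> R \<Longrightarrow> j \<in> R \<Longrightarrow> \<bar>(f i - f j) - (g i - g j)\<bar> \<le> d"
  shows "\<bar>weighted_var A R f - weighted_var A R g\<bar> \<le> (\<Sum>i\<in>R. A i) * (d * (2 * w + d)) / 2"
proof -
  let ?S = "\<Sum>i\<in>R. A i"
  have "weighted_var A R f - weighted_var A R g = (\<Sum>i\<in>R. \<Sum>j\<in>R. A i * A j * ((f i - f j)\<^sup>2 - (g i - g j)\<^sup>2)) / (2 * ?S)"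
    unfolding weighted_var_pairwise[OF S] by (simp add: sum_subtractf right_diff_distrib diff_divide_distrib)
  also have "\<bar>\<dots>\<bar> \<le> (\<Sum>i\<in>R. \<Sum>j\<in>R. A i * A j * (d * (2 * w + d))) / (2 * ?S)"
    unfolding abs_divide
  proof (intro divide_mono order_trans[OF sum_abs] sum_mono)
    fix i j assume ij: "i \<in> R" "j \<in> R"
    have "\<bar>(f i - f j)\<^sup>2 - (g i - g j)\<^sup>2\<bar> = \<bar>(f i - f j) - (g i - g j)\<bar> * \<bar>(f i - f j) + (g i - g j)\<bar>"
      by (simp add: power2_eq_square square_diff_square_factored abs_mult mult.commute)
    also have "\<dots> \<le> d * (2 * w + d)"
      using fw[OF ij] fg[OF ij] by (intro mult_mono) auto
    finally show "\<bar>A i * A j * ((f i - f j)\<^sup>2 - (g i - g j)\<^sup>2)\<bar> \<le> A i * A j * (d * (2 * w + d))"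
      using A[OF ij(1)] A[OF ij(2)] by (simp add: abs_mult mult_left_mono)
  qed (use S in \<open>auto intro!: sum_nonneg\<close>)
  also have "(\<Sum>i\<in>R. \<Sum>j\<in>R. A i * A j * (d * (2 * w + d))) = ?S * ?S * (d * (2 * w + d))"
    by (simp only: sum_distrib_left[symmetric] sum_distrib_right[symmetric])
  also have "?S * ?S * (d * (2 * w + d)) / (2 * ?S) = ?S * (d * (2 * w + d)) / 2" using S by simp
  finally show ?thesis .
qed

text \<open>The model at one fixed size. As \<open>(1 + exp t)\<^sup>2 / exp t\<close> equals
  \<open>1 / dlogistic t\<close>, the last assumption says that \<open>b\<close> is an upper bound
  for \<open>b\<^sub>n\<close>. The condition \<open>2 * r \<le> n\<close> leaves at least half of
  the items outside \<open>R\<close>.\<close>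

locale bradley_terry =
  fixes n r K :: nat and k :: "nat \<Rightarrow> nat \<Rightarrow> nat" and \<beta> :: "nat \<Rightarrow> real" and b :: real
  assumes r3: "3 \<le> r" and n2r: "2 * r \<le> n"
    and k_sym: "\<And>i j. k i j = k j i"
    and k_range: "\<And>i j. 1 \<le> i \<Longrightarrow> i < j \<Longrightarrow> j \<le> n \<Longrightarrow> k i j \<in> {1..K}"
    and beta1: "\<beta> 1 = 0" and H0: "\<And>i. i \<in> {2..r} \<Longrightarrow> \<beta> i = \<beta> 2"
    and b1: "1 \<le> b"
    and b_bound: "\<And>i j. i \<in> {1..n} \<Longrightarrow> j \<in> {1..n} \<Longrightarrow> i \<noteq> j \<Longrightarrow> 1 / b \<le> dlogistic (\<beta> i - \<beta> j)"
begin

abbreviation I where "I \<equiv> {1..n}"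
abbreviation R where "R \<equiv> {2..r}"
abbreviation S where "S \<equiv> {1..n} - {2..r}"

text \<open>The edge weights of the Hessian, which are also the variances of the pairwise win
  counts. The diagonal is arbitrary, as \<open>k i i\<close> is unconstrained; in the sums below it
  meets a zero difference or is left out.\<close>

definition v :: "nat \<Rightarrow> nat \<Rightarrow> real" where
  "v i j = real (k i j) * dlogistic (\<beta> i - \<beta> j)"

definition noise :: "(nat \<times> nat \<Rightarrow> nat) \<Rightarrow> nat \<Rightarrow> nat \<Rightarrow> real" where
  "noise a i j = (if i = j then 0 else real (bt_win k a i j) - real (k i j) * logistic (\<beta> i - \<beta> j))"

definition score :: "(nat \<times> nat \<Rightarrow> nat) \<Rightarrow> nat \<Rightarrow> real" where
  "score a i = (\<Sum>j\<in>I. noise a i j)"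

text \<open>For different \<open>i\<close> in \<open>R\<close> these sums use disjoint sets of
  comparisons, hence are independent. They differ from the full scores by at most
  \<open>r * K\<close>.\<close>

definition score_S :: "(nat \<times> nat \<Rightarrow> nat) \<Rightarrow> nat \<Rightarrow> real" where
  "score_S a i = (\<Sum>j\<in>S. noise a i j)"

definition A :: "nat \<Rightarrow> real" where
  "A i = (\<Sum>j\<in>S. v i j)"

text \<open>Under this condition the truncated subtraction in \<open>bt_win\<close> is exact. It
  holds almost surely, and the deterministic estimates treat one such outcome at a time.\<close>

definition valid :: "(nat \<times> nat \<Rightarrow> nat) \<Rightarrow> bool" where
  "valid a \<longleftrightarrow> (\<forall>(i, j)\<in>bt_pairs n. a (i, j) \<le> k i j)"

lemma R_sub: "R \<subseteq> I" using n2r by auto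

lemma one_in: "1 \<in> I" "1 \<in> S" using n2r r3 by auto

lemma n_pos: "n > 0" "real n > 0" using n2r r3 by auto

lemma b_pos: "b > 0" using b1 by simp

lemma k_bounds: "i \<in> I \<Longrightarrow> j \<in> I \<Longrightarrow> i \<noteq> j \<Longrightarrow> 1 \<le> real (k i j) \<and> real (k i j) \<le> real K"
  using k_range[of i j] k_range[of j i] k_sym[of i j] by (cases "i < j") auto

lemma K1: "real K \<ge> 1"
  using k_bounds[of 1 2] n2r r3 by auto

lemma v_sym: "v i j = v j i"
  using dlogistic_minus[of "\<beta> i - \<beta> j"] by (simp add: v_def k_sym)

lemma v_bounds:
  assumes "i \<in> I" "j \<in> I" "i \<noteq> j"
  shows "1 / b \<le> v i j" "v i j \<le> K / 4"
proof -
  note k = k_bounds[OF assms]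
  have "1 * (1 / b) \<le> v i j" unfolding v_def
    using k b_bound[OF assms] b_pos by (intro mult_mono) auto
  then show "1 / b \<le> v i j" by simp
  have "v i j \<le> K * (1 / 4)" unfolding v_def
    using k dlogistic_le less_imp_le[OF dlogistic_pos] by (intro mult_mono) auto
  then show "v i j \<le> K / 4" by simp
qed

lemma v_nonneg: "v i j \<ge> 0"
  unfolding v_def using less_imp_le[OF dlogistic_pos] by simp

lemma card_S: "card S = n - (r - 1)" "real (card S) \<ge> real n / 2" "real (card S) > 0"
proof -
  show 1: "card S = n - (r - 1)" using R_sub r3 by (simp add: card_Diff_subset)
  then show "real (card S) \<ge> real n / 2" using n2r by simp
  then show "real (card S) > 0" using n_pos by simp
qed

lemma A_bounds:
  assumes "i \<in> R"
  shows "A i \<ge> real (card S) / b" "A i \<ge> real n / (2 * b)" "A i \<le> real n * K / 4" "A i > 0"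
proof -
  have *: "1 / b \<le> v i j" "v i j \<le> K / 4" if "j \<in> S" for j
    using that assms R_sub by (intro v_bounds; auto)+
  have "(\<Sum>j\<in>S. 1 / b) \<le> A i" unfolding A_def by (intro sum_mono *)
  then show 1: "A i \<ge> real (card S) / b" by simp
  have "real n / 2 / b \<le> real (card S) / b" using card_S(2) b_pos by (intro divide_right_mono) auto
  with 1 show 2: "A i \<ge> real n / (2 * b)" by simp
  have "A i \<le> (\<Sum>j\<in>S. real K / 4)" unfolding A_def by (intro sum_mono *)
  also have "\<dots> \<le> real n * (K / 4)" using card_S(1) by (auto intro!: mult_right_mono)
  finally show "A i \<le> real n * K / 4" by simp
  have "real n / (2 * b) > 0" using n_pos b_pos by simp
  with 2 show "A i > 0" by linarith
qed

lemma sum_A: "(\<Sum>i\<in>R. A i) > 0" "(\<Sum>i\<in>R. A i) \<le> real r * real n * K / 4"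
proof -
  show "(\<Sum>i\<in>R. A i) > 0" using A_bounds(4) r3 by (intro sum_pos) auto
  have "(\<Sum>i\<in>R. A i) \<le> (\<Sum>i\<in>R. real n * K / 4)" using A_bounds(3) by (intro sum_mono)
  also have "\<dots> \<le> real r * (real n * K / 4)" by (auto intro!: mult_right_mono)
  finally show "(\<Sum>i\<in>R. A i) \<le> real r * real n * K / 4" by simp
qed

lemma win_complement:
  assumes "valid a" "i \<in> I" "j \<in> I" "i \<noteq> j"
  shows "real (bt_win k a i j) + real (bt_win k a j i) = real (k i j)"
proof -
  have "a (i, j) \<le> k i j" if "i < j" using assms that by (auto simp: valid_def bt_pairs_def)
  moreover have "a (j, i) \<le> k j i" if "j < i" using assms that by (auto simp: valid_def bt_pairs_def)
  ultimately show ?thesis using assms(4) k_sym[of i j] by (auto simp: bt_win_def of_nat_diff)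
qed

lemma noise_antisym:
  assumes "valid a" "i \<in> I" "j \<in> I"
  shows "noise a j i = - noise a i j"
proof (cases "i = j")
  case False
  have lm: "logistic (\<beta> j - \<beta> i) = 1 - logistic (\<beta> i - \<beta> j)"
    using logistic_minus[of "\<beta> i - \<beta> j"] by simp
  show ?thesis
    using win_complement[OF assms False] False unfolding noise_def lm k_sym[of j i]
    by (simp add: algebra_simps)
qed (simp add: noise_def)

lemma noise_bound:
  assumes "valid a" "i \<in> I" "j \<in> I"
  shows "\<bar>noise a i j\<bar> \<le> K"
proof (cases "i = j")
  case False
  have "0 \<le> real (k i j) * logistic (\<beta> i - \<beta> j)" "real (k i j) * logistic (\<beta> i - \<beta> j) \<le> real (k i j) * 1"
    using logistic_bounds[of "\<beta> i - \<beta> j"] by (auto intro!: mult_left_le)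
  moreover have "noise a i j = real (bt_win k a i j) - real (k i j) * logistic (\<beta> i - \<beta> j)"
    using False by (simp add: noise_def)
  ultimately show ?thesis
    using win_complement[OF assms False] k_bounds[OF assms(2,3) False]
      of_nat_0_le_iff[of "bt_win k a i j"] of_nat_0_le_iff[of "bt_win k a j i"] by linarith
qed (use K1 in \<open>simp add: noise_def\<close>)

text \<open>Summation by parts on the complete graph: a flow paired with differences along edges
  equals its divergence paired with \<open>f\<close> at vertices. A constant \<open>f\<close> shows
  that the divergences sum to zero.\<close>

lemma sum_antisym:
  fixes h :: "nat \<Rightarrow> nat \<Rightarrow> real"
  assumes "\<And>i j. i \<in> I \<Longrightarrow> j \<in> I \<Longrightarrow> h j i = - h i j"
  shows "(\<Sum>(i, j)\<in>bt_pairs n. h i j * (f i - f j)) = (\<Sum>i\<in>I. f i * (\<Sum>j\<in>I. h i j))"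
proof -
  have h0: "h i i = 0" if "i \<in> I" for i using assms[OF that that] by simp
  have "(\<Sum>(i, j)\<in>bt_pairs n. h i j * (f i - f j)) = (\<Sum>(i, j)\<in>bt_pairs n. f i * h i j + f j * h j i)"
  proof (intro sum.cong refl, clarify)
    fix i j assume "(i, j) \<in> bt_pairs n"
    then have "h j i = - h i j" by (intro assms) (auto simp: bt_pairs_def)
    then show "h i j * (f i - f j) = f i * h i j + f j * h j i" by (simp add: algebra_simps)
  qed
  also have "\<dots> = (\<Sum>i\<in>I. \<Sum>j\<in>I - {i}. f i * h i j)" by (rule sum_bt_pairs_symmetrized)
  also have "\<dots> = (\<Sum>i\<in>I. \<Sum>j\<in>I. f i * h i j)"
    by (intro sum.cong refl sum.mono_neutral_left) (auto simp: h0)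
  finally show ?thesis by (simp add: sum_distrib_left)
qed

lemma sum_score: "valid a \<Longrightarrow> (\<Sum>i\<in>I. score a i) = 0"
  using sum_antisym[of "noise a" "\<lambda>_. 1", OF noise_antisym] by (simp add: score_def case_prod_unfold)

lemma loglik_eq:
  assumes "valid a"
  shows "bt_loglik n k a \<gamma> = (\<Sum>(i, j)\<in>bt_pairs n. real (bt_win k a i j) * (\<gamma> i - \<gamma> j) - real (k i j) * softplus (\<gamma> i - \<gamma> j))"
proof -
  have "(\<Sum>i=1..n. \<gamma> i * real (bt_degree n k a i)) = (\<Sum>i\<in>I. \<Sum>j\<in>I - {i}. \<gamma> i * real (bt_win k a i j))"
    by (simp add: bt_degree_def sum_distrib_left)
  also have "\<dots> = (\<Sum>(i, j)\<in>bt_pairs n. \<gamma> i * real (bt_win k a i j) + \<gamma> j * real (bt_win k a j i))"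
    by (rule sum_bt_pairs_symmetrized[symmetric])
  finally have "bt_loglik n k a \<gamma> = (\<Sum>p\<in>bt_pairs n. (case p of (i, j) \<Rightarrow> \<gamma> i * real (bt_win k a i j) + \<gamma> j * real (bt_win k a j i))
      - (case p of (i, j) \<Rightarrow> real (k i j) * ln (exp (\<gamma> i) + exp (\<gamma> j))))"
    unfolding bt_loglik_def sum_subtractf by simp
  also have "\<dots> = (\<Sum>(i, j)\<in>bt_pairs n. real (bt_win k a i j) * (\<gamma> i - \<gamma> j) - real (k i j) * softplus (\<gamma> i - \<gamma> j))"
  proof (intro sum.cong refl, clarify)
    fix i j assume "(i, j) \<in> bt_pairs n"
    then have ij: "i \<in> I" "j \<in> I" "i \<noteq> j" by (auto simp: bt_pairs_def)
    have "exp (\<gamma> i) + exp (\<gamma> j) = exp (\<gamma> j) * (1 + exp (\<gamma> i - \<gamma> j))" by (simp add: distrib_left flip: exp_add)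
    then have ln: "ln (exp (\<gamma> i) + exp (\<gamma> j)) = \<gamma> j + softplus (\<gamma> i - \<gamma> j)"
      by (simp add: ln_mult softplus_def)
    show "\<gamma> i * real (bt_win k a i j) + \<gamma> j * real (bt_win k a j i) - real (k i j) * ln (exp (\<gamma> i) + exp (\<gamma> j))
        = real (bt_win k a i j) * (\<gamma> i - \<gamma> j) - real (k i j) * softplus (\<gamma> i - \<gamma> j)"
      unfolding ln using win_complement[OF assms ij] by (simp add: algebra_simps flip: distrib_left)
  qed
  finally show ?thesis .
qed

text \<open>The likelihood equations at \<beta> + e, with the expected wins at \<beta> subtracted
  from both sides so that the centred score appears.\<close>

definition stationary :: "(nat \<times> nat \<Rightarrow> nat) \<Rightarrow> (nat \<Rightarrow> real) \<Rightarrow> bool" where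
  "stationary a e \<longleftrightarrow> (\<forall>i\<in>I. score a i =
     (\<Sum>j\<in>I. real (k i j) * (logistic (\<beta> i - \<beta> j + (e i - e j)) - logistic (\<beta> i - \<beta> j))))"

definition excess :: "(nat \<Rightarrow> real) \<Rightarrow> (nat \<Rightarrow> real) \<Rightarrow> real" where
  "excess e \<delta> = (\<Sum>(i, j)\<in>bt_pairs n. real (k i j) * bregman (\<beta> i - \<beta> j + (e i - e j)) (\<delta> i - \<delta> j))"

text \<open>Stationarity and summation by parts remove the terms linear in \<delta>, which leaves an
  exact identity. Since \<open>excess\<close> is nonnegative, a stationary point is automatically a
  global maximiser.\<close>

lemma loglik_diff:
  assumes a: "valid a" and st: "stationary a e"
  shows "bt_loglik n k a (\<lambda>i. \<beta> i + e i) - bt_loglik n k a (\<lambda>i. \<beta> i + e i + \<delta> i) = excess e \<delta>"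
proof -
  define h where "h = (\<lambda>i j. noise a i j - real (k i j) * (logistic (\<beta> i - \<beta> j + (e i - e j)) - logistic (\<beta> i - \<beta> j)))"
  have anti: "h j i = - h i j" if "i \<in> I" "j \<in> I" for i j
  proof -
    have "logistic (\<beta> j - \<beta> i + (e j - e i)) = 1 - logistic (\<beta> i - \<beta> j + (e i - e j))"
      using logistic_minus[of "\<beta> i - \<beta> j + (e i - e j)"] by (simp add: algebra_simps)
    moreover have "logistic (\<beta> j - \<beta> i) = 1 - logistic (\<beta> i - \<beta> j)"
      using logistic_minus[of "\<beta> i - \<beta> j"] by simp
    ultimately show ?thesis
      unfolding h_def noise_antisym[OF a that] k_sym[of j i] by (simp only:) (simp add: algebra_simps)
  qed
  have "(\<Sum>j\<in>I. h i j) = 0" if "i \<in> I" for i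
    using st that by (simp add: stationary_def h_def sum_subtractf score_def)
  then have 0: "(\<Sum>(i, j)\<in>bt_pairs n. h i j * (\<delta> i - \<delta> j)) = 0"
    using sum_antisym[of h \<delta>, OF anti] by simp
  have "bt_loglik n k a (\<lambda>i. \<beta> i + e i) - bt_loglik n k a (\<lambda>i. \<beta> i + e i + \<delta> i)
    = (\<Sum>p\<in>bt_pairs n. (case p of (i, j) \<Rightarrow> real (k i j) * bregman (\<beta> i - \<beta> j + (e i - e j)) (\<delta> i - \<delta> j))
        - (case p of (i, j) \<Rightarrow> h i j * (\<delta> i - \<delta> j)))"
    unfolding loglik_eq[OF a] sum_subtractf[symmetric]
  proof (intro sum.cong refl, clarify)
    fix i j assume "(i, j) \<in> bt_pairs n"
    then have ij: "i \<noteq> j" by (auto simp: bt_pairs_def)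
    have t: "\<beta> i + e i - (\<beta> j + e j) = \<beta> i - \<beta> j + (e i - e j)"
       "\<beta> i + e i + \<delta> i - (\<beta> j + e j + \<delta> j) = \<beta> i - \<beta> j + (e i - e j) + (\<delta> i - \<delta> j)" by simp_all
    show "real (bt_win k a i j) * (\<beta> i + e i - (\<beta> j + e j)) - real (k i j) * softplus (\<beta> i + e i - (\<beta> j + e j)) -
       (real (bt_win k a i j) * (\<beta> i + e i + \<delta> i - (\<beta> j + e j + \<delta> j)) - real (k i j) * softplus (\<beta> i + e i + \<delta> i - (\<beta> j + e j + \<delta> j)))
       = real (k i j) * bregman (\<beta> i - \<beta> j + (e i - e j)) (\<delta> i - \<delta> j) - h i j * (\<delta> i - \<delta> j)"
      unfolding t using ij by (simp add: h_def noise_def bregman_def algebra_simps)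
  qed
  then show ?thesis unfolding sum_subtractf 0 excess_def by simp
qed

lemma excess_nonneg: "excess e \<delta> \<ge> 0"
  unfolding excess_def by (intro sum_nonneg) (auto intro!: mult_nonneg_nonneg bregman_nonneg)

lemma mle_exists:
  assumes a: "valid a" and X: "\<And>i. i \<in> I \<Longrightarrow> \<bar>score a i\<bar> \<le> X" and small: "4 * b * X \<le> n"
  obtains e where "e 1 = 0" "\<And>i j. i \<in> I \<Longrightarrow> j \<in> I \<Longrightarrow> \<bar>e i - e j\<bar> \<le> 4 * b * X / n" "stationary a e"
proof -
  define H where "H = (\<lambda>i j t. real (k i j) * bregman (\<beta> i - \<beta> j) t)"
  define G where "G = (\<lambda>i j t. real (k i j) * (logistic (\<beta> i - \<beta> j + t) - logistic (\<beta> i - \<beta> j)))"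
  have Hd: "(H i j has_real_derivative G i j t) (at t)" for i j t
  proof -
    have "((\<lambda>t. softplus (\<beta> i - \<beta> j + t)) has_real_derivative logistic (\<beta> i - \<beta> j + t)) (at t)"
      using DERIV_shift[of softplus "logistic (\<beta> i - \<beta> j + t)" t "\<beta> i - \<beta> j"] DERIV_softplus
      by (simp add: add.commute)
    from this show ?thesis
      unfolding H_def G_def bregman_def by (auto intro!: derivative_eq_intros)
  qed
  have anti: "G j i (- t) = - G i j t" for i j t
  proof -
    have "logistic (\<beta> j - \<beta> i + - t) = 1 - logistic (\<beta> i - \<beta> j + t)"
      using logistic_minus[of "\<beta> i - \<beta> j + t"] by (simp add: algebra_simps)
    moreover have "logistic (\<beta> j - \<beta> i) = 1 - logistic (\<beta> i - \<beta> j)"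
      using logistic_minus[of "\<beta> i - \<beta> j"] by simp
    ultimately show ?thesis unfolding G_def k_sym[of j i] by (simp only:) (simp add: algebra_simps)
  qed
  have lower: "(1 - exp (- t)) / b \<le> G i j t" if "i \<in> I" "j \<in> I" "i \<noteq> j" "0 \<le> t" for i j t
  proof -
    have e: "1 - exp (- t) \<ge> 0" using that(4) by simp
    have "(1 - exp (- t)) / b = 1 * (1 / b * (1 - exp (- t)))" by simp
    also have "\<dots> \<le> real (k i j) * (dlogistic (\<beta> i - \<beta> j) * (1 - exp (- t)))"
      using k_bounds[OF that(1-3)] b_bound[OF that(1-3)] e b_pos by (intro mult_mono mult_right_mono) auto
    also have "\<dots> \<le> G i j t" unfolding G_def
      by (intro mult_left_mono logistic_increment_ge that) simp
    finally show ?thesis .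
  qed
  obtain e where "e 1 = 0" "\<And>i j. i \<in> I \<Longrightarrow> j \<in> I \<Longrightarrow> \<bar>e i - e j\<bar> \<le> 4 * b * X / real (card I)"
    "\<And>i. i \<in> I \<Longrightarrow> score a i = (\<Sum>j\<in>I. G i j (e i - e j))"
    by (rule edge_potential_critical_point[of I 1 b "score a" X H G], simp, rule one_in, rule b_pos,
        rule sum_score[OF a], erule X, rule Hd, rule anti, erule (3) lower, simp add: small, blast)
  then show ?thesis using that[of e] by (simp add: stationary_def G_def)
qed

end

section \<open>The likelihood ratio as a restricted quadratic minimum\<close>

context bradley_terry
begin

text \<open>Because \<beta> is constant on \<open>R\<close>, the constraint on \<beta> + e +
  \<delta> says that \<delta> is a constant minus \<open>e\<close> there. One admissible trial point
  \<open>\<delta>0\<close> bounds the statistic from above, and a lower bound on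
  \<open>excess\<close> uniform over the constraint bounds it from below; no restricted maximiser is
  required.\<close>

lemma lr_stat_bounds:
  assumes a: "valid a" and st: "stationary a e" and e1: "e 1 = 0"
    and up: "\<And>i. i \<in> R \<Longrightarrow> \<delta>0 i = c - e i" "\<delta>0 1 = 0" "2 * excess e \<delta>0 \<le> hi"
    and lo: "\<And>\<delta> g. (\<And>i. i \<in> R \<Longrightarrow> \<delta> i = g - e i) \<Longrightarrow> lo \<le> 2 * excess e \<delta>"
  shows "lo \<le> bt_lr_stat n r k a" "bt_lr_stat n r k a \<le> hi"
proof -
  define l where "l = bt_loglik n k a"
  define g where "g = (\<lambda>i. \<beta> i + e i)"
  have diff: "l g - l \<gamma> = excess e (\<lambda>i. \<gamma> i - g i)" for \<gamma>
    using loglik_diff[OF a st, of "\<lambda>i. \<gamma> i - g i"] by (simp add: l_def g_def)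
  have gP: "g \<in> bt_param_space" using e1 beta1 by (simp add: g_def bt_param_space_def)
  have max: "l \<gamma> \<le> l g" for \<gamma> using diff[of \<gamma>] excess_nonneg[of e "\<lambda>i. \<gamma> i - g i"] by linarith
  have supP: "(SUP \<gamma>\<in>bt_param_space. l \<gamma>) = l g"
    by (rule cSup_eq_maximum) (use gP max in auto)
  define \<gamma>0 where "\<gamma>0 = (\<lambda>i. g i + \<delta>0 i)"
  have "2 \<in> R" using r3 by simp
  have g0N: "\<gamma>0 \<in> bt_null_space r"
    unfolding bt_null_space_def
  proof (safe)
    show "\<gamma>0 1 = 0" using up(2) e1 beta1 by (simp add: \<gamma>0_def g_def)
    fix i assume i: "i \<in> {2..r}"
    show "\<gamma>0 i = \<gamma>0 2" using H0[OF i] up(1)[OF i] up(1)[OF \<open>2 \<in> R\<close>] by (simp add: \<gamma>0_def g_def)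
  qed
  have "l \<gamma>0 \<le> (SUP \<gamma>\<in>bt_null_space r. l \<gamma>)"
    using max g0N by (intro cSUP_upper) (auto intro!: bdd_aboveI2)
  moreover have "l g - l \<gamma>0 = excess e \<delta>0" using diff[of \<gamma>0] by (simp add: \<gamma>0_def)
  ultimately show "bt_lr_stat n r k a \<le> hi"
    using up(3) supP by (simp add: bt_lr_stat_def l_def)
  have "(SUP \<gamma>\<in>bt_null_space r. l \<gamma>) \<le> l g - lo / 2"
  proof (rule cSUP_least)
    show "bt_null_space r \<noteq> {}" using g0N by auto
    fix \<gamma> assume \<gamma>: "\<gamma> \<in> bt_null_space r"
    have "lo \<le> 2 * excess e (\<lambda>i. \<gamma> i - g i)"
    proof (rule lo[where g = "\<gamma> 2 - \<beta> 2"])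
      fix i assume i: "i \<in> R"
      have "\<gamma> i = \<gamma> 2" using \<gamma> i unfolding bt_null_space_def by blast
      then show "\<gamma> i - g i = \<gamma> 2 - \<beta> 2 - e i" using H0[OF i] by (simp add: g_def)
    qed
    then show "l \<gamma> \<le> l g - lo / 2" using diff[of \<gamma>] by linarith
  qed
  then show "lo \<le> bt_lr_stat n r k a" using supP by (simp add: bt_lr_stat_def l_def)
qed

lemma sum_split_RS:
  fixes F :: "nat \<Rightarrow> nat \<Rightarrow> real"
  assumes sym: "\<And>i j. F i j = F j i"
  shows "(\<Sum>i\<in>I. \<Sum>j\<in>I. F i j) = (\<Sum>i\<in>R. \<Sum>j\<in>R. F i j) + 2 * (\<Sum>i\<in>R. \<Sum>j\<in>S. F i j) + (\<Sum>i\<in>S. \<Sum>j\<in>S. F i j)"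
proof -
  have sp: "(\<Sum>i\<in>I. f i) = (\<Sum>i\<in>R. f i) + (\<Sum>i\<in>S. f i)" for f :: "nat \<Rightarrow> real"
    using sum.subset_diff[OF R_sub, of f] by (simp add: add.commute)
  have "(\<Sum>i\<in>S. \<Sum>j\<in>R. F i j) = (\<Sum>i\<in>R. \<Sum>j\<in>S. F i j)"
    by (subst sum.swap) (simp add: sym)
  then show ?thesis unfolding sp by (simp add: sum.distrib)
qed

lemma sum_pairs_quadratic:
  "(\<Sum>(i, j)\<in>bt_pairs n. v i j * (\<delta> i - \<delta> j)\<^sup>2)
   = (\<Sum>i\<in>R. \<Sum>j\<in>R. v i j * (\<delta> i - \<delta> j)\<^sup>2) / 2 + (\<Sum>i\<in>R. \<Sum>j\<in>S. v i j * (\<delta> i - \<delta> j)\<^sup>2)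
     + (\<Sum>i\<in>S. \<Sum>j\<in>S. v i j * (\<delta> i - \<delta> j)\<^sup>2) / 2"
proof -
  have sym: "v i j * (\<delta> i - \<delta> j)\<^sup>2 = v j i * (\<delta> j - \<delta> i)\<^sup>2" for i j
    using v_sym[of i j] by (simp add: power2_commute)
  have "(\<Sum>(i, j)\<in>bt_pairs n. v i j * (\<delta> i - \<delta> j)\<^sup>2) = (\<Sum>i\<in>I. \<Sum>j\<in>I. v i j * (\<delta> i - \<delta> j)\<^sup>2) / 2"
    by (rule sum_bt_pairs_symmetric, rule sym, simp)
  moreover have "x = (p + 2 * q + s) / 2 \<Longrightarrow> x = p / 2 + q + s / 2" for x p q s :: real by simp
  ultimately show ?thesis unfolding sum_split_RS[of "\<lambda>i j. v i j * (\<delta> i - \<delta> j)\<^sup>2", OF sym] by blast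
qed

lemma excess_upper:
  fixes e :: "nat \<Rightarrow> real" and w :: real and h :: real
  assumes "\<And>i j. i \<in> I \<Longrightarrow> j \<in> I \<Longrightarrow> \<bar>e i - e j\<bar> \<le> w" "\<And>i j. i \<in> I \<Longrightarrow> j \<in> I \<Longrightarrow> \<bar>\<delta> i - \<delta> j\<bar> \<le> h"
  shows "2 * excess e \<delta> \<le> exp (w + h) * (\<Sum>(i, j)\<in>bt_pairs n. v i j * (\<delta> i - \<delta> j)\<^sup>2)"
  unfolding excess_def sum_distrib_left
proof (intro sum_mono, clarify)
  fix i j assume "(i, j) \<in> bt_pairs n"
  then have ij: "i \<in> I" "j \<in> I" by (auto simp: bt_pairs_def)
  have "2 * bregman (\<beta> i - \<beta> j + (e i - e j)) (\<delta> i - \<delta> j) \<le> exp (\<bar>e i - e j\<bar> + \<bar>\<delta> i - \<delta> j\<bar>) * (dlogistic (\<beta> i - \<beta> j) * (\<delta> i - \<delta> j)\<^sup>2)"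
    by (rule bregman_upper)
  also have "\<dots> \<le> exp (w + h) * (dlogistic (\<beta> i - \<beta> j) * (\<delta> i - \<delta> j)\<^sup>2)"
    using assms[OF ij] less_imp_le[OF dlogistic_pos] by (intro mult_right_mono) auto
  finally have "real (k i j) * (2 * bregman (\<beta> i - \<beta> j + (e i - e j)) (\<delta> i - \<delta> j))
     \<le> real (k i j) * (exp (w + h) * (dlogistic (\<beta> i - \<beta> j) * (\<delta> i - \<delta> j)\<^sup>2))"
    by (rule mult_left_mono) simp
  then show "2 * (real (k i j) * bregman (\<beta> i - \<beta> j + (e i - e j)) (\<delta> i - \<delta> j)) \<le> exp (w + h) * (v i j * (\<delta> i - \<delta> j)\<^sup>2)"
    by (simp add: v_def mult_ac)
qed

lemma excess_lower:
  fixes e :: "nat \<Rightarrow> real" and w :: real and h :: real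
  assumes "\<And>i j. i \<in> I \<Longrightarrow> j \<in> I \<Longrightarrow> \<bar>e i - e j\<bar> \<le> w" "h \<ge> 0"
  shows "exp (- (w + h)) * (\<Sum>(i, j)\<in>bt_pairs n. v i j * (min \<bar>\<delta> i - \<delta> j\<bar> h)\<^sup>2) \<le> 2 * excess e \<delta>"
  unfolding excess_def sum_distrib_left
proof (intro sum_mono, clarify)
  fix i j assume "(i, j) \<in> bt_pairs n"
  then have ij: "i \<in> I" "j \<in> I" by (auto simp: bt_pairs_def)
  have "exp (- (w + h)) * (dlogistic (\<beta> i - \<beta> j) * (min \<bar>\<delta> i - \<delta> j\<bar> h)\<^sup>2)
     \<le> exp (- (\<bar>e i - e j\<bar> + h)) * (dlogistic (\<beta> i - \<beta> j) * (min \<bar>\<delta> i - \<delta> j\<bar> h)\<^sup>2)"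
    using assms(1)[OF ij] less_imp_le[OF dlogistic_pos] by (intro mult_right_mono) auto
  also have "\<dots> \<le> 2 * bregman (\<beta> i - \<beta> j + (e i - e j)) (\<delta> i - \<delta> j)"
    by (rule bregman_clip_lower[OF assms(2)])
  finally have "real (k i j) * (exp (- (w + h)) * (dlogistic (\<beta> i - \<beta> j) * (min \<bar>\<delta> i - \<delta> j\<bar> h)\<^sup>2))
     \<le> real (k i j) * (2 * bregman (\<beta> i - \<beta> j + (e i - e j)) (\<delta> i - \<delta> j))"
    by (rule mult_left_mono) simp
  then show "exp (- (w + h)) * (v i j * (min \<bar>\<delta> i - \<delta> j\<bar> h)\<^sup>2) \<le> 2 * (real (k i j) * bregman (\<beta> i - \<beta> j + (e i - e j)) (\<delta> i - \<delta> j))"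
    by (simp add: v_def mult_ac)
qed

lemma weighted_mean_dist:
  assumes "i \<in> R" "\<And>i j. i \<in> R \<Longrightarrow> j \<in> R \<Longrightarrow> \<bar>f i - f j\<bar> \<le> w"
  shows "\<bar>(\<Sum>j\<in>R. A j * f j) / (\<Sum>j\<in>R. A j) - f i\<bar> \<le> w"
proof -
  have eq: "(\<Sum>j\<in>R. A j * f j) / (\<Sum>j\<in>R. A j) - f i = (\<Sum>j\<in>R. A j * (f j - f i)) / (\<Sum>j\<in>R. A j)"
    using sum_A(1) by (simp add: right_diff_distrib sum_subtractf diff_divide_distrib sum_distrib_right[symmetric])
  have "\<bar>(\<Sum>j\<in>R. A j * f j) / (\<Sum>j\<in>R. A j) - f i\<bar> = \<bar>\<Sum>j\<in>R. A j * (f j - f i)\<bar> / (\<Sum>j\<in>R. A j)"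
    unfolding eq using sum_A(1) by simp
  also have "\<dots> \<le> (\<Sum>j\<in>R. A j * w) / (\<Sum>j\<in>R. A j)"
  proof (rule divide_right_mono)
    show "\<bar>\<Sum>j\<in>R. A j * (f j - f i)\<bar> \<le> (\<Sum>j\<in>R. A j * w)"
    proof (rule order_trans[OF sum_abs], rule sum_mono)
      fix j assume j: "j \<in> R"
      have "\<bar>A j * (f j - f i)\<bar> = A j * \<bar>f j - f i\<bar>" using A_bounds(4)[OF j] by (simp add: abs_mult)
      also have "\<dots> \<le> A j * w" using A_bounds(4)[OF j] by (intro mult_left_mono assms(2)[OF j assms(1)]) simp
      finally show "\<bar>A j * (f j - f i)\<bar> \<le> A j * w" .
    qed
  qed (rule less_imp_le[OF sum_A(1)])
  also have "\<dots> = w" using sum_A(1) by (simp flip: sum_distrib_right)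
  finally show ?thesis .
qed

text \<open>The trial point moves only the items of \<open>R\<close>, to the weighted mean of
  \<open>e\<close>. Pairs within \<open>S\<close> then cost nothing, pairs between \<open>R\<close>
  and \<open>S\<close> give exactly the weighted variance, and the boundedly many pairs within
  \<open>R\<close> give the remainder.\<close>

lemma excess_null_upper:
  fixes e :: "nat \<Rightarrow> real" and w :: real
  assumes ew: "\<And>i j. i \<in> I \<Longrightarrow> j \<in> I \<Longrightarrow> \<bar>e i - e j\<bar> \<le> w"
  defines "m \<equiv> (\<Sum>i\<in>R. A i * e i) / (\<Sum>i\<in>R. A i)"
  shows "2 * excess e (\<lambda>i. if i \<in> R then m - e i else 0) \<le> exp (2 * w) * (weighted_var A R e + (real r)\<^sup>2 * K * w\<^sup>2)"
proof -
  define \<delta> where "\<delta> = (\<lambda>i. if i \<in> R then m - e i else 0)"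
  have w0: "w \<ge> 0" using ew[OF one_in(1) one_in(1)] by simp
  have md: "\<bar>m - e i\<bar> \<le> w" if "i \<in> R" for i
    unfolding m_def using that ew R_sub by (intro weighted_mean_dist) auto
  have dw: "\<bar>\<delta> i - \<delta> j\<bar> \<le> w" if "i \<in> I" "j \<in> I" for i j
    using ew[OF that] md[of i] md[of j] w0 by (auto simp: \<delta>_def)
  have RR: "(\<Sum>i\<in>R. \<Sum>j\<in>R. v i j * (\<delta> i - \<delta> j)\<^sup>2) \<le> (real r)\<^sup>2 * K * w\<^sup>2"
  proof -
    have "(\<Sum>i\<in>R. \<Sum>j\<in>R. v i j * (\<delta> i - \<delta> j)\<^sup>2) \<le> (\<Sum>i\<in>R. \<Sum>j\<in>R. K * w\<^sup>2)"
    proof (intro sum_mono)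
      fix i j assume ij: "i \<in> R" "j \<in> R"
      show "v i j * (\<delta> i - \<delta> j)\<^sup>2 \<le> K * w\<^sup>2"
      proof (cases "i = j")
        case False
        have "v i j \<le> K" using v_bounds(2)[of i j] ij R_sub False by force
        moreover have "(\<delta> i - \<delta> j)\<^sup>2 \<le> w\<^sup>2" using dw[of i j] ij R_sub w0 by (subst abs_le_square_iff[symmetric]) auto
        ultimately show ?thesis using v_nonneg by (intro mult_mono) auto
      qed simp
    qed
    also have "\<dots> = (real (card R))\<^sup>2 * (K * w\<^sup>2)" by (simp only: sum_constant power2_eq_square[of "real (card R)"] mult.assoc)
    also have "\<dots> \<le> (real r)\<^sup>2 * (K * w\<^sup>2)" by (intro mult_right_mono power_mono) auto
    finally show ?thesis by simp
  qed
  have RS: "(\<Sum>i\<in>R. \<Sum>j\<in>S. v i j * (\<delta> i - \<delta> j)\<^sup>2) = weighted_var A R e"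
  proof -
    have "(\<Sum>i\<in>R. \<Sum>j\<in>S. v i j * (\<delta> i - \<delta> j)\<^sup>2) = (\<Sum>i\<in>R. A i * (e i - m)\<^sup>2)"
      unfolding A_def sum_distrib_right by (intro sum.cong refl) (auto simp: \<delta>_def power2_commute)
    also have "\<dots> = weighted_var A R e" by (subst weighted_var_shift[OF sum_A(1)]) (simp add: m_def)
    finally show ?thesis .
  qed
  have SS: "(\<Sum>i\<in>S. \<Sum>j\<in>S. v i j * (\<delta> i - \<delta> j)\<^sup>2) = 0"
    by (intro sum.neutral ballI) (auto simp: \<delta>_def)
  have "2 * excess e \<delta> \<le> exp (w + w) * (\<Sum>(i, j)\<in>bt_pairs n. v i j * (\<delta> i - \<delta> j)\<^sup>2)"
    by (rule excess_upper) (use ew dw in auto)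
  also have "\<dots> \<le> exp (w + w) * (weighted_var A R e + (real r)\<^sup>2 * K * w\<^sup>2)"
  proof (intro mult_left_mono)
    have "(\<Sum>i\<in>R. \<Sum>j\<in>R. v i j * (\<delta> i - \<delta> j)\<^sup>2) \<ge> 0" by (intro sum_nonneg mult_nonneg_nonneg v_nonneg) auto
    then show "(\<Sum>(i, j)\<in>bt_pairs n. v i j * (\<delta> i - \<delta> j)\<^sup>2) \<le> weighted_var A R e + (real r)\<^sup>2 * K * w\<^sup>2"
      unfolding sum_pairs_quadratic RS SS using RR by linarith
  qed auto
  finally show ?thesis by (simp add: \<delta>_def)
qed

text \<open>Moving the items of \<open>S\<close> could lower the cross terms. Their mean is absorbed
  into the free level \<open>g\<close>, and deviations from the mean are paid for by the form on
  \<open>S\<close>, whose spectral gap is at least \<open>N / b\<close>. What can be gained is only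
  a fraction of order \<open>b * r * K / n\<close>.\<close>

lemma quadratic_lower:
  assumes \<delta>: "\<And>i. i \<in> R \<Longrightarrow> \<delta> i = g - e i" and small: "b * r * K \<le> 2 * real n"
  shows "(1 - b * r * K / (2 * real n)) * weighted_var A R e \<le> (\<Sum>(i, j)\<in>bt_pairs n. v i j * (\<delta> i - \<delta> j)\<^sup>2)"
proof -
  define N where "N = real (card S)"
  define m where "m = real (card R)"
  have N: "N > 0" "N \<ge> real n / 2" using card_S by (auto simp: N_def)
  have m: "m > 0" "m \<le> r" using r3 by (auto simp: m_def)
  define \<mu> where "\<mu> = (\<Sum>j\<in>S. \<delta> j) / N"
  define u where "u = (\<lambda>i. \<delta> i - \<mu>)"
  have u0: "(\<Sum>j\<in>S. u j) = 0" using N by (simp add: u_def sum_subtractf \<mu>_def N_def)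
  have ud: "\<delta> i - \<delta> j = u i - u j" for i j by (simp add: u_def)
  define W where "W = (\<Sum>j\<in>S. (u j)\<^sup>2)"
  have RR: "(\<Sum>i\<in>R. \<Sum>j\<in>R. v i j * (\<delta> i - \<delta> j)\<^sup>2) \<ge> 0" by (intro sum_nonneg mult_nonneg_nonneg v_nonneg) auto
  have SS: "(\<Sum>i\<in>S. \<Sum>j\<in>S. v i j * (\<delta> i - \<delta> j)\<^sup>2) \<ge> 2 * (N / b) * W"
  proof -
    have "(\<Sum>i\<in>S. \<Sum>j\<in>S. (u i - u j)\<^sup>2) = (\<Sum>i\<in>S. \<Sum>j\<in>S. (u i)\<^sup>2 + (u j)\<^sup>2 - 2 * (u i * u j))"
      by (intro sum.cong refl) (simp add: power2_diff)
    also have "\<dots> = 2 * N * W - 2 * ((\<Sum>j\<in>S. u j) * (\<Sum>j\<in>S. u j))"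
      by (simp add: sum.distrib sum_subtractf N_def W_def sum_distrib_left[symmetric] sum_distrib_right[symmetric] del: sum_constant)
         (simp add: sum_distrib_left mult.assoc)
    finally have "2 * (N / b) * W = (\<Sum>i\<in>S. \<Sum>j\<in>S. (1 / b) * (u i - u j)\<^sup>2)"
      unfolding u0 by (simp only: sum_distrib_left[symmetric]) simp
    also have "\<dots> \<le> (\<Sum>i\<in>S. \<Sum>j\<in>S. v i j * (\<delta> i - \<delta> j)\<^sup>2)"
    proof (intro sum_mono)
      fix i j assume ij: "i \<in> S" "j \<in> S"
      show "1 / b * (u i - u j)\<^sup>2 \<le> v i j * (\<delta> i - \<delta> j)\<^sup>2"
      proof (cases "i = j")
        case False
        then show ?thesis unfolding ud using ij by (intro mult_right_mono v_bounds) auto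
      qed simp
    qed
    finally show ?thesis .
  qed
  \<comment> \<open>Chosen so that the costs \<open>W / t\<close>, summed over the \<open>m\<close>
    items of \<open>R\<close>, equal the reserve \<open>(N / b) * W\<close> provided by
    \<open>SS\<close>.\<close>
  define t where "t = b * m / N"
  have t: "t > 0" using N m b_pos by (simp add: t_def)
  have RS: "(\<Sum>j\<in>S. v i j * (\<delta> i - \<delta> j)\<^sup>2) \<ge> A i * (u i)\<^sup>2 * (1 - t * K / 4) - W / t" if i: "i \<in> R" for i
  proof -
    have "A i * (u i)\<^sup>2 * (1 - t * K / 4) - W / t = (\<Sum>j\<in>S. v i j * (u i)\<^sup>2 - v i j * (K / 4) * (u i)\<^sup>2 * t - (u j)\<^sup>2 / t)"
      unfolding sum_subtractf sum_distrib_right[symmetric] sum_divide_distrib[symmetric] A_def[symmetric] W_def[symmetric]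
      by (simp add: algebra_simps)
    also have "\<dots> \<le> (\<Sum>j\<in>S. v i j * (\<delta> i - \<delta> j)\<^sup>2)"
    proof (rule sum_mono)
      fix j assume j: "j \<in> S"
      \<comment> \<open>AM-GM with weight t\<close>
      have "0 \<le> (v i j * u i * t - u j)\<^sup>2 / t" using t by simp
      also have "\<dots> = (v i j)\<^sup>2 * (u i)\<^sup>2 * t - 2 * v i j * u i * u j + (u j)\<^sup>2 / t"
        using t by (simp add: field_simps power2_eq_square)
      finally have 1: "2 * v i j * u i * u j \<le> (v i j)\<^sup>2 * (u i)\<^sup>2 * t + (u j)\<^sup>2 / t" by simp
      have "v i j \<le> K / 4" using v_bounds(2)[of i j] i j R_sub by blast
      then have "v i j * v i j \<le> v i j * (K / 4)" by (intro mult_left_mono v_nonneg)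
      then have "(v i j)\<^sup>2 * ((u i)\<^sup>2 * t) \<le> v i j * (K / 4) * ((u i)\<^sup>2 * t)"
        unfolding power2_eq_square[of "v i j"] using t by (intro mult_right_mono) auto
      moreover have "v i j * (\<delta> i - \<delta> j)\<^sup>2 = v i j * (u i)\<^sup>2 - 2 * v i j * u i * u j + v i j * (u j)\<^sup>2"
        unfolding ud by (simp add: power2_eq_square algebra_simps)
      moreover have "v i j * (u j)\<^sup>2 \<ge> 0" using v_nonneg by simp
      ultimately show "v i j * (u i)\<^sup>2 - v i j * (K / 4) * (u i)\<^sup>2 * t - (u j)\<^sup>2 / t \<le> v i j * (\<delta> i - \<delta> j)\<^sup>2"
        using 1 by (simp add: mult.assoc)
    qed
    finally show ?thesis .
  qed
  have "t * K / 4 \<le> b * r * K / (2 * real n)"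
  proof -
    have "t \<le> b * r / (real n / 2)" unfolding t_def
      using N m b_pos n_pos by (intro divide_mono mult_left_mono mult_nonneg_nonneg) auto
    then have "t * (K / 4) \<le> b * r / (real n / 2) * (K / 4)" by (rule mult_right_mono) simp
    then show ?thesis by simp
  qed
  then have k1: "1 - b * r * K / (2 * real n) \<le> 1 - t * K / 4" by simp
  have k0: "0 \<le> 1 - b * r * K / (2 * real n)" using small n_pos by (simp add: divide_le_eq)
  have "(1 - b * r * K / (2 * real n)) * weighted_var A R e \<le> (1 - b * r * K / (2 * real n)) * (\<Sum>i\<in>R. A i * (e i - (g - \<mu>))\<^sup>2)"
    by (intro mult_left_mono weighted_var_le sum_A k0)
  also have "(\<Sum>i\<in>R. A i * (e i - (g - \<mu>))\<^sup>2) = (\<Sum>i\<in>R. A i * (u i)\<^sup>2)"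
    by (intro sum.cong refl) (simp add: u_def \<delta> power2_commute algebra_simps)
  also have "(1 - b * r * K / (2 * real n)) * (\<Sum>i\<in>R. A i * (u i)\<^sup>2) \<le> (1 - t * K / 4) * (\<Sum>i\<in>R. A i * (u i)\<^sup>2)"
    by (intro mult_right_mono k1 sum_nonneg mult_nonneg_nonneg less_imp_le[OF A_bounds(4)]) auto
  also have "\<dots> = (\<Sum>i\<in>R. A i * (u i)\<^sup>2 * (1 - t * K / 4) - W / t) + (N / b) * W"
    using m N b_pos by (simp add: sum_subtractf sum_distrib_left mult_ac t_def m_def)
  also have "\<dots> \<le> (\<Sum>i\<in>R. \<Sum>j\<in>S. v i j * (\<delta> i - \<delta> j)\<^sup>2) + (N / b) * W"
    by (intro add_mono sum_mono RS order_refl)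
  also have "\<dots> \<le> (\<Sum>(i, j)\<in>bt_pairs n. v i j * (\<delta> i - \<delta> j)\<^sup>2)"
    unfolding sum_pairs_quadratic using RR SS by linarith
  finally show ?thesis .
qed

lemma weighted_var_upper:
  fixes e :: "nat \<Rightarrow> real" and w :: real
  assumes ew: "\<And>i j. i \<in> I \<Longrightarrow> j \<in> I \<Longrightarrow> \<bar>e i - e j\<bar> \<le> w"
  shows "weighted_var A R e \<le> real r * real n * K / 4 * w\<^sup>2"
proof -
  have w0: "w \<ge> 0" using ew[OF one_in(1) one_in(1)] by simp
  have "weighted_var A R e \<le> (\<Sum>i\<in>R. A i * (e i - e 1)\<^sup>2)" by (rule weighted_var_le[OF sum_A(1)])
  also have "\<dots> \<le> (\<Sum>i\<in>R. A i * w\<^sup>2)"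
  proof (intro sum_mono mult_left_mono)
    fix i assume i: "i \<in> R"
    show "(e i - e 1)\<^sup>2 \<le> w\<^sup>2" using ew[of i 1] one_in i R_sub w0 by (subst abs_le_square_iff[symmetric]) auto
    show "0 \<le> A i" using A_bounds(4)[OF i] by simp
  qed
  also have "\<dots> = (\<Sum>i\<in>R. A i) * w\<^sup>2" by (simp add: sum_distrib_right)
  also have "\<dots> \<le> real r * real n * K / 4 * w\<^sup>2" by (intro mult_right_mono sum_A) simp
  finally show ?thesis .
qed

lemma weighted_var_nonneg: "weighted_var A R e \<ge> 0"
  unfolding weighted_var_pairwise[OF sum_A(1)]
  using sum_A(1) A_bounds(4) by (intro divide_nonneg_pos sum_nonneg mult_nonneg_nonneg) (auto intro: less_imp_le)

text \<open>If all increments of \<delta> are at most \<open>h\<close>, clipping has no effect and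
  \<open>quadratic_lower\<close> applies. Otherwise one long increment forces an excess of order
  \<open>n * h\<^sup>2 / b\<close>, and the factor \<open>20 * r * K * b\<close> in \<open>h\<close>
  lifts this above the crude bound \<open>r * n * K * w\<^sup>2 / 4\<close> on the weighted
  variance.\<close>

lemma excess_null_lower:
  fixes e :: "nat \<Rightarrow> real" and w :: real
  assumes ew: "\<And>i j. i \<in> I \<Longrightarrow> j \<in> I \<Longrightarrow> \<bar>e i - e j\<bar> \<le> w" and \<delta>: "\<And>i. i \<in> R \<Longrightarrow> \<delta> i = g - e i"
    and small: "b * r * K \<le> 2 * real n" and small2: "w + 20 * real r * real K * b * w \<le> 1"
  shows "(1 - w - 20 * real r * real K * b * w) * (1 - b * r * K / (2 * real n)) * weighted_var A R e \<le> 2 * excess e \<delta>"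
proof -
  define h where "h = 20 * real r * real K * b * w"
  define W where "W = weighted_var A R e"
  define \<kappa> where "\<kappa> = b * r * K / (2 * real n)"
  have w0: "w \<ge> 0" using ew[OF one_in(1) one_in(1)] by simp
  have h0: "h \<ge> 0" using w0 b_pos by (simp add: h_def)
  have \<kappa>: "0 \<le> 1 - \<kappa>" "\<kappa> \<ge> 0" using small n_pos b_pos by (auto simp: \<kappa>_def divide_le_eq)
  have W0: "W \<ge> 0" unfolding W_def by (rule weighted_var_nonneg)
  have wh: "0 \<le> 1 - w - h" using small2 by (simp add: h_def)
  have ex: "1 - w - h \<le> exp (- (w + h))" using exp_ge_add_one_self[of "- (w + h)"] by linarith
  have low: "exp (- (w + h)) * (\<Sum>(i, j)\<in>bt_pairs n. v i j * (min \<bar>\<delta> i - \<delta> j\<bar> h)\<^sup>2) \<le> 2 * excess e \<delta>"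
    by (rule excess_lower[OF ew h0])
  have "(1 - w - h) * ((1 - \<kappa>) * W) \<le> 2 * excess e \<delta>"
  proof (cases "\<forall>i\<in>I. \<forall>j\<in>I. \<bar>\<delta> i - \<delta> j\<bar> \<le> h")
    case True
    have "(1 - w - h) * ((1 - \<kappa>) * W) \<le> exp (- (w + h)) * (\<Sum>(i, j)\<in>bt_pairs n. v i j * (\<delta> i - \<delta> j)\<^sup>2)"
      unfolding \<kappa>_def W_def
      by (intro mult_mono ex quadratic_lower[OF \<delta> small]) (use \<kappa> W0 in \<open>auto simp: W_def \<kappa>_def\<close>)
    also have "(\<Sum>(i, j)\<in>bt_pairs n. v i j * (\<delta> i - \<delta> j)\<^sup>2) = (\<Sum>(i, j)\<in>bt_pairs n. v i j * (min \<bar>\<delta> i - \<delta> j\<bar> h)\<^sup>2)"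
      using True by (intro sum.cong refl) (auto simp: bt_pairs_def)
    finally show ?thesis using low by linarith
  next
    case False
    \<comment> \<open>away from the estimator even the clipped increments outweigh the weighted variance\<close>
    then obtain p q where pq: "p \<in> I" "q \<in> I" "h < \<bar>\<delta> p - \<delta> q\<bar>" by force
    define M where "M = (\<lambda>i j. (min \<bar>\<delta> i - \<delta> j\<bar> h)\<^sup>2)"
    have Msym: "M i j = M j i" for i j by (simp add: M_def abs_minus_commute)
    have M0: "M i j \<ge> 0" for i j by (simp add: M_def)
    have Md: "M i i = 0" for i using h0 by (simp add: M_def)
    have pq': "p \<noteq> q" using pq(3) h0 by auto
    have "real n * h\<^sup>2 / 4 = (\<Sum>j\<in>I. h\<^sup>2 / 4)" by simp
    also have "\<dots> \<le> (\<Sum>j\<in>I. M p j + M q j)"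
    proof (rule sum_mono)
      fix j assume "j \<in> I"
      \<comment> \<open>By the triangle inequality every \<open>j\<close> is far from
        \<open>p\<close> or from \<open>q\<close>, so a single long increment produces about
        \<open>n\<close> substantial ones.\<close>
      have "h / 2 \<le> \<bar>\<delta> p - \<delta> j\<bar> \<or> h / 2 \<le> \<bar>\<delta> q - \<delta> j\<bar>" using pq(3) by linarith
      then have "h / 2 \<le> min \<bar>\<delta> p - \<delta> j\<bar> h \<or> h / 2 \<le> min \<bar>\<delta> q - \<delta> j\<bar> h" using h0 by auto
      then have "(h / 2)\<^sup>2 \<le> M p j \<or> (h / 2)\<^sup>2 \<le> M q j" unfolding M_def using h0 by (auto intro!: power_mono)
      then show "h\<^sup>2 / 4 \<le> M p j + M q j" using M0[of p j] M0[of q j] by (auto simp: power_divide)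
    qed
    also have "\<dots> = (\<Sum>i\<in>{p, q}. \<Sum>j\<in>I. M i j)" using pq' by (simp add: sum.distrib)
    also have "\<dots> \<le> (\<Sum>i\<in>I. \<Sum>j\<in>I. M i j)" using pq by (intro sum_mono2 sum_nonneg M0) auto
    also have "\<dots> = 2 * (\<Sum>(i, j)\<in>bt_pairs n. M i j)" by (subst sum_bt_pairs_symmetric[OF Msym Md]) auto
    finally have Msum: "real n * h\<^sup>2 / 8 \<le> (\<Sum>(i, j)\<in>bt_pairs n. M i j)" by simp
    have "1 / 9 * (1 / b * (real n * h\<^sup>2 / 8)) \<le> exp (- (w + h)) * (\<Sum>(i, j)\<in>bt_pairs n. v i j * M i j)"
    proof (rule mult_mono)
      have "exp (w + h) \<le> exp 1" using wh by simp
      also have "\<dots> \<le> 3" by (rule exp_le)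
      finally have "inverse 3 \<le> exp (- (w + h))" unfolding exp_minus[of "w + h"] by (rule le_imp_inverse_le) simp
      then show "1 / 9 \<le> exp (- (w + h))" by (rule order_trans[rotated]) simp
      have "1 / b * (real n * h\<^sup>2 / 8) \<le> 1 / b * (\<Sum>(i, j)\<in>bt_pairs n. M i j)"
        using b_pos by (intro mult_left_mono Msum) auto
      also have "\<dots> \<le> (\<Sum>(i, j)\<in>bt_pairs n. v i j * M i j)"
        unfolding sum_distrib_left
      proof (intro sum_mono, clarify)
        fix i j assume "(i, j) \<in> bt_pairs n"
        then show "1 / b * M i j \<le> v i j * M i j"
          by (intro mult_right_mono v_bounds M0) (auto simp: bt_pairs_def)
      qed
      finally show "1 / b * (real n * h\<^sup>2 / 8) \<le> (\<Sum>(i, j)\<in>bt_pairs n. v i j * M i j)" .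
    qed (use b_pos in auto)
    also have "\<dots> \<le> 2 * excess e \<delta>" using low by (simp add: M_def)
    finally have 1: "real n * h\<^sup>2 / (72 * b) \<le> 2 * excess e \<delta>" by (simp add: field_simps)
    have "W \<le> real r * real n * K / 4 * w\<^sup>2" unfolding W_def by (rule weighted_var_upper[OF ew])
    also have "\<dots> \<le> real n * h\<^sup>2 / (72 * b)"
    proof -
      have rK1: "real r * K \<ge> 1 * 1" using r3 K1 by (intro mult_mono) auto
      then have rK: "real r * K * (real r * K) \<ge> 1 * (real r * K)" by (intro mult_right_mono) auto
      have "real n * h\<^sup>2 / (72 * b) = (400 / 72) * b * (real r * K * (real r * K)) * (real n * w\<^sup>2)"
        using b_pos by (simp add: h_def power2_eq_square field_simps)
      also have "\<dots> \<ge> (1 / 4) * 1 * (1 * (real r * K)) * (real n * w\<^sup>2)"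
        using b1 rK rK1 by (intro mult_right_mono mult_mono) auto
      finally show ?thesis by (simp add: mult_ac)
    qed
    finally have "W \<le> 2 * excess e \<delta>" using 1 by linarith
    moreover have "(1 - w - h) * ((1 - \<kappa>) * W) \<le> 1 * (1 * W)"
      using wh w0 h0 \<kappa> W0 by (intro mult_mono) auto
    ultimately show ?thesis by simp
  qed
  then show ?thesis by (simp add: h_def \<kappa>_def W_def mult.assoc)
qed

end

section \<open>Expansion of the estimator\<close>

text \<open>Applied with \<open>N = sqrt n\<close>; the right side is the common small parameter
  \<open>t\<close>, with the extreme exponents among the error terms treated this way.\<close>

lemma monomial_le:
  fixes b l N :: real
  assumes "b \<ge> 1" "l \<ge> 1" "N \<ge> 1" "p \<le> 5" "q \<le> 3" "1 \<le> s"
  shows "b ^ p * l ^ q / N ^ s \<le> b ^ 5 * l ^ 3 / N"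
proof -
  have "b ^ p * l ^ q \<le> b ^ 5 * l ^ 3" using assms by (intro mult_mono power_increasing) auto
  moreover have "N ^ 1 \<le> N ^ s" using assms by (intro power_increasing) auto
  ultimately show ?thesis using assms by (intro frac_le) auto
qed

lemma scaled_monomial_le:
  fixes R K t x :: real
  assumes "R \<ge> 1" "K \<ge> 1" "t \<ge> 0" "x \<le> t" "p \<le> 3" "q \<le> 9" "c \<ge> 0"
  shows "c * R ^ p * K ^ q * x \<le> c * (R ^ 3 * K ^ 9 * t)"
proof -
  have "R ^ p * K ^ q * x \<le> R ^ p * K ^ q * t" using assms by (intro mult_left_mono) auto
  also have "\<dots> \<le> R ^ 3 * K ^ 9 * t" using assms by (intro mult_right_mono mult_mono power_increasing) auto
  finally have "c * (R ^ p * K ^ q * x) \<le> c * (R ^ 3 * K ^ 9 * t)" using assms by (intro mult_left_mono) auto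
  then show ?thesis by (simp add: mult.assoc)
qed

text \<open>Here \<open>N = sqrt n\<close>, \<open>w\<close> bounds the oscillation of the
  estimator, \<open>D\<close> is the accuracy of its expansion, and \<open>W\<close>,
  \<open>Q\<close> are the weighted variances of the estimator and of its linearisation. The
  decisive term is \<open>N\<^sup>2 * D * w\<close>, of order \<open>b ^ 5 * l ^ 3 / N\<close>. The
  constant 6000 covers 5406 for the distance of \<open>W\<close> and \<open>Q\<close> and at most
  338 for that of \<open>L\<close> and \<open>W\<close>.\<close>

lemma lr_error_arith:
  fixes b l N R K W Q L :: real
  assumes b: "b \<ge> 1" and l: "l \<ge> 1" and N: "N \<ge> 1" and R: "R \<ge> 1" and K: "K \<ge> 1"
  defines "t \<equiv> b ^ 5 * l ^ 3 / N"
  defines "w \<equiv> 4 * K * b * l / N"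
  defines "D \<equiv> 204 * R * K ^ 4 * b ^ 4 * l\<^sup>2 / N\<^sup>2"
  assumes small: "100 * R * K\<^sup>2 * t \<le> 1"
    and W: "0 \<le> W" "W \<le> R * N\<^sup>2 * K / 4 * w\<^sup>2"
    and up: "L \<le> exp (2 * w) * (W + R\<^sup>2 * K * w\<^sup>2)"
    and lo: "(1 - w - 20 * R * K * b * w) * (1 - b * R * K / (2 * N\<^sup>2)) * W \<le> L"
    and WQ: "\<bar>W - Q\<bar> \<le> R * N\<^sup>2 * K / 4 * (D * (2 * w + D)) / 2"
  shows "\<bar>L - Q\<bar> \<le> 6000 * (R ^ 3 * K ^ 9 * t)"
proof -
  define Z where "Z = R ^ 3 * K ^ 9 * t"
  have t0: "t \<ge> 0" using b l N by (simp add: t_def)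
  note mono = monomial_le[OF b l N, folded t_def]
  note sc = scaled_monomial_le[OF R K t0, folded Z_def]
  have Z0: "Z \<ge> 0" using t0 R K by (simp add: Z_def)
  have N0: "N > 0" "N \<noteq> 0" using N by auto
  have t1: "t \<le> 1"
  proof -
    have "1 * 1 * t \<le> 100 * R * K\<^sup>2 * t" using R K t0 by (intro mult_right_mono mult_mono) (auto simp: one_le_power)
    then show ?thesis using small by simp
  qed
  have w0: "w \<ge> 0" using K b l N by (simp add: w_def)
  have h0: "20 * R * K * b * w \<ge> 0" using K b R w0 by simp
  have k0: "b * R * K / (2 * N\<^sup>2) \<ge> 0" using K b R by simp
  have wt: "w \<le> 4 * K * t"
  proof -
    have "w = 4 * K * (b ^ 1 * l ^ 1 / N ^ 1)" by (simp add: w_def)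
    also have "\<dots> \<le> 4 * K * t" using K by (intro mult_left_mono mono) auto
    finally show ?thesis .
  qed
  have wh: "w \<le> 1 / 2"
  proof -
    have "4 * (1 * (K * 1)) * t \<le> 100 / 2 * (R * (K * K)) * t" using R K t0 by (intro mult_right_mono mult_mono) auto
    then have "4 * K * t \<le> 100 / 2 * (R * (K * K)) * t" by (simp only: mult_1 mult_1_right)
    moreover have "100 / 2 * (R * (K * K)) * t = (100 * R * K\<^sup>2 * t) / 2" by (simp add: power2_eq_square)
    ultimately show ?thesis using wt small by linarith
  qed
  have W2: "W \<le> 4 * R * K ^ 3 * (b\<^sup>2 * l\<^sup>2)"
    using W(2) N0 by (simp add: w_def power2_eq_square eval_nat_numeral field_simps)
  have wW: "w * W \<le> 16 * R * K ^ 4 * (b ^ 3 * l ^ 3 / N)"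
  proof -
    have "w * W \<le> w * (4 * R * K ^ 3 * (b\<^sup>2 * l\<^sup>2))" by (intro mult_left_mono W2 w0)
    then show ?thesis by (simp add: w_def power2_eq_square eval_nat_numeral mult_ac)
  qed
  have wW': "w * W \<le> 16 * Z"
  proof -
    have "16 * R ^ 1 * K ^ 4 * (b ^ 3 * l ^ 3 / N ^ 1) \<le> 16 * Z" by (intro sc mono) auto
    then show ?thesis using wW by simp
  qed
  have hW: "20 * R * K * b * w * W \<le> 320 * Z"
  proof -
    have "20 * R * K * b * (w * W) \<le> 20 * R * K * b * (16 * R * K ^ 4 * (b ^ 3 * l ^ 3 / N))"
      using R K b by (intro mult_left_mono wW) auto
    also have "\<dots> = 320 * R ^ 2 * K ^ 5 * (b ^ 4 * l ^ 3 / N ^ 1)"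
      by (simp add: eval_nat_numeral mult_ac)
    also have "\<dots> \<le> 320 * Z" by (intro sc mono) auto
    finally show ?thesis by (simp add: mult_ac)
  qed
  have kW: "b * R * K / (2 * N\<^sup>2) * W \<le> 2 * Z"
  proof -
    have "b * R * K / (2 * N\<^sup>2) * W \<le> b * R * K / (2 * N\<^sup>2) * (4 * R * K ^ 3 * (b\<^sup>2 * l\<^sup>2))"
      by (intro mult_left_mono W2 k0)
    also have "\<dots> = 2 * R ^ 2 * K ^ 4 * (b ^ 3 * l ^ 2 / N ^ 2)"
      by (simp add: eval_nat_numeral mult_ac)
    also have "\<dots> \<le> 2 * Z" by (intro sc mono) auto
    finally show ?thesis .
  qed
  have lower: "W - L \<le> 338 * Z"
  proof -
    have "W - (w * W + 20 * R * K * b * w * W + b * R * K / (2 * N\<^sup>2) * W)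
       \<le> (1 - w - 20 * R * K * b * w) * (1 - b * R * K / (2 * N\<^sup>2)) * W"
    proof -
      define u k where "u = w + 20 * R * K * b * w" and "k = b * R * K / (2 * N\<^sup>2)"
      have "u \<ge> 0" "k \<ge> 0" using w0 h0 k0 by (simp_all only: u_def k_def add_nonneg_nonneg)
      then have "u * k * W \<ge> 0" using W(1) by simp
      then have "W - (u * W + k * W) \<le> (1 - u) * (1 - k) * W" by (simp add: algebra_simps)
      then show ?thesis by (simp add: u_def k_def algebra_simps)
    qed
    then show ?thesis using lo wW' hW kW by linarith
  qed
  have upper: "L - W \<le> 80 * Z"
  proof -
    have "exp (2 * w) \<le> 1 + 2 * w + (2 * w)\<^sup>2" using w0 wh by (intro exp_bound) auto
    also have "(2 * w)\<^sup>2 \<le> 2 * w" using w0 wh mult_left_mono[of "2 * w" 1 "2 * w"] by (simp add: power2_eq_square)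
    finally have e: "exp (2 * w) \<le> 1 + 4 * w" by simp
    have w2: "w\<^sup>2 \<le> w" using w0 wh mult_left_mono[of w 1 w] by (simp add: power2_eq_square)
    have "R\<^sup>2 * K * w\<^sup>2 \<le> R\<^sup>2 * K * (4 * K * t)" using w2 wt R K by (intro mult_left_mono) auto
    also have "\<dots> = 4 * R ^ 2 * K ^ 2 * t" by (simp add: power2_eq_square mult_ac)
    also have "\<dots> \<le> 4 * Z" by (intro sc) auto
    finally have RK: "R\<^sup>2 * K * w\<^sup>2 \<le> 4 * Z" .
    have RK0: "R\<^sup>2 * K * w\<^sup>2 \<ge> 0" using R K by simp
    have "L \<le> (1 + 4 * w) * (W + R\<^sup>2 * K * w\<^sup>2)"
      using up e W(1) RK0 by (meson add_nonneg_nonneg mult_right_mono order_trans)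
    also have "\<dots> = W + 4 * (w * W) + (1 + 4 * w) * (R\<^sup>2 * K * w\<^sup>2)" by (simp add: algebra_simps)
    finally have "L \<le> W + 4 * (w * W) + (1 + 4 * w) * (R\<^sup>2 * K * w\<^sup>2)" .
    moreover have "(1 + 4 * w) * (R\<^sup>2 * K * w\<^sup>2) \<le> 3 * (4 * Z)" by (rule mult_mono) (use RK RK0 wh w0 in auto)
    ultimately show ?thesis using wW' Z0 by linarith
  qed
  have "R * N\<^sup>2 * K / 4 * (D * (2 * w + D)) / 2 \<le> 5406 * Z"
  proof -
    have "R * N\<^sup>2 * K / 4 * (D * (2 * w + D)) / 2 = (204 / 8) * R\<^sup>2 * K ^ 5 * (b ^ 4 * l\<^sup>2) * (2 * w + D)"
      using N0 by (simp add: D_def power2_eq_square eval_nat_numeral field_simps)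
    also have "\<dots> = 204 * R ^ 2 * K ^ 6 * (b ^ 5 * l ^ 3 / N ^ 1) + 5202 * R ^ 3 * K ^ 9 * (b ^ 8 * l ^ 4 / N\<^sup>2)"
      using N0 by (simp add: D_def w_def power2_eq_square eval_nat_numeral field_simps)
    also have "\<dots> \<le> 204 * Z + 5202 * Z"
    proof (rule add_mono)
      show "204 * R ^ 2 * K ^ 6 * (b ^ 5 * l ^ 3 / N ^ 1) \<le> 204 * Z" by (intro sc mono) auto
      \<comment> \<open>The term quadratic in \<open>D\<close> has too high a power of
        \<open>b\<close> for \<open>monomial_le\<close>; it is compared with \<open>t * t\<close>,
        where \<open>t \<le> 1\<close>.\<close>
      have "b ^ 8 * l ^ 4 / N\<^sup>2 \<le> b ^ 10 * l ^ 6 / N\<^sup>2"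
        using b l N by (intro divide_right_mono mult_mono power_increasing) auto
      also have "\<dots> = t * t" by (simp add: t_def power2_eq_square eval_nat_numeral mult_ac)
      also have "\<dots> \<le> t" using t0 t1 by (simp add: mult_left_le)
      finally show "5202 * R ^ 3 * K ^ 9 * (b ^ 8 * l ^ 4 / N\<^sup>2) \<le> 5202 * Z" by (intro sc) auto
    qed
    finally show ?thesis by simp
  qed
  then have "\<bar>W - Q\<bar> \<le> 5406 * Z" using WQ by linarith
  then show ?thesis using lower upper Z0 unfolding Z_def[symmetric] by linarith
qed

section \<open>Correctors and the linear expansion of the estimator\<close>

context bradley_terry
begin

lemma inverse_A_bounds:
  assumes i: "i \<in> R"
  shows "1 / A i \<le> 2 * b / n" "1 / A i > 0"
proof -
  have "1 / A i \<le> 1 / (real n / (2 * b))"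
    using A_bounds(2,4)[OF i] n_pos b_pos by (intro divide_left_mono) (auto intro!: divide_pos_pos mult_pos_pos)
  then show "1 / A i \<le> 2 * b / n" by simp
  show "1 / A i > 0" using A_bounds(4)[OF i] by simp
qed

definition bump :: "nat \<Rightarrow> nat \<Rightarrow> real" where
  "bump i m = (if m = i then 1 / A i else 0)"

text \<open>A corrector \<open>z\<close> turns the one-point function \<open>bump i\<close> into the exact solution \<open>bump i + z\<close> of
  \<open>V f = 1\<^sub>i - 1/n\<close>; it is smaller than \<open>bump i\<close> by a factor of order \<open>b / n\<close>.\<close>

definition is_corrector :: "nat \<Rightarrow> (nat \<Rightarrow> real) \<Rightarrow> bool" where
  "is_corrector i z \<longleftrightarrow> z 1 = 0 \<and> (\<forall>p\<in>I. \<forall>q\<in>I. \<bar>z p - z q\<bar> \<le> 4 * real r * real K * b\<^sup>2 / (real n)\<^sup>2) \<and>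
     (\<forall>m\<in>I. (\<Sum>j\<in>I. v m j * (z m - z j)) = (if m = i then 1 else 0) - 1 / n - (\<Sum>j\<in>I. v m j * (bump i m - bump i j)))"

text \<open>The bump alone leaves a residual \<pi> of size at most \<open>r * K * b / n\<close>: at
  \<open>i\<close> it comes from the weights within \<open>R\<close>, elsewhere from the single
  weight \<open>v m i / A i\<close>, besides the \<open>1 / n\<close>. The residual sums to zero, so
  \<open>edge_potential_critical_point\<close> with quadratic potentials inverts it, at the cost of
  a further factor \<open>4 * b / n\<close>.\<close>

lemma corrector_exists:
  assumes i: "i \<in> R" and small: "4 * real r * real K * b\<^sup>2 \<le> (real n)\<^sup>2"
  shows "\<exists>z. is_corrector i z"
proof -
  define \<pi> where "\<pi> = (\<lambda>m. (if m = i then 1 else 0) - 1 / n - (\<Sum>j\<in>I. v m j * (bump i m - bump i j)))"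
  define X where "X = real r * real K * b / n"
  have iI: "i \<in> I" using i R_sub by auto
  have Vanti: "v j m * (f j - f m) = - (v m j * (f m - f j))" for f :: "nat \<Rightarrow> real" and j m
    using v_sym[of j m] by (simp add: algebra_simps)
  have "(\<Sum>m\<in>I. \<Sum>j\<in>I. v m j * (bump i m - bump i j)) = 0"
    using sum_antisym[of "\<lambda>m j. v m j * (bump i m - bump i j)" "\<lambda>_. 1", OF Vanti] by (simp add: case_prod_unfold)
  moreover have "(\<Sum>m\<in>I. if m = i then 1 else 0 :: real) = 1" using iI by simp
  moreover have "(\<Sum>m\<in>I. 1 / real n) = 1" using n_pos by simp
  ultimately have sum0: "(\<Sum>m\<in>I. \<pi> m) = 0" unfolding \<pi>_def sum_subtractf by simp
  note A = inverse_A_bounds[OF i]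
  have Kb: "K * b \<ge> 1" using K1 b1 mult_mono[of 1 "real K" 1 b] by simp
  have bound: "\<bar>\<pi> m\<bar> \<le> X" if m: "m \<in> I" for m
  proof (cases "m = i")
    case True
    have "(\<Sum>j\<in>I. v i j * (bump i i - bump i j)) = (\<Sum>j\<in>I - {i}. v i j * (1 / A i))"
      using iI by (subst sum.remove[of _ i]) (auto simp: bump_def intro!: sum.cong)
    also have "\<dots> = (\<Sum>j\<in>I - {i}. v i j) * (1 / A i)" by (rule sum_distrib_right[symmetric])
    also have "(\<Sum>j\<in>I - {i}. v i j) = A i + (\<Sum>j\<in>R - {i}. v i j)"
    proof -
      have "I - {i} = S \<union> (R - {i})" using R_sub i by auto
      moreover have "sum (v i) (S \<union> (R - {i})) = sum (v i) S + sum (v i) (R - {i})"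
        by (rule sum.union_disjoint) auto
      ultimately show ?thesis unfolding A_def by (simp only:)
    qed
    also have "(A i + (\<Sum>j\<in>R - {i}. v i j)) * (1 / A i) = 1 + (\<Sum>j\<in>R - {i}. v i j) * (1 / A i)"
      using A_bounds(4)[OF i] by (simp add: add_divide_distrib)
    finally have eq: "\<pi> m = - (1 / n) - (\<Sum>j\<in>R - {i}. v i j) * (1 / A i)" by (simp add: \<pi>_def True)
    have s0: "0 \<le> (\<Sum>j\<in>R - {i}. v i j)" by (intro sum_nonneg v_nonneg)
    have "(\<Sum>j\<in>R - {i}. v i j) \<le> (\<Sum>j\<in>R - {i}. K / 4)"
      using i R_sub by (intro sum_mono v_bounds) auto
    also have "\<dots> \<le> (r - 2) * (K / 4)" using i by (auto intro!: mult_right_mono)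
    finally have "(\<Sum>j\<in>R - {i}. v i j) * (1 / A i) \<le> (r - 2) * (K / 4) * (2 * b / n)"
      using A s0 by (intro mult_mono) auto
    moreover have "(\<Sum>j\<in>R - {i}. v i j) * (1 / A i) \<ge> 0" using s0 A by (intro mult_nonneg_nonneg) auto
    ultimately have "\<bar>\<pi> m\<bar> \<le> 1 / n + (r - 2) * (K / 4) * (2 * b / n)"
      unfolding eq using zero_le_divide_1_iff[of "real n"] of_nat_0_le_iff[of n] by linarith
    also have "\<dots> \<le> K * b / n + (real r - 2) * (K * b / n)"
    proof (rule add_mono)
      show "1 / real n \<le> K * b / n" using Kb by (rule divide_right_mono) simp
      have "real K * b / n \<ge> 0" using b_pos by simp
      moreover have "K / 4 * (2 * b / n) = real K * b / n / 2" by (simp add: mult.commute)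
      moreover have "0 \<le> x \<Longrightarrow> x / 2 \<le> x" for x :: real by simp
      ultimately have "K / 4 * (2 * b / n) \<le> K * b / n" by metis
      then have "(real r - 2) * (K / 4 * (2 * b / n)) \<le> (real r - 2) * (K * b / n)"
        using r3 by (intro mult_left_mono) auto
      then show "(r - 2) * (K / 4) * (2 * b / n) \<le> (real r - 2) * (K * b / n)"
        using r3 by (simp only: of_nat_diff mult.assoc) simp
    qed
    also have "\<dots> \<le> X" using b_pos n_pos by (simp add: X_def field_simps)
    finally show ?thesis .
  next
    case False
    have "(\<Sum>j\<in>I. v m j * (bump i m - bump i j)) = - v m i * (1 / A i)"
      using iI False by (subst sum.remove[of _ i]) (auto simp: bump_def intro!: sum.neutral)
    then have eq: "\<pi> m = - (1 / n) + v m i * (1 / A i)" using False by (simp add: \<pi>_def)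
    have "v m i * (1 / A i) \<le> K / 4 * (2 * b / n)"
      using A v_bounds(2)[OF m iI False] v_nonneg by (intro mult_mono) auto
    moreover have "v m i * (1 / A i) \<ge> 0" using A v_nonneg by (intro mult_nonneg_nonneg) auto
    ultimately have "\<bar>\<pi> m\<bar> \<le> 1 / n + K / 4 * (2 * b / n)"
      unfolding eq using zero_le_divide_1_iff[of "real n"] of_nat_0_le_iff[of n] by linarith
    also have "\<dots> \<le> K * b / n + K * b / n"
      using Kb n_pos by (intro add_mono divide_right_mono) (auto simp: field_simps)
    also have "\<dots> = 2 * (K * b / n)" by simp
    also have "\<dots> \<le> r * (K * b / n)" using r3 Kb n_pos by (intro mult_right_mono) auto
    finally show ?thesis by (simp add: X_def)
  qed
  define H where "H = (\<lambda>p q t. v p q * t\<^sup>2 / 2)"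
  define G where "G = (\<lambda>p q t. v p q * t)"
  have Hd: "(H p q has_real_derivative G p q t) (at t)" for p q t
    unfolding H_def G_def by (auto intro!: derivative_eq_intros)
  have anti: "G q p (- t) = - G p q t" for p q t unfolding G_def using v_sym[of p q] by simp
  have lower: "(1 - exp (- t)) / b \<le> G p q t" if "p \<in> I" "q \<in> I" "p \<noteq> q" "0 \<le> t" for p q t
  proof -
    have "1 - exp (- t) \<le> t" using exp_ge_add_one_self[of "- t"] by linarith
    then have "(1 - exp (- t)) / b \<le> 1 / b * t" using b_pos by (simp add: divide_right_mono)
    also have "\<dots> \<le> G p q t" unfolding G_def by (intro mult_right_mono v_bounds that)
    finally show ?thesis .
  qed
  have sm: "4 * b * X \<le> real (card I)"
  proof -
    have "4 * b * X * n = 4 * real r * real K * b\<^sup>2" using n_pos by (simp add: X_def power2_eq_square)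
    also have "\<dots> \<le> n * n" using small by (simp add: power2_eq_square)
    finally show ?thesis using n_pos by simp
  qed
  obtain z where z: "z 1 = 0" "\<And>p q. p \<in> I \<Longrightarrow> q \<in> I \<Longrightarrow> \<bar>z p - z q\<bar> \<le> 4 * b * X / real (card I)"
    "\<And>m. m \<in> I \<Longrightarrow> \<pi> m = (\<Sum>j\<in>I. G m j (z m - z j))"
    by (rule edge_potential_critical_point[of I 1 b \<pi> X H G], simp, rule one_in, rule b_pos,
        rule sum0, erule bound, rule Hd, rule anti, erule (3) lower, rule sm, blast)
  have X4: "4 * b * X / real (card I) = 4 * real r * real K * b\<^sup>2 / (real n)\<^sup>2"
    by (simp add: X_def power2_eq_square)
  show ?thesis
  proof (rule exI[of _ z], unfold is_corrector_def, intro conjI ballI)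
    show "z 1 = 0" by fact
    fix p q assume "p \<in> I" "q \<in> I"
    then show "\<bar>z p - z q\<bar> \<le> 4 * real r * real K * b\<^sup>2 / (real n)\<^sup>2" using z(2) X4 by metis
  next
    fix m assume "m \<in> I"
    then show "(\<Sum>j\<in>I. v m j * (z m - z j)) = (if m = i then 1 else 0) - 1 / n - (\<Sum>j\<in>I. v m j * (bump i m - bump i j))"
      using z(3)[of m] by (simp only: \<pi>_def G_def)
  qed
qed

text \<open>The choice depends on the model only, not on the outcome, so pairing it with the scores
  gives a fixed linear statistic.\<close>

definition corrector :: "nat \<Rightarrow> nat \<Rightarrow> real" where
  "corrector i = (SOME z. is_corrector i z)"

text \<open>Symmetry of the Laplacian moves it from \<open>f\<close> to \<open>e\<close>, where the
  likelihood equations replace it by the score minus a Taylor remainder \<rho>. The bump part of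
  \<open>f\<close> yields the main term. The four errors are, in order: corrector against scores,
  comparisons within \<open>R\<close>, corrector against \<rho>, and bump against \<rho>.\<close>

lemma mle_expansion:
  fixes e :: "nat \<Rightarrow> real" and w :: real
  assumes a: "valid a" and st: "stationary a e" and ew: "\<And>i j. i \<in> I \<Longrightarrow> j \<in> I \<Longrightarrow> \<bar>e i - e j\<bar> \<le> w" and w1: "w \<le> 1"
    and i: "i \<in> R" and z: "is_corrector i z"
  shows "\<bar>(e i - (\<Sum>m\<in>I. e m) / n) - score_S a i / A i\<bar>
     \<le> \<bar>\<Sum>m\<in>I. z m * score a m\<bar> + 2 * b * real r * real K / n + 4 * real r * real K * b\<^sup>2 * (K * w\<^sup>2) + 2 * b * K * w\<^sup>2"
proof -
  define f where "f = (\<lambda>m. z m + bump i m)"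
  define \<rho> where "\<rho> = (\<lambda>m. \<Sum>j\<in>I. real (k m j) * (logistic (\<beta> m - \<beta> j + (e m - e j)) - logistic (\<beta> m - \<beta> j) - dlogistic (\<beta> m - \<beta> j) * (e m - e j)))"
  define \<zeta> where "\<zeta> = 4 * real r * real K * b\<^sup>2 / (real n)\<^sup>2"
  have iI: "i \<in> I" using i R_sub by auto
  have w0: "w \<ge> 0" using ew[OF one_in(1) one_in(1)] by simp
  have Vanti: "v j m * (g j - g m) = - (v m j * (g m - g j))" for g :: "nat \<Rightarrow> real" and j m
    using v_sym[of j m] by (simp add: algebra_simps)
  have zeq: "(\<Sum>j\<in>I. v m j * (z m - z j)) = (if m = i then 1 else 0) - 1 / n - (\<Sum>j\<in>I. v m j * (bump i m - bump i j))" if "m \<in> I" for m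
    using z that unfolding is_corrector_def by blast
  have Vf: "(\<Sum>j\<in>I. v m j * (f m - f j)) = (if m = i then 1 else 0) - 1 / n" if "m \<in> I" for m
  proof -
    have "(\<Sum>j\<in>I. v m j * (f m - f j)) = (\<Sum>j\<in>I. v m j * (z m - z j)) + (\<Sum>j\<in>I. v m j * (bump i m - bump i j))"
      unfolding sum.distrib[symmetric] by (intro sum.cong refl) (simp add: f_def algebra_simps)
    then show ?thesis unfolding zeq[OF that] by simp
  qed
  have Ve: "(\<Sum>j\<in>I. v m j * (e m - e j)) = score a m - \<rho> m" if "m \<in> I" for m
  proof -
    have "score a m = (\<Sum>j\<in>I. real (k m j) * (logistic (\<beta> m - \<beta> j + (e m - e j)) - logistic (\<beta> m - \<beta> j)))"
      using st that by (simp add: stationary_def)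
    then show ?thesis unfolding \<rho>_def v_def by (simp add: sum_subtractf[symmetric] algebra_simps)
  qed
  have "e i - (\<Sum>m\<in>I. e m) / n = (\<Sum>m\<in>I. e m * (\<Sum>j\<in>I. v m j * (f m - f j)))"
  proof -
    have "(\<Sum>m\<in>I. e m * (\<Sum>j\<in>I. v m j * (f m - f j))) = (\<Sum>m\<in>I. (if m = i then e m else 0) - e m / n)"
    proof (intro sum.cong refl)
      fix m assume "m \<in> I"
      then show "e m * (\<Sum>j\<in>I. v m j * (f m - f j)) = (if m = i then e m else 0) - e m / n"
        unfolding Vf[OF \<open>m \<in> I\<close>] by (simp add: right_diff_distrib)
    qed
    also have "\<dots> = e i - (\<Sum>m\<in>I. e m) / n" using iI by (simp add: sum_subtractf sum_divide_distrib)
    finally show ?thesis by simp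
  qed
  also have "\<dots> = (\<Sum>(m, j)\<in>bt_pairs n. v m j * (f m - f j) * (e m - e j))"
    by (rule sum_antisym[symmetric]) (rule Vanti)
  also have "\<dots> = (\<Sum>(m, j)\<in>bt_pairs n. v m j * (e m - e j) * (f m - f j))" by (simp add: mult_ac)
  also have "\<dots> = (\<Sum>m\<in>I. f m * (\<Sum>j\<in>I. v m j * (e m - e j)))"
    by (rule sum_antisym) (rule Vanti)
  also have "\<dots> = (\<Sum>m\<in>I. f m * score a m) - (\<Sum>m\<in>I. f m * \<rho> m)"
    unfolding sum_subtractf[symmetric]
  proof (intro sum.cong refl)
    fix m assume "m \<in> I"
    then show "f m * (\<Sum>j\<in>I. v m j * (e m - e j)) = f m * score a m - f m * \<rho> m"
      unfolding Ve[OF \<open>m \<in> I\<close>] by (simp add: right_diff_distrib)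
  qed
  finally have main: "e i - (\<Sum>m\<in>I. e m) / n = (\<Sum>m\<in>I. f m * score a m) - (\<Sum>m\<in>I. f m * \<rho> m)" .
  have fsum: "(\<Sum>m\<in>I. f m * g m) = (\<Sum>m\<in>I. z m * g m) + g i / A i" for g :: "nat \<Rightarrow> real"
  proof -
    have "(\<Sum>m\<in>I. bump i m * g m) = (\<Sum>m\<in>I. if m = i then g i / A i else 0)"
      by (intro sum.cong refl) (simp add: bump_def)
    then show ?thesis using iI by (simp add: f_def distrib_right sum.distrib)
  qed
  note A = inverse_A_bounds[OF i]
  have \<rho>: "\<bar>\<rho> m\<bar> \<le> n * (K * w\<^sup>2)" if m: "m \<in> I" for m
  proof -
    have "\<bar>\<rho> m\<bar> \<le> (\<Sum>j\<in>I. K * w\<^sup>2)" unfolding \<rho>_def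
    proof (rule order_trans[OF sum_abs], rule sum_mono)
      fix j assume j: "j \<in> I"
      have h: "\<bar>e m - e j\<bar> \<le> 1" "(e m - e j)\<^sup>2 \<le> w\<^sup>2"
        using ew[OF m j] w1 w0 by (auto simp: abs_le_square_iff[symmetric])
      show "\<bar>real (k m j) * (logistic (\<beta> m - \<beta> j + (e m - e j)) - logistic (\<beta> m - \<beta> j) - dlogistic (\<beta> m - \<beta> j) * (e m - e j))\<bar> \<le> K * w\<^sup>2"
      proof (cases "m = j")
        case False
        show ?thesis unfolding abs_mult
          using k_bounds[OF m j False] logistic_taylor[OF h(1), of "\<beta> m - \<beta> j"] h(2) by (intro mult_mono) auto
      qed simp
    qed
    then show ?thesis by simp
  qed
  have zb: "\<bar>z m\<bar> \<le> \<zeta>" if "m \<in> I" for m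
  proof -
    have "\<bar>z m - z 1\<bar> \<le> \<zeta>" "z 1 = 0" using z that one_in(1) unfolding is_corrector_def \<zeta>_def by blast+
    then show ?thesis by simp
  qed
  have \<zeta>0: "\<zeta> \<ge> 0" by (simp add: \<zeta>_def)
  have "\<bar>\<Sum>m\<in>I. z m * \<rho> m\<bar> \<le> (\<Sum>m\<in>I. \<zeta> * (n * (K * w\<^sup>2)))"
  proof (rule order_trans[OF sum_abs], rule sum_mono)
    fix m assume "m \<in> I"
    then show "\<bar>z m * \<rho> m\<bar> \<le> \<zeta> * (n * (K * w\<^sup>2))" unfolding abs_mult using zb \<rho> \<zeta>0 by (intro mult_mono) auto
  qed
  also have "\<dots> = 4 * real r * real K * b\<^sup>2 * (K * w\<^sup>2)" using n_pos by (simp add: \<zeta>_def power2_eq_square)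
  finally have z\<rho>: "\<bar>\<Sum>m\<in>I. z m * \<rho> m\<bar> \<le> 4 * real r * real K * b\<^sup>2 * (K * w\<^sup>2)" .
  have \<rho>i: "\<bar>\<rho> i / A i\<bar> \<le> 2 * b * K * w\<^sup>2"
  proof -
    have "\<bar>\<rho> i\<bar> * (1 / A i) \<le> n * (K * w\<^sup>2) * (2 * b / n)" using \<rho>[OF iI] A by (intro mult_mono) auto
    then show ?thesis using A n_pos A_bounds(4)[OF i] by (simp add: mult_ac)
  qed
  have sc: "\<bar>(score a i - score_S a i) / A i\<bar> \<le> 2 * b * real r * real K / n"
  proof -
    have "score a i - score_S a i = (\<Sum>j\<in>R. noise a i j)"
      unfolding score_def score_S_def using sum.subset_diff[OF R_sub, of "noise a i"] by simp
    also have "\<bar>\<dots>\<bar> \<le> (\<Sum>j\<in>R. real K)"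
      using noise_bound[OF a iI] R_sub by (intro order_trans[OF sum_abs] sum_mono) auto
    also have "\<dots> \<le> r * K" by (auto intro!: mult_right_mono)
    finally have "\<bar>score a i - score_S a i\<bar> * (1 / A i) \<le> r * K * (2 * b / n)" using A by (intro mult_mono) auto
    then show ?thesis using A_bounds(4)[OF i] by (simp add: mult_ac)
  qed
  have "(e i - (\<Sum>m\<in>I. e m) / n) - score_S a i / A i
     = (\<Sum>m\<in>I. z m * score a m) + (score a i - score_S a i) / A i - (\<Sum>m\<in>I. z m * \<rho> m) - \<rho> i / A i"
    unfolding main fsum by (simp add: diff_divide_distrib)
  then show ?thesis using sc \<rho>i z\<rho> by linarith
qed

definition quad_stat :: "(nat \<times> nat \<Rightarrow> nat) \<Rightarrow> real" where
  "quad_stat a = weighted_var A R (\<lambda>i. score_S a i / A i)"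

lemma corrector_scale_small:
  fixes l :: real
  assumes l1: "l \<ge> 1" and small: "100 * real r * (real K)\<^sup>2 * (b ^ 5 * l ^ 3 / sqrt n) \<le> 1"
  shows "4 * real r * real K * b\<^sup>2 \<le> (real n)\<^sup>2"
proof -
  define N where "N = sqrt n"
  define t where "t = b ^ 5 * l ^ 3 / N"
  have N1: "N \<ge> 1" using n_pos by (simp add: N_def)
  have t0: "t \<ge> 0" using b1 l1 N1 by (simp add: t_def)
  have "b ^ 2 * l ^ 0 / N ^ 4 \<le> t" unfolding t_def by (rule monomial_le[OF b1 l1 N1]) auto
  then have "4 * (real r * real K) * (b ^ 2 * l ^ 0 / N ^ 4) \<le> 4 * (real r * real K) * t" by (intro mult_left_mono) auto
  also have "\<dots> \<le> 4 * (real r * (real K)\<^sup>2) * t"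
    using t0 K1 by (intro mult_right_mono mult_left_mono) (auto simp: power2_eq_square)
  also have "\<dots> \<le> 100 * (real r * (real K)\<^sup>2) * t" using t0 by (intro mult_right_mono) auto
  also have "\<dots> \<le> 1" using small by (simp add: t_def N_def mult.assoc)
  finally have "4 * (real r * real K) * (b\<^sup>2 / N ^ 4) \<le> 1" by simp
  moreover have "N ^ 4 = (real n)\<^sup>2" by (simp add: N_def power4_eq_xxxx power2_eq_square)
  ultimately show ?thesis using n_pos by (simp add: field_simps)
qed

text \<open>A deterministic statement on the good event described by the last two assumptions. The
  first of them feeds \<open>mle_exists\<close>, which gives an estimator of oscillation
  \<open>4 * K * b * l / sqrt n\<close>; the second controls the linear statistic left over in
  \<open>mle_expansion\<close>.\<close>

lemma lr_stat_approx:
  fixes l t :: real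
  assumes a: "valid a" and l1: "l \<ge> 1"
  defines "t \<equiv> b ^ 5 * l ^ 3 / sqrt n"
  assumes small: "100 * real r * (real K)\<^sup>2 * t \<le> 1"
    and score_b: "\<And>i. i \<in> I \<Longrightarrow> \<bar>score a i\<bar> \<le> K * sqrt n * l"
    and corr_b: "\<And>i. i \<in> R \<Longrightarrow> \<bar>\<Sum>m\<in>I. corrector i m * score a m\<bar> \<le> real K * (4 * real r * real K * b\<^sup>2 / (real n)\<^sup>2) * n * l"
  shows "\<bar>bt_lr_stat n r k a - quad_stat a\<bar> \<le> 6000 * (real r ^ 3 * real K ^ 9 * t)"
proof -
  define N where "N = sqrt n"
  have N2: "N\<^sup>2 = n" by (simp add: N_def)
  have N1: "N \<ge> 1" using n_pos by (simp add: N_def)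
  have R1: "real r \<ge> 1" using r3 by simp
  have t0: "t \<ge> 0" using b1 l1 by (simp add: t_def)
  have tN: "t = b ^ 5 * l ^ 3 / N" by (simp add: t_def N_def)
  have m: "b ^ p * l ^ q / N ^ s \<le> t" if "p \<le> 5" "q \<le> 3" "1 \<le> s" for p q s
    unfolding tN by (rule monomial_le[OF b1 l1 N1 that])
  define w where "w = 4 * real K * b * l / N"
  have w_eq: "w = 4 * K * (b ^ 1 * l ^ 1 / N ^ 1)" by (simp add: w_def)
  have w0: "w \<ge> 0" using b1 l1 N1 by (simp add: w_def)
  have wt: "w \<le> 4 * K * t" unfolding w_eq by (intro mult_left_mono m) auto
  have Ksq: "real K \<le> (real K)\<^sup>2" using K1 by (simp add: power2_eq_square)
  have rKK: "real r * real K \<le> real r * (real K)\<^sup>2" by (intro mult_left_mono Ksq) simp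
  have rK: "real K * t \<le> real r * (real K)\<^sup>2 * t"
    using mult_mono[of 1 "real r" "real K" "(real K)\<^sup>2"] R1 Ksq t0 by (intro mult_right_mono) auto
  have hw: "20 * real r * real K * b * w \<le> 80 * (real r * (real K)\<^sup>2 * t)"
  proof -
    have "20 * real r * real K * b * w = 80 * (real r * (real K)\<^sup>2) * (b ^ 2 * l ^ 1 / N ^ 1)"
      by (simp add: w_def power2_eq_square)
    also have "\<dots> \<le> 80 * (real r * (real K)\<^sup>2) * t" by (intro mult_left_mono m) auto
    finally show ?thesis by simp
  qed
  have small2: "w + 20 * real r * real K * b * w \<le> 1"
  proof -
    have "0 \<le> real r * (real K)\<^sup>2 * t" using t0 by simp
    then show ?thesis using wt rK hw small by linarith
  qed
  have w1: "w \<le> 1" using small2 w0 b1 by (smt (verit) mult_nonneg_nonneg of_nat_0_le_iff)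
  have small1: "b * r * K \<le> 2 * real n"
  proof -
    have "r * K * (b ^ 1 * l ^ 0 / N ^ 2) \<le> r * K * t" by (intro mult_left_mono m) auto
    also have "\<dots> \<le> real r * (real K)\<^sup>2 * t" using rKK t0 by (intro mult_right_mono) auto
    also have "\<dots> \<le> 2" using small by simp
    finally show ?thesis using n_pos by (simp add: N2 field_simps)
  qed
  note small3 = corrector_scale_small[OF l1 small[unfolded t_def]]
  have X: "4 * b * (K * sqrt n * l) \<le> n" "4 * b * (K * sqrt n * l) / n = w"
  proof -
    have nN: "real n = N * N" using N2 by (simp add: power2_eq_square)
    show 1: "4 * b * (K * sqrt n * l) / n = w"
      unfolding N_def[symmetric] nN w_def using N1 by simp
    then have "4 * b * (K * sqrt n * l) / n \<le> 1" using w1 by simp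
    then show "4 * b * (K * sqrt n * l) \<le> n" using n_pos by (simp add: divide_le_eq del: of_nat_0_less_iff)
  qed
  obtain e where e: "e 1 = 0" "\<And>i j. i \<in> I \<Longrightarrow> j \<in> I \<Longrightarrow> \<bar>e i - e j\<bar> \<le> w" "stationary a e"
    using mle_exists[OF a score_b X(1)] unfolding X(2) by blast
  define W where "W = weighted_var A R e"
  have W: "0 \<le> W" "W \<le> r * N\<^sup>2 * K / 4 * w\<^sup>2"
    unfolding W_def N2 by (rule weighted_var_nonneg, rule weighted_var_upper[OF e(2)])
  define mm where "mm = (\<Sum>i\<in>R. A i * e i) / (\<Sum>i\<in>R. A i)"
  have LR: "(1 - w - 20 * real r * real K * b * w) * (1 - b * r * K / (2 * real n)) * W \<le> bt_lr_stat n r k a"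
    "bt_lr_stat n r k a \<le> exp (2 * w) * (W + (real r)\<^sup>2 * K * w\<^sup>2)"
  proof -
    let ?\<delta> = "\<lambda>i. if i \<in> R then mm - e i else 0"
    have 1: "2 * excess e ?\<delta> \<le> exp (2 * w) * (W + (real r)\<^sup>2 * K * w\<^sup>2)"
      unfolding W_def mm_def by (rule excess_null_upper[OF e(2)])
    have 2: "(1 - w - 20 * real r * real K * b * w) * (1 - b * r * K / (2 * real n)) * W \<le> 2 * excess e \<delta>"
      if "\<And>i. i \<in> R \<Longrightarrow> \<delta> i = g - e i" for \<delta> g
      unfolding W_def by (rule excess_null_lower[OF e(2) that small1 small2])
    have d: "?\<delta> i = mm - e i" if "i \<in> R" for i using that by simp
    have d1: "?\<delta> 1 = 0" by simp
    show "(1 - w - 20 * real r * real K * b * w) * (1 - b * r * K / (2 * real n)) * W \<le> bt_lr_stat n r k a"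
      by (rule lr_stat_bounds(1)[OF a e(3) e(1) d d1 1 2])
    show "bt_lr_stat n r k a \<le> exp (2 * w) * (W + (real r)\<^sup>2 * K * w\<^sup>2)"
      by (rule lr_stat_bounds(2)[OF a e(3) e(1) d d1 1 2])
  qed
  \<comment> \<open>The four errors of the expansion are at most 4, 2, 64 and 32 times a common
    monomial \<open>F\<close>. Their sum 102 is doubled because the weighted variances are compared
    through differences of two coordinates.\<close>
  define D where "D = 204 * real r * real K ^ 4 * b ^ 4 * l\<^sup>2 / N\<^sup>2"
  have exp_b: "\<bar>(e i - (\<Sum>m\<in>I. e m) / n) - score_S a i / A i\<bar> \<le> D / 2" if i: "i \<in> R" for i
  proof -
    have "is_corrector i (corrector i)" unfolding corrector_def using corrector_exists[OF i small3] by (rule someI_ex)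
    from mle_expansion[OF a e(3,2) w1 i this] corr_b[OF i]
    have "\<bar>(e i - (\<Sum>m\<in>I. e m) / n) - score_S a i / A i\<bar> \<le> real K * (4 * real r * real K * b\<^sup>2 / (real n)\<^sup>2) * n * l
       + 2 * b * real r * real K / n + 4 * real r * real K * b\<^sup>2 * (K * w\<^sup>2) + 2 * b * K * w\<^sup>2" by linarith
    also have "\<dots> \<le> D / 2"
    proof -
      have w2: "w\<^sup>2 = 16 * K\<^sup>2 * b\<^sup>2 * l\<^sup>2 / N\<^sup>2" by (simp add: w_def power_mult_distrib power_divide)
      define F where "F = real r * real K ^ 4 * (b ^ 4 * l\<^sup>2) / N\<^sup>2"
      have gen: "x * (real r ^ p1 * real K ^ p2 * (b ^ p3 * l ^ p4)) / N\<^sup>2 \<le> x * F" if "x \<ge> 0" "p1 \<le> 1" "p2 \<le> 4" "p3 \<le> 4" "p4 \<le> 2" for x p1 p2 p3 p4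
      proof -
        have "real r ^ p1 * real K ^ p2 * (b ^ p3 * l ^ p4) \<le> real r ^ 1 * real K ^ 4 * (b ^ 4 * l ^ 2)"
          using that R1 K1 b1 l1 by (intro mult_mono power_increasing) auto
        then have "x * (real r ^ p1 * real K ^ p2 * (b ^ p3 * l ^ p4)) / N\<^sup>2 \<le> x * (real r ^ 1 * real K ^ 4 * (b ^ 4 * l ^ 2)) / N\<^sup>2"
          using that by (intro divide_right_mono mult_left_mono) auto
        then show ?thesis by (simp add: F_def)
      qed
      have "real K * (4 * real r * real K * b\<^sup>2 / (real n)\<^sup>2) * n * l = 4 * (real r ^ 1 * real K ^ 2 * (b ^ 2 * l ^ 1)) / N\<^sup>2"
        unfolding N2 using n_pos by (simp add: power2_eq_square)
      also have "\<dots> \<le> 4 * F" by (rule gen) auto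
      finally have f1: "real K * (4 * real r * real K * b\<^sup>2 / (real n)\<^sup>2) * n * l \<le> 4 * F" .
      have "2 * b * real r * real K / n = 2 * (real r ^ 1 * real K ^ 1 * (b ^ 1 * l ^ 0)) / N\<^sup>2" unfolding N2 by simp
      also have "\<dots> \<le> 2 * F" by (rule gen) auto
      finally have f2: "2 * b * real r * real K / n \<le> 2 * F" .
      have "4 * real r * real K * b\<^sup>2 * (K * w\<^sup>2) = 64 * (real r ^ 1 * real K ^ 4 * (b ^ 4 * l ^ 2)) / N\<^sup>2"
        unfolding w2 by (simp add: power2_eq_square eval_nat_numeral)
      also have "\<dots> \<le> 64 * F" by (rule gen) auto
      finally have f3: "4 * real r * real K * b\<^sup>2 * (K * w\<^sup>2) \<le> 64 * F" .
      have "2 * b * K * w\<^sup>2 = 32 * (real r ^ 0 * real K ^ 3 * (b ^ 3 * l ^ 2)) / N\<^sup>2"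
        unfolding w2 by (simp add: power2_eq_square eval_nat_numeral)
      also have "\<dots> \<le> 32 * F" by (rule gen) auto
      finally have f4: "2 * b * K * w\<^sup>2 \<le> 32 * F" .
      have "D / 2 = 102 * F" by (simp add: D_def F_def)
      then show ?thesis using f1 f2 f3 f4 by linarith
    qed
    finally show ?thesis .
  qed
  have "\<bar>W - quad_stat a\<bar> \<le> (\<Sum>i\<in>R. A i) * (D * (2 * w + D)) / 2"
    unfolding W_def quad_stat_def
  proof (rule weighted_var_perturb[OF _ sum_A(1)])
    fix i assume i: "i \<in> R" then show "0 \<le> A i" using A_bounds(4) by (simp add: less_imp_le)
  next
    fix i j assume ij: "i \<in> R" "j \<in> R"
    then show "\<bar>e i - e j\<bar> \<le> w" using R_sub by (intro e(2)) auto
    show "\<bar>e i - e j - (score_S a i / A i - score_S a j / A j)\<bar> \<le> D"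
      using exp_b[OF ij(1)] exp_b[OF ij(2)] by linarith
  qed
  also have "\<dots> \<le> r * N\<^sup>2 * K / 4 * (D * (2 * w + D)) / 2"
    unfolding N2 using w0 b1 l1 by (intro divide_right_mono mult_right_mono sum_A(2)) (auto simp: D_def)
  finally have WQ: "\<bar>W - quad_stat a\<bar> \<le> r * N\<^sup>2 * K / 4 * (D * (2 * w + D)) / 2" .
  show ?thesis
    by (rule lr_error_arith[OF b1 l1 N1 R1 K1, folded tN w_def D_def, OF small W LR(2) _ WQ])
       (use LR(1) in \<open>simp add: N2\<close>)
qed

end

section \<open>Concentration of linear statistics\<close>

lemma expectation_Pi_pmf_component:
  fixes f :: "'a \<Rightarrow> real"
  assumes "finite P" "p \<in> P"
  shows "measure_pmf.expectation (Pi_pmf P d q) (\<lambda>a. f (a p)) = measure_pmf.expectation (q p) f"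
  using arg_cong[OF Pi_pmf_component[OF assms(1), of p d q], of "\<lambda>M. measure_pmf.expectation M f"] assms(2)
  by simp

lemma expectation_binomial_pmf_Suc:
  fixes f :: "nat \<Rightarrow> real"
  assumes p: "p \<in> {0..1}"
  shows "measure_pmf.expectation (binomial_pmf (Suc m) p) f
    = p * measure_pmf.expectation (binomial_pmf m p) (\<lambda>x. f (x + 1)) + (1 - p) * measure_pmf.expectation (binomial_pmf m p) f"
proof -
  have "binomial_pmf (Suc m) p = bernoulli_pmf p \<bind> (\<lambda>b. map_pmf (\<lambda>x. (if b then 1 else 0) + x) (binomial_pmf m p))"
    unfolding binomial_pmf_Suc[OF p] map_pmf_def by simp
  then have "measure_pmf.expectation (binomial_pmf (Suc m) p) f
     = (\<Sum>b\<in>UNIV. pmf (bernoulli_pmf p) b *\<^sub>R measure_pmf.expectation (map_pmf (\<lambda>x. (if b then 1 else 0) + x) (binomial_pmf m p)) f)"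
    by (simp only:) (rule pmf_expectation_bind, use p in \<open>auto intro!: finite_imageI\<close>)
  then show ?thesis using p by (simp add: UNIV_bool add.commute)
qed

lemma binomial_pmf_moments:
  assumes p: "p \<in> {0..1}"
  shows "measure_pmf.expectation (binomial_pmf m p) real = m * p"
    and "measure_pmf.expectation (binomial_pmf m p) (\<lambda>x. (real x)\<^sup>2) = m * p * (1 - p) + (m * p)\<^sup>2"
proof -
  have int: "integrable (binomial_pmf m p) f" for f :: "nat \<Rightarrow> real" and m using p by simp
  show E1: "measure_pmf.expectation (binomial_pmf m p) real = m * p" for m
  proof (induction m)
    case 0
    then show ?case using p by (simp add: binomial_pmf_0)
  next
    case (Suc m)
    then show ?case
      by (simp add: expectation_binomial_pmf_Suc[OF p] int algebra_simps)
  qed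
  show "measure_pmf.expectation (binomial_pmf m p) (\<lambda>x. (real x)\<^sup>2) = m * p * (1 - p) + (m * p)\<^sup>2"
  proof (induction m)
    case 0
    then show ?case using p by (simp add: binomial_pmf_0)
  next
    case (Suc m)
    have "measure_pmf.expectation (binomial_pmf m p) (\<lambda>x. (real (x + 1))\<^sup>2)
      = measure_pmf.expectation (binomial_pmf m p) (\<lambda>x. (real x)\<^sup>2 + 2 * real x + 1)"
      by (simp add: power2_eq_square algebra_simps)
    also have "\<dots> = measure_pmf.expectation (binomial_pmf m p) (\<lambda>x. (real x)\<^sup>2) + 2 * measure_pmf.expectation (binomial_pmf m p) real + 1"
      by (simp add: int)
    finally have step: "measure_pmf.expectation (binomial_pmf m p) (\<lambda>x. (real (x + 1))\<^sup>2)
      = m * p * (1 - p) + (m * p)\<^sup>2 + 2 * (m * p) + 1" unfolding Suc.IH E1 .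
    show ?case
      unfolding expectation_binomial_pmf_Suc[OF p] Suc.IH step by (simp add: algebra_simps power2_eq_square)
  qed
qed

lemma binomial_pmf_centered:
  assumes p: "p \<in> {0..1}"
  shows "measure_pmf.expectation (binomial_pmf m p) (\<lambda>x. real x - m * p) = 0"
    and "measure_pmf.expectation (binomial_pmf m p) (\<lambda>x. (real x - m * p)\<^sup>2) = m * (p * (1 - p))"
proof -
  have int: "integrable (binomial_pmf m p) f" for f :: "nat \<Rightarrow> real" using p by simp
  show "measure_pmf.expectation (binomial_pmf m p) (\<lambda>x. real x - m * p) = 0"
    by (simp add: int binomial_pmf_moments[OF p])
  have "measure_pmf.expectation (binomial_pmf m p) (\<lambda>x. (real x - m * p)\<^sup>2)
     = measure_pmf.expectation (binomial_pmf m p) (\<lambda>x. (real x)\<^sup>2 - 2 * (m * p) * real x + (m * p)\<^sup>2)"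
    by (simp add: power2_diff algebra_simps)
  also have "\<dots> = measure_pmf.expectation (binomial_pmf m p) (\<lambda>x. (real x)\<^sup>2) - 2 * (m * p) * measure_pmf.expectation (binomial_pmf m p) real + (m * p)\<^sup>2"
    by (simp add: int)
  also have "\<dots> = m * (p * (1 - p))"
    unfolding binomial_pmf_moments[OF p] by (simp add: algebra_simps power2_eq_square)
  finally show "measure_pmf.expectation (binomial_pmf m p) (\<lambda>x. (real x - m * p)\<^sup>2) = m * (p * (1 - p))" .
qed

section \<open>Hoeffding bounds under the Bradley-Terry law\<close>

context bradley_terry
begin

abbreviation data where "data \<equiv> bt_data n k \<beta>"

definition pair_pmf_of :: "nat \<times> nat \<Rightarrow> nat pmf" where
  "pair_pmf_of = (\<lambda>(i, j). binomial_pmf (k i j) (logistic (\<beta> i - \<beta> j)))"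

definition pair_noise :: "nat \<times> nat \<Rightarrow> nat \<Rightarrow> real" where
  "pair_noise = (\<lambda>(i, j) x. real x - k i j * logistic (\<beta> i - \<beta> j))"

lemma finite_pairs: "finite (bt_pairs n)"
  by (rule finite_subset[of _ "{1..n} \<times> {1..n}"]) (auto simp: bt_pairs_def)

lemma data_eq: "data = Pi_pmf (bt_pairs n) 0 pair_pmf_of"
  unfolding bt_data_def pair_pmf_of_def bt_prob_def logistic_def ..

lemma logistic_01: "logistic x \<in> {0..1}"
  using logistic_bounds[of x] by auto

lemma set_pair_pmf_of: "set_pmf (pair_pmf_of (i, j)) = {..k i j}"
  using logistic_bounds[of "\<beta> i - \<beta> j"] by (simp add: pair_pmf_of_def)

lemma finite_set_pair_pmf_of: "finite (set_pmf (pair_pmf_of p))"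
  using set_pair_pmf_of by (cases p) simp

lemma finite_set_data: "finite (set_pmf data)"
  unfolding data_eq
  by (rule finite_subset[OF set_Pi_pmf_subset'[OF finite_pairs]])
     (intro finite_PiE_dflt finite_pairs, simp add: finite_set_pair_pmf_of)

lemma valid_data: "a \<in> set_pmf data \<Longrightarrow> valid a"
  using set_Pi_pmf_subset'[OF finite_pairs, of 0 pair_pmf_of] set_pair_pmf_of
  unfolding data_eq valid_def PiE_dflt_def by fastforce

lemma pair_noise_eq:
  assumes "(i, j) \<in> bt_pairs n"
  shows "pair_noise (i, j) (a (i, j)) = noise a i j"
  using assms by (auto simp: pair_noise_def noise_def bt_win_def bt_pairs_def)

text \<open>After summation by parts the statistic is linear in the independent counts, with
  coefficient \<open>z i - z j\<close> at the pair (i, j). Working with an upper bound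
  \<open>u\<close> keeps the total squared width positive even if increments of \<open>z\<close>
  vanish, and suits the corrector, known only through such a bound.\<close>

lemma hoeffding_linear:
  fixes z :: "nat \<Rightarrow> real" and u :: "nat \<times> nat \<Rightarrow> real"
  assumes u: "\<And>i j. (i, j) \<in> bt_pairs n \<Longrightarrow> \<bar>z i - z j\<bar> \<le> u (i, j)"
    and U: "(\<Sum>p\<in>bt_pairs n. (u p)\<^sup>2) > 0" "(\<Sum>p\<in>bt_pairs n. (u p)\<^sup>2) \<le> U" and \<epsilon>: "\<epsilon> \<ge> 0"
  shows "measure_pmf.prob data {a. valid a \<and> \<bar>\<Sum>m\<in>I. z m * score a m\<bar> \<ge> \<epsilon>} \<le> 2 * exp (- 2 * \<epsilon>\<^sup>2 / ((real K)\<^sup>2 * U))"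
proof -
  define c where "c = (\<lambda>(i, j). z i - z j)"
  \<comment> \<open>\<open>X p\<close> is \<open>c p\<close> times a count between 0 and
    \<open>K\<close>, so the sign of \<open>c p\<close> decides on which side of 0 its interval of
    length \<open>K * u p\<close> lies.\<close>
  define lo where "lo = (\<lambda>p. if c p \<ge> 0 then 0 else - (K * u p))"
  define hi where "hi = (\<lambda>p. lo p + K * u p)"
  define X where "X = (\<lambda>p (a :: nat \<times> nat \<Rightarrow> nat). real (a p) * c p)"
  define \<mu> where "\<mu> = (\<Sum>p\<in>bt_pairs n. measure_pmf.expectation data (X p))"
  have cu: "\<bar>c p\<bar> \<le> u p" if "p \<in> bt_pairs n" for p using u that by (cases p) (auto simp: c_def)
  interpret Hoeffding_ineq "measure_pmf data" "bt_pairs n" X lo hi \<mu>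
  proof (unfold_locales)
    show "finite (bt_pairs n)" by (rule finite_pairs)
    show "prob_space.indep_vars (measure_pmf data) (\<lambda>_. borel) X (bt_pairs n)"
      unfolding X_def data_eq
      by (rule prob_space.indep_vars_compose2[OF _ indep_vars_Pi_pmf[OF finite_pairs], where Y = "\<lambda>p x. real x * c p"])
         (auto simp: measure_pmf.prob_space_axioms)
    show "AE a in measure_pmf data. X p a \<in> {lo p..hi p}" if p: "p \<in> bt_pairs n" for p
      unfolding AE_measure_pmf_iff
    proof
      fix a assume "a \<in> set_pmf data"
      then have v: "valid a" by (rule valid_data)
      obtain i j where ij: "p = (i, j)" by (cases p)
      have "a p \<le> k i j" using v p ij by (auto simp: valid_def)
      moreover have "real (k i j) \<le> K" using k_bounds[of i j] p ij by (auto simp: bt_pairs_def)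
      ultimately have aK: "real (a p) \<le> K" by linarith
      have "real (a p) * \<bar>c p\<bar> \<le> K * u p" using aK cu[OF p] by (intro mult_mono) auto
      then show "X p a \<in> {lo p..hi p}" by (auto simp: X_def lo_def hi_def abs_if mult_le_0_iff split: if_splits)
    qed
  qed (simp add: \<mu>_def)
  have width: "(\<Sum>p\<in>bt_pairs n. (hi p - lo p)\<^sup>2) = (real K)\<^sup>2 * (\<Sum>p\<in>bt_pairs n. (u p)\<^sup>2)"
    by (simp add: hi_def power_mult_distrib sum_distrib_left)
  have K0: "(real K)\<^sup>2 > 0" using K1 by simp
  have "{a. valid a \<and> \<bar>\<Sum>m\<in>I. z m * score a m\<bar> \<ge> \<epsilon>} \<subseteq> {a \<in> space (measure_pmf data). \<bar>(\<Sum>p\<in>bt_pairs n. X p a) - \<mu>\<bar> \<ge> \<epsilon>}"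
  proof safe
    fix a assume a: "valid a" "\<epsilon> \<le> \<bar>\<Sum>m\<in>I. z m * score a m\<bar>"
    have "(\<Sum>m\<in>I. z m * score a m) = (\<Sum>(i, j)\<in>bt_pairs n. noise a i j * (z i - z j))"
      unfolding score_def by (rule sum_antisym[symmetric]) (rule noise_antisym[OF a(1)])
    also have "\<dots> = (\<Sum>p\<in>bt_pairs n. X p a - measure_pmf.expectation data (X p))"
    proof (intro sum.cong refl, clarify)
      fix i j assume p: "(i, j) \<in> bt_pairs n"
      have "measure_pmf.expectation data (X (i, j)) = measure_pmf.expectation (pair_pmf_of (i, j)) (\<lambda>x. real x * c (i, j))"
        unfolding data_eq X_def by (rule expectation_Pi_pmf_component[OF finite_pairs p])
      also have "\<dots> = k i j * logistic (\<beta> i - \<beta> j) * c (i, j)"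
        using binomial_pmf_moments(1)[OF logistic_01, of "k i j" "\<beta> i - \<beta> j"] by (simp add: pair_pmf_of_def)
      finally show "noise a i j * (z i - z j) = X (i, j) a - measure_pmf.expectation data (X (i, j))"
        unfolding pair_noise_eq[OF p, symmetric] by (simp add: pair_noise_def X_def c_def algebra_simps)
    qed
    also have "\<dots> = (\<Sum>p\<in>bt_pairs n. X p a) - \<mu>" by (simp add: sum_subtractf \<mu>_def)
    finally show "\<epsilon> \<le> \<bar>(\<Sum>p\<in>bt_pairs n. X p a) - \<mu>\<bar>" using a(2) by simp
  qed simp
  then have "measure_pmf.prob data {a. valid a \<and> \<bar>\<Sum>m\<in>I. z m * score a m\<bar> \<ge> \<epsilon>}
      \<le> measure_pmf.prob data {a \<in> space (measure_pmf data). \<bar>(\<Sum>p\<in>bt_pairs n. X p a) - \<mu>\<bar> \<ge> \<epsilon>}"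
    by (rule measure_pmf.finite_measure_mono) simp
  also have "\<dots> \<le> 2 * exp (- 2 * \<epsilon>\<^sup>2 / (\<Sum>p\<in>bt_pairs n. (hi p - lo p)\<^sup>2))"
    by (rule Hoeffding_ineq_abs_ge[OF \<epsilon>]) (use K0 U(1) in \<open>simp add: width\<close>)
  also have "\<dots> \<le> 2 * exp (- 2 * \<epsilon>\<^sup>2 / ((real K)\<^sup>2 * U))"
  proof -
    have "2 * \<epsilon>\<^sup>2 / ((real K)\<^sup>2 * U) \<le> 2 * \<epsilon>\<^sup>2 / (\<Sum>p\<in>bt_pairs n. (hi p - lo p)\<^sup>2)"
      unfolding width using K0 U by (intro divide_left_mono mult_left_mono mult_pos_pos) auto
    then show ?thesis by simp
  qed
  finally show ?thesis .
qed

lemma prob_score_large: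
  assumes i: "i \<in> I" and l: "l \<ge> 0"
  shows "measure_pmf.prob data {a. valid a \<and> \<bar>score a i\<bar> \<ge> K * sqrt n * l} \<le> 2 * exp (- 2 * l\<^sup>2)"
proof -
  define z where "z = (\<lambda>m. if m = i then 1 else 0 :: real)"
  define u where "u = (\<lambda>p. \<bar>z (fst p) - z (snd p)\<bar>)"
  have "(\<Sum>p\<in>bt_pairs n. (u p)\<^sup>2) = (\<Sum>(p, q)\<in>bt_pairs n. (z p - z q)\<^sup>2)"
    by (simp add: u_def case_prod_unfold)
  also have "\<dots> = (\<Sum>p\<in>I. \<Sum>q\<in>I. (z p - z q)\<^sup>2) / 2"
    by (rule sum_bt_pairs_symmetric) (auto simp: power2_commute)
  also have "(\<Sum>p\<in>I. \<Sum>q\<in>I. (z p - z q)\<^sup>2) = (\<Sum>p\<in>I. \<Sum>q\<in>I. z p + z q - 2 * (z p * z q))"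
    by (intro sum.cong refl) (auto simp: z_def)
  also have "\<dots> = 2 * n * (\<Sum>p\<in>I. z p) - 2 * ((\<Sum>p\<in>I. z p) * (\<Sum>p\<in>I. z p))"
    by (simp add: sum.distrib sum_subtractf sum_distrib_left[symmetric] sum_distrib_right[symmetric])
  also have "(\<Sum>p\<in>I. z p) = 1" using i by (simp add: z_def)
  finally have su: "(\<Sum>p\<in>bt_pairs n. (u p)\<^sup>2) = real n - 1" by simp
  have "(\<Sum>m\<in>I. z m * score a m) = score a i" for a
  proof -
    have "(\<Sum>m\<in>I. z m * score a m) = (\<Sum>m\<in>I. if m = i then score a i else 0)"
      by (intro sum.cong refl) (simp add: z_def)
    then show ?thesis using i by simp
  qed
  moreover have "measure_pmf.prob data {a. valid a \<and> \<bar>\<Sum>m\<in>I. z m * score a m\<bar> \<ge> K * sqrt n * l}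
    \<le> 2 * exp (- 2 * (K * sqrt n * l)\<^sup>2 / ((real K)\<^sup>2 * n))"
    by (rule hoeffding_linear[where u = u]) (use su n2r r3 l in \<open>auto simp: u_def\<close>)
  moreover have "- 2 * (K * sqrt n * l)\<^sup>2 / ((real K)\<^sup>2 * n) = - 2 * l\<^sup>2"
    using K1 n_pos by (simp add: power_mult_distrib)
  ultimately show ?thesis by (simp only:)
qed

lemma prob_corrector_large:
  assumes i: "i \<in> R" and l: "l \<ge> 0" and small: "4 * real r * real K * b\<^sup>2 \<le> (real n)\<^sup>2"
  shows "measure_pmf.prob data {a. valid a \<and> \<bar>\<Sum>m\<in>I. corrector i m * score a m\<bar> \<ge> real K * (4 * real r * real K * b\<^sup>2 / (real n)\<^sup>2) * n * l}
    \<le> 2 * exp (- 2 * l\<^sup>2)"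
proof -
  define \<zeta> where "\<zeta> = 4 * real r * real K * b\<^sup>2 / (real n)\<^sup>2"
  have \<zeta>: "\<zeta> > 0" using r3 K1 b_pos n_pos by (simp add: \<zeta>_def)
  have cor: "is_corrector i (corrector i)" unfolding corrector_def using corrector_exists[OF i small] by (rule someI_ex)
  define u where "u = (\<lambda>p :: nat \<times> nat. \<zeta>)"
  have card: "real (card (bt_pairs n)) \<le> (real n)\<^sup>2" "card (bt_pairs n) > 0"
  proof -
    have "card (bt_pairs n) \<le> card ({1..n} \<times> {1..n})" by (rule card_mono) (auto simp: bt_pairs_def)
    then have "card (bt_pairs n) \<le> n * n" by simp
    then have "real (card (bt_pairs n)) \<le> real (n * n)" by (rule of_nat_mono)
    then show "real (card (bt_pairs n)) \<le> (real n)\<^sup>2" by (simp add: power2_eq_square)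
    have "(1, 2) \<in> bt_pairs n" using n2r r3 by (simp add: bt_pairs_def)
    then show "card (bt_pairs n) > 0" using finite_pairs card_gt_0_iff by blast
  qed
  have "measure_pmf.prob data {a. valid a \<and> \<bar>\<Sum>m\<in>I. corrector i m * score a m\<bar> \<ge> K * \<zeta> * n * l}
    \<le> 2 * exp (- 2 * (K * \<zeta> * n * l)\<^sup>2 / ((real K)\<^sup>2 * ((real n)\<^sup>2 * \<zeta>\<^sup>2)))"
  proof (rule hoeffding_linear[where u = u])
    fix p q assume "(p, q) \<in> bt_pairs n"
    then show "\<bar>corrector i p - corrector i q\<bar> \<le> u (p, q)"
      using cor unfolding is_corrector_def u_def \<zeta>_def by (auto simp: bt_pairs_def)
  qed (use card \<zeta> l in \<open>auto simp: u_def intro!: mult_right_mono\<close>)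
  moreover have "- 2 * (K * \<zeta> * n * l)\<^sup>2 / ((real K)\<^sup>2 * ((real n)\<^sup>2 * \<zeta>\<^sup>2)) = - 2 * l\<^sup>2"
    using K1 n_pos \<zeta> by (simp add: power_mult_distrib)
  ultimately show ?thesis unfolding \<zeta>_def[symmetric] by (simp only:)
qed

text \<open>This covers every valid outcome, including those without a maximum likelihood estimator:
  the log-likelihood is at most 0, so both suprema are finite. It bounds the Laplace integrand by 1
  on the bad event.\<close>

lemma lr_stat_nonneg:
  assumes a: "valid a"
  shows "bt_lr_stat n r k a \<ge> 0"
proof -
  have le0: "bt_loglik n k a \<gamma> \<le> 0" for \<gamma>
    unfolding loglik_eq[OF a]
  proof (intro sum_nonpos, clarify)
    fix i j assume "(i, j) \<in> bt_pairs n"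
    then have ij: "i \<in> I" "j \<in> I" "i \<noteq> j" by (auto simp: bt_pairs_def)
    define t where "t = \<gamma> i - \<gamma> j"
    define x where "x = real (bt_win k a i j)"
    have x: "0 \<le> x" "x \<le> k i j" using win_complement[OF a ij] by (auto simp: x_def)
    have "ln 1 \<le> softplus t" unfolding softplus_def by (rule ln_mono) auto
    then have s0: "softplus t \<ge> 0" by simp
    have "ln (exp t) \<le> softplus t" unfolding softplus_def by (rule ln_mono) auto
    then have "t \<le> softplus t" by simp
    then have "x * t \<le> x * softplus t" using x by (intro mult_left_mono) auto
    also have "\<dots> \<le> k i j * softplus t" using x s0 by (intro mult_right_mono) auto
    finally show "real (bt_win k a i j) * (\<gamma> i - \<gamma> j) - real (k i j) * softplus (\<gamma> i - \<gamma> j) \<le> 0"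
      by (simp add: x_def t_def)
  qed
  have "(SUP \<gamma>\<in>bt_null_space r. bt_loglik n k a \<gamma>) \<le> (SUP \<gamma>\<in>bt_param_space. bt_loglik n k a \<gamma>)"
  proof (rule cSUP_subset_mono)
    show "bt_null_space r \<noteq> {}" unfolding bt_null_space_def by (auto intro: exI[of _ "\<lambda>_. 0"])
    show "bdd_above (bt_loglik n k a ` bt_param_space)" using le0 by (intro bdd_aboveI2)
  qed (auto simp: bt_null_space_def bt_param_space_def)
  then show ?thesis by (simp add: bt_lr_stat_def)
qed

end

section \<open>Laplace transform of the likelihood ratio statistic\<close>

lemma heat_kernel_cong:
  assumes "\<And>i. i \<in> R \<Longrightarrow> x i = y i" "\<And>i. i \<in> R \<Longrightarrow> S i = T i"
  shows "heat_kernel l A R S x = heat_kernel l A R T y"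
  unfolding heat_kernel_def Let_def using assms by (simp cong: sum.cong prod.cong)

lemma heat_kernel_start:
  assumes "\<And>i. i \<in> R \<Longrightarrow> A i > 0" "(\<Sum>i\<in>R. A i) > 0"
  shows "heat_kernel l A R (\<lambda>_. 0) x = exp (- l * weighted_var A R (\<lambda>i. x i / A i))"
proof -
  have 1: "(\<Prod>j\<in>R. A j / A j) = 1" using assms(1) by (intro prod.neutral) force
  have 2: "(\<Sum>j\<in>R. (A j)\<^sup>2 / A j) = (\<Sum>j\<in>R. A j)" using assms(1) by (intro sum.cong refl) (force simp: power2_eq_square)
  have 3: "(\<Sum>j\<in>R. A j * x j / A j) = (\<Sum>j\<in>R. A j * (x j / A j))" by simp
  have 4: "(\<Sum>j\<in>R. (x j)\<^sup>2 / A j) = (\<Sum>j\<in>R. A j * (x j / A j)\<^sup>2)"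
    using assms(1) by (intro sum.cong refl) (force simp: power2_eq_square)
  show ?thesis unfolding heat_kernel_def Let_def weighted_var_def using assms(2)
    by (simp only: mult_zero_right add_0_right 1 2 3 4) simp
qed

text \<open>With Gaussian variances equal to the weights, every \<open>D j\<close> is
  \<open>(1 + 2 * l) * A j\<close>. The product contributes \<open>card R\<close> inverse factors
  \<open>1 + 2 * l\<close> under the root and the normalisation by the mean returns one, which
  leaves \<open>card R - 1\<close> degrees of freedom.\<close>

lemma heat_kernel_end:
  assumes fin: "finite R" and A: "\<And>i. i \<in> R \<Longrightarrow> A i > 0" and S: "(\<Sum>i\<in>R. A i) > 0" and l: "l > 0" and R: "card R \<ge> 1"
  shows "heat_kernel l A R A (\<lambda>_. 0) = (1 + 2 * l) powr (- real (card R - 1) / 2)"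
proof -
  define g where "g = 1 + 2 * l"
  have g: "g > 0" using l by (simp add: g_def)
  have D: "A j + 2 * l * A j = g * A j" for j by (simp add: g_def algebra_simps)
  have 1: "(\<Prod>j\<in>R. A j / (g * A j)) = (1 / g) ^ card R"
  proof -
    have "(\<Prod>j\<in>R. A j / (g * A j)) = (\<Prod>j\<in>R. 1 / g)" using A by (intro prod.cong refl) force
    then show ?thesis by simp
  qed
  have 2: "(\<Sum>j\<in>R. (A j)\<^sup>2 / (g * A j)) = (\<Sum>j\<in>R. A j) / g"
    unfolding sum_divide_distrib using A by (intro sum.cong refl) (force simp: power2_eq_square)
  have "heat_kernel l A R A (\<lambda>_. 0) = sqrt ((1 / g) ^ card R * (\<Sum>j\<in>R. A j) / ((\<Sum>j\<in>R. A j) / g))"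
    unfolding heat_kernel_def Let_def D 1 2 by simp
  also have "(1 / g) ^ card R * (\<Sum>j\<in>R. A j) / ((\<Sum>j\<in>R. A j) / g) = (1 / g) ^ card R * g" using S g by simp
  also have "\<dots> = 1 / g ^ (card R - 1)"
  proof -
    obtain m where "card R = Suc m" using R by (cases "card R") auto
    then show ?thesis using g by (simp add: power_one_over)
  qed
  also have "\<dots> = g powr (- real (card R - 1))" using g by (simp add: powr_minus powr_realpow inverse_eq_divide)
  also have "sqrt \<dots> = (g powr (- real (card R - 1))) powr (1 / 2)" using g by (simp add: powr_half_sqrt)
  also have "\<dots> = g powr (- real (card R - 1) / 2)" by (simp add: powr_powr)
  finally show ?thesis by (simp add: g_def)
qed

section \<open>Independent comparisons between \<open>R\<close> and \<open>S\<close>\<close>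

context bradley_terry
begin

definition cross_pairs :: "(nat \<times> nat) set" where
  "cross_pairs = {p \<in> bt_pairs n. (fst p \<in> R) \<noteq> (snd p \<in> R)}"

definition home :: "nat \<times> nat \<Rightarrow> nat" where
  "home p = (if fst p \<in> R then fst p else snd p)"

text \<open>The sign makes each comparison count from the side of its item in \<open>R\<close>.
  Every cross pair has exactly one such item, so the pairs split into disjoint blocks indexed by
  \<open>R\<close>.\<close>

definition home_noise :: "nat \<times> nat \<Rightarrow> nat \<Rightarrow> real" where
  "home_noise p x = (if fst p \<in> R then pair_noise p x else - pair_noise p x)"

lemma sum_cross_pairs:
  fixes F :: "nat \<times> nat \<Rightarrow> real"
  assumes i: "i \<in> R"
  shows "(\<Sum>p\<in>{p \<in> cross_pairs. home p = i}. F p) = (\<Sum>j\<in>S. F (if i < j then (i, j) else (j, i)))"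
  by (rule sum.reindex_bij_witness[where i = "\<lambda>j. if i < j then (i, j) else (j, i)"
        and j = "\<lambda>p. if fst p \<in> R then snd p else fst p"])
     (use i n2r in \<open>auto simp: cross_pairs_def home_def bt_pairs_def split: if_splits\<close>)

lemma score_S_cross:
  assumes "valid a" and i: "i \<in> R"
  shows "(\<Sum>p\<in>{p \<in> cross_pairs. home p = i}. home_noise p (a p)) = score_S a i"
  unfolding sum_cross_pairs[OF i] score_S_def
proof (intro sum.cong refl)
  fix j assume j: "j \<in> S"
  have iI: "i \<in> I" "j \<in> I" using i j R_sub by auto
  have ij: "i \<noteq> j" using i j by auto
  show "home_noise (if i < j then (i, j) else (j, i)) (a (if i < j then (i, j) else (j, i))) = noise a i j"
  proof (cases "i < j")
    case True
    then have "(i, j) \<in> bt_pairs n" using iI by (auto simp: bt_pairs_def)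
    from pair_noise_eq[OF this, of a] show ?thesis using True i by (simp add: home_noise_def)
  next
    case False
    then have "(j, i) \<in> bt_pairs n" using iI ij by (auto simp: bt_pairs_def)
    from pair_noise_eq[OF this, of a] show ?thesis
      using False j noise_antisym[OF assms(1) iI] by (auto simp: home_noise_def)
  qed
qed

text \<open>The information identity: the variance of the centred wins of \<open>i\<close> against
  \<open>S\<close> equals its weight \<open>A i\<close> in the quadratic form. This is why the
  replacement ends at the times \<open>T = A\<close> and the limit is a chi-square law without
  scaling.\<close>

lemma var_cross:
  assumes i: "i \<in> R"
  shows "(\<Sum>p\<in>{p \<in> cross_pairs. home p = i}. v (fst p) (snd p)) = A i"
  unfolding sum_cross_pairs[OF i] A_def by (intro sum.cong refl) (auto simp: v_sym)

lemma pair_noise_moments: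
  "measure_pmf.expectation (pair_pmf_of p) (pair_noise p) = 0"
  "measure_pmf.expectation (pair_pmf_of p) (\<lambda>x. (pair_noise p x)\<^sup>2) = v (fst p) (snd p)"
  using binomial_pmf_centered[OF logistic_01, of "k (fst p) (snd p)" "\<beta> (fst p) - \<beta> (snd p)"]
  by (simp_all add: pair_pmf_of_def pair_noise_def v_def dlogistic_eq case_prod_unfold)

lemma quad_stat_laplace:
  fixes lam :: real
  assumes lam: "lam > 0"
  defines "c \<equiv> sqrt (lam / (real n / (2 * b)))"
  shows "\<bar>measure_pmf.expectation data (\<lambda>a. exp (- lam * quad_stat a)) - (1 + 2 * lam) powr (- real (r - 2) / 2)\<bar>
     \<le> (4 * c ^ 3 * K + 12 * c ^ 4 * (real K)\<^sup>2) * (real r * real n * K / 4)"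
proof -
  have finc: "finite cross_pairs" unfolding cross_pairs_def using finite_pairs by simp
  have sub: "cross_pairs \<subseteq> bt_pairs n" by (auto simp: cross_pairs_def)
  have homeR: "home p \<in> R" if "p \<in> cross_pairs" for p using that by (auto simp: cross_pairs_def home_def)
  have hn: "home_noise p = pair_noise p \<or> home_noise p = (\<lambda>x. - pair_noise p x)" for p
    by (auto simp: home_noise_def fun_eq_iff)
  have mean: "measure_pmf.expectation (pair_pmf_of p) (home_noise p) = 0" for p
    using pair_noise_moments(1)[of p] hn[of p] by auto
  have var: "measure_pmf.expectation (pair_pmf_of p) (\<lambda>x. (home_noise p x)\<^sup>2) = v (fst p) (snd p)" for p
    using pair_noise_moments(2)[of p] hn[of p] by auto
  have bd: "\<bar>home_noise p x\<bar> \<le> K" if p: "p \<in> cross_pairs" and x: "x \<in> set_pmf (pair_pmf_of p)" for p x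
  proof -
    obtain i j where ij: "p = (i, j)" by (cases p)
    have kK: "real (k i j) \<le> K" using k_bounds[of i j] p sub ij by (auto simp: bt_pairs_def)
    have "x \<le> k i j" using x set_pair_pmf_of[of i j] ij by simp
    moreover have "0 \<le> real (k i j) * logistic (\<beta> i - \<beta> j)" "real (k i j) * logistic (\<beta> i - \<beta> j) \<le> real (k i j) * 1"
      using logistic_bounds[of "\<beta> i - \<beta> j"] by (auto intro!: mult_left_le)
    ultimately have "\<bar>real x - k i j * logistic (\<beta> i - \<beta> j)\<bar> \<le> K" using kK by linarith
    then show ?thesis by (simp add: home_noise_def pair_noise_def ij abs_minus_commute)
  qed
  have A0: "real n / (2 * b) > 0" using n_pos b_pos by simp
  have cardR: "card R = r - 1" "card R \<ge> 2" using r3 by auto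
  have vsum: "(\<Sum>p\<in>cross_pairs. v (fst p) (snd p)) = (\<Sum>i\<in>R. A i)"
  proof -
    have "(\<Sum>p\<in>cross_pairs. v (fst p) (snd p)) = (\<Sum>i\<in>R. \<Sum>p\<in>{p \<in> cross_pairs. home p = i}. v (fst p) (snd p))"
      using sum.group[OF finc, of R home "\<lambda>p. v (fst p) (snd p)"] homeR by force
    also have "\<dots> = (\<Sum>i\<in>R. A i)" by (intro sum.cong refl var_cross)
    finally show ?thesis .
  qed
  \<comment> \<open>The summands 0 match the form of \<open>heat_kernel_expectation\<close> started
    at the origin with zero times.\<close>
  let ?x = "\<lambda>a i. 0 + (\<Sum>p\<in>{p \<in> cross_pairs. home p = i}. home_noise p (a p))"
  let ?T = "\<lambda>i. 0 + (\<Sum>p\<in>{p \<in> cross_pairs. home p = i}. v (fst p) (snd p))"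
  have "\<bar>measure_pmf.expectation (Pi_pmf cross_pairs 0 pair_pmf_of) (\<lambda>a. heat_kernel lam A R (\<lambda>_. 0) (?x a))
     - heat_kernel lam A R ?T (\<lambda>_. 0)\<bar> \<le> (4 * c ^ 3 * K + 12 * c ^ 4 * (real K)\<^sup>2) * (\<Sum>p\<in>cross_pairs. v (fst p) (snd p))"
    unfolding c_def
    by (rule heat_kernel_expectation[OF _ cardR(2) lam A0 _ _ finc])
       (use A_bounds(2) homeR mean var bd finite_set_pair_pmf_of in auto)
  also have "heat_kernel lam A R ?T (\<lambda>_. 0) = heat_kernel lam A R A (\<lambda>_. 0)"
    by (rule heat_kernel_cong) (auto simp: var_cross)
  also have "\<dots> = (1 + 2 * lam) powr (- real (r - 2) / 2)"
    using heat_kernel_end[of R A lam] A_bounds(4) sum_A(1) lam cardR by (simp add: numeral_2_eq_2)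
  also have "measure_pmf.expectation (Pi_pmf cross_pairs 0 pair_pmf_of) (\<lambda>a. heat_kernel lam A R (\<lambda>_. 0) (?x a))
     = measure_pmf.expectation data (\<lambda>a. exp (- lam * quad_stat a))"
  proof -
    have "measure_pmf.expectation (Pi_pmf cross_pairs 0 pair_pmf_of) (\<lambda>a. heat_kernel lam A R (\<lambda>_. 0) (?x a))
       = measure_pmf.expectation data (\<lambda>a. heat_kernel lam A R (\<lambda>_. 0) (?x (\<lambda>p. if p \<in> cross_pairs then a p else 0)))"
      unfolding data_eq Pi_pmf_subset[OF finite_pairs sub] by simp
    also have "\<dots> = measure_pmf.expectation data (\<lambda>a. exp (- lam * quad_stat a))"
    proof (intro integral_cong_AE)
      show "AE a in data. heat_kernel lam A R (\<lambda>_. 0) (?x (\<lambda>p. if p \<in> cross_pairs then a p else 0)) = exp (- lam * quad_stat a)"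
        unfolding AE_measure_pmf_iff
      proof
        fix a assume "a \<in> set_pmf data"
        then have v: "valid a" by (rule valid_data)
        have "heat_kernel lam A R (\<lambda>_. 0) (?x (\<lambda>p. if p \<in> cross_pairs then a p else 0)) = heat_kernel lam A R (\<lambda>_. 0) (score_S a)"
        proof (rule heat_kernel_cong)
          fix i assume i: "i \<in> R"
          have "?x (\<lambda>p. if p \<in> cross_pairs then a p else 0) i = (\<Sum>p\<in>{p \<in> cross_pairs. home p = i}. home_noise p (a p))"
            unfolding add_0 by (intro sum.cong) auto
          then show "?x (\<lambda>p. if p \<in> cross_pairs then a p else 0) i = score_S a i" using score_S_cross[OF v i] by simp
        qed simp
        also have "\<dots> = exp (- lam * quad_stat a)"
          unfolding quad_stat_def by (rule heat_kernel_start) (use A_bounds(4) sum_A in auto)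
        finally show "heat_kernel lam A R (\<lambda>_. 0) (?x (\<lambda>p. if p \<in> cross_pairs then a p else 0)) = exp (- lam * quad_stat a)" .
      qed
    qed auto
    finally show ?thesis .
  qed
  also have "(4 * c ^ 3 * K + 12 * c ^ 4 * (real K)\<^sup>2) * (\<Sum>p\<in>cross_pairs. v (fst p) (snd p)) \<le> (4 * c ^ 3 * K + 12 * c ^ 4 * (real K)\<^sup>2) * (real r * real n * K / 4)"
    unfolding vsum using lam b_pos by (intro mult_left_mono sum_A(2)) (auto simp: c_def intro!: add_nonneg_nonneg mult_nonneg_nonneg)
  finally show ?thesis .
qed

text \<open>Off the bad event the exponentials differ by at most \<open>lam\<close> times the
  distance of the two statistics; on it they both lie in [0, 1], so its probability suffices. In the
  replacement error \<open>c \<le> g * b / sqrt n\<close>, whence \<open>n * c ^ 3\<close> and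
  \<open>n * c ^ 4\<close> are also of order \<open>t\<close>.\<close>

lemma lr_stat_laplace:
  fixes l lam t g :: real
  assumes l1: "l \<ge> 1" and lam: "lam > 0"
  defines "t \<equiv> b ^ 5 * l ^ 3 / sqrt n"
  defines "g \<equiv> 1 + 2 * lam"
  assumes small: "100 * real r * (real K)\<^sup>2 * t \<le> 1"
  shows "\<bar>measure_pmf.expectation data (\<lambda>a. exp (- lam * bt_lr_stat n r k a)) - (1 + 2 * lam) powr (- real (r - 2) / 2)\<bar>
    \<le> 2 * (real n + real r) * exp (- 2 * l\<^sup>2) + (lam * 6000 * (real r ^ 3 * real K ^ 9) + (4 * K * g ^ 3 + 12 * (real K)\<^sup>2 * g ^ 4) * (real r * real K / 4)) * t"
proof -
  note small3 = corrector_scale_small[OF l1 small[unfolded t_def]]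
  define B1 where "B1 = (\<lambda>i. {a. valid a \<and> \<bar>score a i\<bar> \<ge> K * sqrt n * l})"
  define B2 where "B2 = (\<lambda>i. {a. valid a \<and> \<bar>\<Sum>m\<in>I. corrector i m * score a m\<bar> \<ge> real K * (4 * real r * real K * b\<^sup>2 / (real n)\<^sup>2) * n * l})"
  define Bad where "Bad = (\<Union>i\<in>I. B1 i) \<union> (\<Union>i\<in>R. B2 i)"
  have l0: "l \<ge> 0" using l1 by simp
  have pBad: "measure_pmf.prob data Bad \<le> 2 * (real n + real r) * exp (- 2 * l\<^sup>2)"
  proof -
    have "measure_pmf.prob data Bad \<le> measure_pmf.prob data (\<Union>i\<in>I. B1 i) + measure_pmf.prob data (\<Union>i\<in>R. B2 i)"
      unfolding Bad_def by (rule measure_Un_le) auto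
    also have "\<dots> \<le> (\<Sum>i\<in>I. measure_pmf.prob data (B1 i)) + (\<Sum>i\<in>R. measure_pmf.prob data (B2 i))"
      by (intro add_mono measure_UNION_le) auto
    also have "\<dots> \<le> (\<Sum>i\<in>I. 2 * exp (- 2 * l\<^sup>2)) + (\<Sum>i\<in>R. 2 * exp (- 2 * l\<^sup>2))"
      unfolding B1_def B2_def by (intro add_mono sum_mono prob_score_large prob_corrector_large l0 small3)
    also have "\<dots> = real (card I) * (2 * exp (- 2 * l\<^sup>2)) + real (card R) * (2 * exp (- 2 * l\<^sup>2))" by simp
    also have "\<dots> \<le> real n * (2 * exp (- 2 * l\<^sup>2)) + real r * (2 * exp (- 2 * l\<^sup>2))"
      by (intro add_mono mult_right_mono) auto
    finally show ?thesis by (simp add: algebra_simps)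
  qed
  define C where "C = 6000 * (real r ^ 3 * real K ^ 9 * t)"
  have t0: "t \<ge> 0" using b1 l1 by (simp add: t_def)
  have C0: "C \<ge> 0" using t0 by (simp add: C_def)
  have quad0: "quad_stat a \<ge> 0" for a unfolding quad_stat_def by (rule weighted_var_nonneg)
  have exp_lip: "\<bar>exp (- lam * x) - exp (- lam * y)\<bar> \<le> lam * \<bar>x - y\<bar>" if "x \<ge> 0" "y \<ge> 0" for x y
  proof -
    have *: "exp (- lam * x) - exp (- lam * y) \<le> lam * (y - x)" if "x \<ge> 0" "x \<le> y" for x y
    proof -
      have "exp (- lam * x) - exp (- lam * y) = exp (- lam * x) * (1 - exp (- (lam * (y - x))))"
        by (simp add: right_diff_distrib flip: exp_add)
      also have "\<dots> \<le> 1 * (lam * (y - x))"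
        using lam that exp_ge_add_one_self[of "- (lam * (y - x))"] by (intro mult_mono) auto
      finally show ?thesis by simp
    qed
    have mono: "exp (- lam * y) \<le> exp (- lam * x)" if "x \<le> y" for x y using that lam by simp
    show ?thesis
    proof (cases "x \<le> y")
      case True
      then show ?thesis using *[OF that(1) True] mono[OF True] by simp
    next
      case False
      then show ?thesis using *[OF that(2), of x] mono[of y x] by simp
    qed
  qed
  have int: "integrable data f" for f :: "_ \<Rightarrow> real" by (rule integrable_measure_pmf_finite[OF finite_set_data])
  have "\<bar>measure_pmf.expectation data (\<lambda>a. exp (- lam * bt_lr_stat n r k a)) - measure_pmf.expectation data (\<lambda>a. exp (- lam * quad_stat a))\<bar>
     = \<bar>measure_pmf.expectation data (\<lambda>a. exp (- lam * bt_lr_stat n r k a) - exp (- lam * quad_stat a))\<bar>"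
    by (simp only: Bochner_Integration.integral_diff[OF int int])
  also have "\<dots> \<le> measure_pmf.expectation data (\<lambda>a. \<bar>exp (- lam * bt_lr_stat n r k a) - exp (- lam * quad_stat a)\<bar>)"
    by (rule integral_abs_bound)
  also have "\<dots> \<le> measure_pmf.expectation data (\<lambda>a. lam * C + indicator Bad a)"
  proof (intro integral_mono_AE int)
    show "AE a in data. \<bar>exp (- lam * bt_lr_stat n r k a) - exp (- lam * quad_stat a)\<bar> \<le> lam * C + indicator Bad a"
      unfolding AE_measure_pmf_iff
    proof
      fix a assume "a \<in> set_pmf data"
      then have v: "valid a" by (rule valid_data)
      show "\<bar>exp (- lam * bt_lr_stat n r k a) - exp (- lam * quad_stat a)\<bar> \<le> lam * C + indicator Bad a"
      proof (cases "a \<in> Bad")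
        case True
        have e: "0 \<le> exp (- lam * x) \<and> exp (- lam * x) \<le> 1" if "x \<ge> 0" for x using that lam by simp
        have "\<bar>exp (- lam * bt_lr_stat n r k a) - exp (- lam * quad_stat a)\<bar> \<le> 1"
          using e[OF lr_stat_nonneg[OF v]] e[OF quad0[of a]] by linarith
        moreover have "0 \<le> lam * C" using lam C0 by simp
        ultimately show ?thesis using True by simp
      next
        case False
        have s1: "\<bar>score a i\<bar> \<le> K * sqrt n * l" if "i \<in> I" for i
          using False v that unfolding Bad_def B1_def by fastforce
        have s2: "\<bar>\<Sum>m\<in>I. corrector i m * score a m\<bar> \<le> real K * (4 * real r * real K * b\<^sup>2 / (real n)\<^sup>2) * n * l" if "i \<in> R" for i
        proof (rule ccontr)
          assume "\<not> ?thesis"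
          then have "a \<in> B2 i" using v by (simp add: B2_def)
          then show False using False that by (auto simp: Bad_def)
        qed
        have "\<bar>bt_lr_stat n r k a - quad_stat a\<bar> \<le> C"
          unfolding C_def t_def by (rule lr_stat_approx[OF v l1 small[unfolded t_def] s1 s2])
        then have "lam * \<bar>bt_lr_stat n r k a - quad_stat a\<bar> \<le> lam * C" using lam by (intro mult_left_mono) auto
        then show ?thesis using exp_lip[OF lr_stat_nonneg[OF v] quad0[of a]] False by simp
      qed
    qed
  qed
  also have "\<dots> = lam * C + measure_pmf.prob data Bad" by (simp add: int)
  finally have 1: "\<bar>measure_pmf.expectation data (\<lambda>a. exp (- lam * bt_lr_stat n r k a)) - measure_pmf.expectation data (\<lambda>a. exp (- lam * quad_stat a))\<bar>
     \<le> lam * C + 2 * (real n + real r) * exp (- 2 * l\<^sup>2)" using pBad by linarith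
  define N where "N = sqrt n"
  define c where "c = sqrt (lam / (real n / (2 * b)))"
  have N1: "N \<ge> 1" using n_pos by (simp add: N_def)
  have nN: "real n = N\<^sup>2" by (simp add: N_def)
  have g1: "g \<ge> 1" using lam by (simp add: g_def)
  have c0: "c \<ge> 0" using lam b_pos by (simp add: c_def)
  have c: "c \<le> g * b / N"
  proof -
    have "c = sqrt (2 * lam * b) / N" unfolding c_def N_def by (simp add: real_sqrt_divide)
    also have "2 * lam * b \<le> (g * b)\<^sup>2"
    proof -
      have "2 * lam \<le> g * g" using lam by (simp add: g_def algebra_simps)
      then have "2 * lam * b \<le> g * g * (b * b)" by (rule mult_mono) (use lam b1 in auto)
      then show ?thesis by (simp add: power2_eq_square mult_ac)
    qed
    then have "sqrt (2 * lam * b) / N \<le> sqrt ((g * b)\<^sup>2) / N" using N1 by (intro divide_right_mono real_sqrt_le_mono) auto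
    finally show ?thesis using g1 b1 by simp
  qed
  have c3: "c ^ 3 * n \<le> g ^ 3 * t"
  proof -
    have "c ^ 3 * n \<le> (g * b / N) ^ 3 * n" using c c0 by (intro mult_right_mono power_mono) auto
    also have "\<dots> = g ^ 3 * (b ^ 3 * l ^ 0 / N ^ 1)" unfolding nN using N1 by (simp add: power_mult_distrib power_divide eval_nat_numeral)
    also have "\<dots> \<le> g ^ 3 * t" unfolding t_def N_def[symmetric] using g1 by (intro mult_left_mono monomial_le[OF b1 l1 N1]) auto
    finally show ?thesis .
  qed
  have c4: "c ^ 4 * n \<le> g ^ 4 * t"
  proof -
    have "c ^ 4 * n \<le> (g * b / N) ^ 4 * n" using c c0 by (intro mult_right_mono power_mono) auto
    also have "\<dots> = g ^ 4 * (b ^ 4 * l ^ 0 / N ^ 2)" unfolding nN using N1 by (simp add: power_mult_distrib power_divide eval_nat_numeral)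
    also have "\<dots> \<le> g ^ 4 * t" unfolding t_def N_def[symmetric] using g1 by (intro mult_left_mono monomial_le[OF b1 l1 N1]) auto
    finally show ?thesis .
  qed
  have "\<bar>measure_pmf.expectation data (\<lambda>a. exp (- lam * quad_stat a)) - (1 + 2 * lam) powr (- real (r - 2) / 2)\<bar>
     \<le> (4 * c ^ 3 * K + 12 * c ^ 4 * (real K)\<^sup>2) * (real r * real n * K / 4)"
    unfolding c_def by (rule quad_stat_laplace[OF lam])
  also have "\<dots> = (4 * K * (c ^ 3 * n) + 12 * (real K)\<^sup>2 * (c ^ 4 * n)) * (real r * K / 4)" by (simp add: algebra_simps)
  also have "\<dots> \<le> (4 * K * (g ^ 3 * t) + 12 * (real K)\<^sup>2 * (g ^ 4 * t)) * (real r * K / 4)"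
    using c3 c4 by (intro mult_right_mono add_mono mult_left_mono) auto
  also have "\<dots> = (4 * K * g ^ 3 + 12 * (real K)\<^sup>2 * g ^ 4) * (real r * real K / 4) * t" by (simp add: algebra_simps)
  finally have 2: "\<bar>measure_pmf.expectation data (\<lambda>a. exp (- lam * quad_stat a)) - (1 + 2 * lam) powr (- real (r - 2) / 2)\<bar>
     \<le> (4 * K * g ^ 3 + 12 * (real K)\<^sup>2 * g ^ 4) * (real r * real K / 4) * t" .
  have 3: "(lam * 6000 * (real r ^ 3 * real K ^ 9) + (4 * K * g ^ 3 + 12 * (real K)\<^sup>2 * g ^ 4) * (real r * real K / 4)) * t
     = lam * C + (4 * K * g ^ 3 + 12 * (real K)\<^sup>2 * g ^ 4) * (real r * real K / 4) * t"
    by (simp add: C_def distrib_right mult.assoc)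
  show ?thesis unfolding 3 using 1 2 by linarith
qed

end

section \<open>The limit theorem\<close>

lemma inverse_dlogistic: "(1 + exp t)\<^sup>2 / exp t = 1 / dlogistic t"
  by (simp add: dlogistic_def)

lemma finite_bt_ratios:
  "finite {(1 + exp (\<beta> i - \<beta> j))^2 / exp (\<beta> i - \<beta> j) | i j. i \<in> {1..n} \<and> j \<in> {1..n} \<and> i \<noteq> (j::nat)}"
proof (rule finite_subset)
  show "{(1 + exp (\<beta> i - \<beta> j))^2 / exp (\<beta> i - \<beta> j) | i j. i \<in> {1..n} \<and> j \<in> {1..n} \<and> i \<noteq> j}
    \<subseteq> (\<lambda>(i, j). (1 + exp (\<beta> i - \<beta> j))^2 / exp (\<beta> i - \<beta> j)) ` ({1..n} \<times> {1..n})" by auto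
qed auto

lemma bt_b_ge:
  assumes "i \<in> {1..n}" "j \<in> {1..n}" "i \<noteq> j"
  shows "1 / dlogistic (\<beta> i - \<beta> j) \<le> bt_b n \<beta>"
  unfolding bt_b_def inverse_dlogistic[symmetric]
  by (rule Max_ge[OF finite_bt_ratios]) (use assms in blast)

lemma bt_c_le:
  assumes "i \<in> {1..n}" "j \<in> {1..n}" "i \<noteq> j"
  shows "bt_c n \<beta> \<le> 1 / dlogistic (\<beta> i - \<beta> j)"
  unfolding bt_c_def inverse_dlogistic[symmetric]
  by (rule Min_le[OF finite_bt_ratios]) (use assms in blast)

lemma bt_c_pos:
  assumes "i \<in> {1..n}" "j \<in> {1..n}" "i \<noteq> j"
  shows "bt_c n \<beta> > 0"
proof -
  have "bt_c n \<beta> \<in> {(1 + exp (\<beta> i - \<beta> j))^2 / exp (\<beta> i - \<beta> j) | i j. i \<in> {1..n} \<and> j \<in> {1..n} \<and> i \<noteq> j}"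
    unfolding bt_c_def by (rule Min_in[OF finite_bt_ratios]) (use assms in blast)
  then show ?thesis by (auto intro!: divide_pos_pos zero_less_power)
qed

theorem theorem4:
  fixes K r :: nat
    and k :: "nat \<Rightarrow> nat \<Rightarrow> nat \<Rightarrow> nat"
    and \<beta> :: "nat \<Rightarrow> nat \<Rightarrow> real"
  assumes r_gt: "r > 2"
    and k_sym: "\<And>n i j. k n i j = k n j i"
    and k_range: "\<And>n i j. 1 \<le> i \<Longrightarrow> i < j \<Longrightarrow> j \<le> n \<Longrightarrow> k n i j \<in> {1..K}"
    and beta1: "\<And>n. \<beta> n 1 = 0"
    and H0: "\<And>n i. i \<in> {2..r} \<Longrightarrow> \<beta> n i = \<beta> n 2"
    and rate: "(\<lambda>n. bt_b n (\<beta> n) ^ 11 / bt_c n (\<beta> n) ^ 6)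
               \<in> o(\<lambda>n. sqrt (real n) / ln (real n) powr (5 / 2))"
  shows "weak_conv_m (\<lambda>n. measure_pmf (map_pmf (bt_lr_stat n r (k n)) (bt_data n (k n) (\<beta> n))))
           (chi_square (r - 2))"
proof -
  define b where "b = (\<lambda>n. bt_b n (\<beta> n))"
  \<comment> \<open>With this choice \<open>exp (- 2 * (l n)\<^sup>2)\<close> is
    \<open>1 / n\<^sup>2\<close>, small enough for a union bound over the \<open>n\<close>
    scores.\<close>
  define l where "l = (\<lambda>n. sqrt (ln (real n)))"
  define t where "t = (\<lambda>n. b n ^ 5 * l n ^ 3 / sqrt (real n))"
  define \<mu> where "\<mu> = (\<lambda>n. map_pmf (bt_lr_stat n r (k n)) (bt_data n (k n) (\<beta> n)))"
  define err where "err = (\<lambda>n. \<bar>bt_b n (\<beta> n) ^ 11 / bt_c n (\<beta> n) ^ 6 / (sqrt (real n) / ln (real n) powr (5 / 2))\<bar>)"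
  have b1: "b n \<ge> 1" if "n \<ge> 2 * r" for n
  proof -
    have "4 \<le> 1 / dlogistic (\<beta> n 1 - \<beta> n 2)"
      using dlogistic_le[of "\<beta> n 1 - \<beta> n 2"] dlogistic_pos[of "\<beta> n 1 - \<beta> n 2"] by (simp add: field_simps)
    also have "\<dots> \<le> b n" unfolding b_def by (rule bt_b_ge) (use that r_gt in auto)
    finally show ?thesis by simp
  qed
  have bt: "bradley_terry n r K (k n) (\<beta> n) (b n)" if n: "n \<ge> 2 * r" for n
  proof
    show "1 / b n \<le> dlogistic (\<beta> n i - \<beta> n j)" if "i \<in> {1..n}" "j \<in> {1..n}" "i \<noteq> j" for i j
      using bt_b_ge[OF that, of "\<beta> n"] b1[OF n] dlogistic_pos[of "\<beta> n i - \<beta> n j"] by (simp add: b_def field_simps)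
    show "3 \<le> r" using r_gt by simp
    show "2 * r \<le> n" by (rule n)
    show "k n i j = k n j i" for i j by (rule k_sym)
    show "k n i j \<in> {1..K}" if "1 \<le> i" "i < j" "j \<le> n" for i j using that by (rule k_range)
    show "\<beta> n 1 = 0" by (rule beta1)
    show "\<beta> n i = \<beta> n 2" if "i \<in> {2..r}" for i using that by (rule H0)
    show "1 \<le> b n" by (rule b1[OF n])
  qed
  have l1: "l n \<ge> 1" if "n \<ge> 2 * r" for n
  proof -
    have "exp 1 \<le> (3::real)" by (rule exp_le)
    also have "3 \<le> real n" using that r_gt by simp
    finally have "ln (exp 1) \<le> ln (real n)" by (intro ln_mono) auto
    then show ?thesis by (simp add: l_def)
  qed
  have t0: "t n \<ge> 0" if "n \<ge> 2 * r" for n using b1[OF that] l1[OF that] by (simp add: t_def)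
  have "err \<longlonglongrightarrow> 0"
    unfolding err_def using tendsto_rabs_zero[OF smalloD_tendsto[OF rate]] by simp
  \<comment> \<open>Items 2 and 3 have equal parameters because \<open>r \<ge> 3\<close>, so
    \<open>c \<le> 1 / dlogistic 0 = 4\<close>, and 4096 is \<open>4 ^ 6\<close>. Since
    \<open>b n \<ge> 1\<close> and \<open>ln n \<ge> 1\<close>, the power 5 of \<open>b n\<close>
    may be raised to 11 and the power 3 / 2 of \<open>ln n\<close> to 5 / 2.\<close>
  have t_le: "t n \<le> 4096 * err n" if n: "n \<ge> 2 * r" for n
  proof -
    define c where "c = bt_c n (\<beta> n)"
    have "c \<le> 1 / dlogistic (\<beta> n 2 - \<beta> n 3)" unfolding c_def by (rule bt_c_le) (use n r_gt in auto)
    also have "\<beta> n 3 = \<beta> n 2" using H0[of 3 n] r_gt by simp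
    finally have c4: "c \<le> 4" by (simp add: dlogistic_def)
    have c0: "c > 0" unfolding c_def by (rule bt_c_pos[of 1 _ 2]) (use n r_gt in auto)
    have "c ^ 6 \<le> 4 ^ 6" using c0 c4 by (intro power_mono) auto
    then have c6: "1 \<le> 4096 / c ^ 6" using c0 by simp
    have ln1: "ln (real n) \<ge> 1" using l1[OF n] by (simp add: l_def)
    have "l n ^ 3 = ln (real n) powr (3 / 2)"
      using ln1 by (simp add: l_def powr_half_sqrt[symmetric] powr_powr flip: powr_realpow)
    also have "\<dots> \<le> ln (real n) powr (5 / 2)" using ln1 by (intro powr_mono) auto
    finally have l3: "l n ^ 3 \<le> ln (real n) powr (5 / 2)" .
    have b5: "b n ^ 5 * 1 \<le> b n ^ 11 * (4096 / c ^ 6)"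
      using b1[OF n] c6 by (intro mult_mono power_increasing) auto
    have "b n ^ 5 * 1 * l n ^ 3 / sqrt (real n) \<le> b n ^ 11 * (4096 / c ^ 6) * ln (real n) powr (5 / 2) / sqrt (real n)"
      by (rule divide_right_mono, rule mult_mono) (use b5 b1[OF n] c0 l3 l1[OF n] in auto)
    also have "\<dots> = 4096 * (b n ^ 11 / c ^ 6 / (sqrt (real n) / ln (real n) powr (5 / 2)))" by simp
    also have "\<dots> \<le> 4096 * err n" unfolding err_def b_def c_def by (intro mult_left_mono abs_ge_self) simp
    finally show ?thesis by (simp add: t_def)
  qed
  have "t \<longlonglongrightarrow> 0"
  proof (rule tendsto_sandwich[where f = "\<lambda>_. 0" and h = "\<lambda>n. 4096 * err n"])
    show "eventually (\<lambda>n. 0 \<le> t n) sequentially" using t0 by (rule eventually_sequentiallyI)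
    show "eventually (\<lambda>n. t n \<le> 4096 * err n) sequentially" using t_le by (rule eventually_sequentiallyI)
    show "(\<lambda>n. 4096 * err n) \<longlonglongrightarrow> 0" using tendsto_mult_left[OF \<open>err \<longlonglongrightarrow> 0\<close>, of 4096] by simp
  qed simp
  have laplace: "(\<lambda>n. measure_pmf.expectation (\<mu> n) (\<lambda>x. exp (- real m * x)))
      \<longlonglongrightarrow> integral\<^sup>L (chi_square (r - 2)) (\<lambda>x. exp (- real m * x))" if m: "m > 0" for m :: nat
  proof -
    define g where "g = 1 + 2 * real m"
    define C where "C = real m * 6000 * (real r ^ 3 * real K ^ 9) + (4 * K * g ^ 3 + 12 * (real K)\<^sup>2 * g ^ 4) * (real r * real K / 4)"
    have chi: "integral\<^sup>L (chi_square (r - 2)) (\<lambda>x. exp (- real m * x)) = g powr (- real (r - 2) / 2)"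
      using chi_square_laplace[of "r - 2" "real m"] r_gt by (simp add: g_def)
    have "eventually (\<lambda>n. \<bar>100 * real r * (real K)\<^sup>2 * t n\<bar> < 1) sequentially"
    proof -
      have "(\<lambda>n. 100 * real r * (real K)\<^sup>2 * t n) \<longlonglongrightarrow> 0"
        using tendsto_mult_left[OF \<open>t \<longlonglongrightarrow> 0\<close>, of "100 * real r * (real K)\<^sup>2"] by simp
      from order_tendstoD(2)[OF tendsto_rabs_zero[OF this], of 1] show ?thesis by simp
    qed
    then have "eventually (\<lambda>n. norm (measure_pmf.expectation (\<mu> n) (\<lambda>x. exp (- real m * x)) - g powr (- real (r - 2) / 2))
        \<le> 4 / real n + C * t n) sequentially"
      using eventually_ge_at_top[of "2 * r"]
    proof eventually_elim
      case (elim n)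
      interpret bradley_terry n r K "k n" "\<beta> n" "b n" by (rule bt[OF elim(2)])
      have "100 * real r * (real K)\<^sup>2 * (b n ^ 5 * l n ^ 3 / sqrt (real n)) \<le> 1"
        using elim(1) unfolding t_def by linarith
      from lr_stat_laplace[OF l1[OF elim(2)] _ this, of "real m"] m
      have "\<bar>measure_pmf.expectation (\<mu> n) (\<lambda>x. exp (- real m * x)) - g powr (- real (r - 2) / 2)\<bar>
         \<le> 2 * (real n + real r) * exp (- 2 * (l n)\<^sup>2) + C * t n"
        by (simp add: \<mu>_def C_def g_def t_def)
      also have "2 * (real n + real r) * exp (- 2 * (l n)\<^sup>2) \<le> 4 / real n"
      proof -
        have n: "real n > 0" "real r \<le> real n" using elim(2) r_gt by auto
        have "ln (real n) \<ge> 0" using l1[OF elim(2)] by (simp add: l_def)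
        then have "exp (- 2 * (l n)\<^sup>2) = 1 / (exp (ln (real n)))\<^sup>2"
          by (simp add: l_def exp_minus exp_double inverse_eq_divide)
        then have "2 * (real n + real r) * exp (- 2 * (l n)\<^sup>2) = 2 * (real n + real r) / (real n)\<^sup>2" using n by simp
        also have "\<dots> \<le> 2 * (real n + real n) / (real n)\<^sup>2" using n by (intro divide_right_mono) auto
        also have "\<dots> = 4 / real n" using n by (simp add: power2_eq_square)
        finally show ?thesis .
      qed
      finally show ?case by simp
    qed
    moreover have "(\<lambda>n. 4 / real n + C * t n) \<longlonglongrightarrow> 0"
      using tendsto_add[OF lim_const_over_n[of 4] tendsto_mult_left[OF \<open>t \<longlonglongrightarrow> 0\<close>, of C]] by simp
    ultimately have "(\<lambda>n. measure_pmf.expectation (\<mu> n) (\<lambda>x. exp (- real m * x)) - g powr (- real (r - 2) / 2)) \<longlonglongrightarrow> 0"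
      by (rule Lim_null_comparison)
    then show ?thesis unfolding chi by (rule LIM_zero_cancel)
  qed
  \<comment> \<open>The model facts are available from \<open>n = 2 * r\<close> on, while the
    convergence criterion asks for nonnegative values at every index; hence the shift, removed
    afterwards.\<close>
  have "weak_conv_m (\<lambda>n. measure_pmf (\<mu> (n + 2 * r))) (chi_square (r - 2))"
  proof (rule weak_conv_m_of_laplace)
    show "real_distribution (chi_square (r - 2))" using r_gt by (intro real_distribution_chi_square) simp
    show "AE x in chi_square (r - 2). 0 \<le> x" by (rule AE_chi_square_nonneg)
    show "0 \<le> x" if "x \<in> set_pmf (\<mu> (n + 2 * r))" for n x
    proof -
      interpret bradley_terry "n + 2 * r" r K "k (n + 2 * r)" "\<beta> (n + 2 * r)" "b (n + 2 * r)" by (rule bt) simp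
      show ?thesis using that valid_data lr_stat_nonneg by (auto simp: \<mu>_def)
    qed
    show "(\<lambda>n. measure_pmf.expectation (\<mu> (n + 2 * r)) (\<lambda>x. exp (- real m * x)))
      \<longlonglongrightarrow> integral\<^sup>L (chi_square (r - 2)) (\<lambda>x. exp (- real m * x))" if "m > 0" for m :: nat
      using LIMSEQ_ignore_initial_segment[OF laplace[OF that], of "2 * r"] .
  qed
  then have "weak_conv_m (\<lambda>n. measure_pmf (\<mu> n)) (chi_square (r - 2))"
    unfolding weak_conv_m_def weak_conv_def by (auto intro: LIMSEQ_offset[where k = "2 * r"])
  then show ?thesis by (simp only: \<mu>_def)
qed

end
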